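(* Suppose $\{E_j\}_{j=0,1,2}$, with $\chi_{E_j}\in BV(B_R)$, is V-permissible in $B_R\subset\mathbb{R}^n$ and is made up of sets of finite perimeter, and suppose $\Psi_V(\{E_j\},A)=0$ for every $A\subset\subset B_R$. Then there is a constant $C$ (depending on the triple but not on $\rho,r$) such that for all $0<\rho<r<R$ $$\rho^{1-n}\mathcal{F}_S(\{E_j\},B_\rho)+C\rho+\sum_{j=0}^2\frac{\alpha_j}{8}\int_{B_r\setminus B_\rho}|x|^{1-n}\left\langle\frac{x}{|x|},\frac{D\chi_{E_j}}{|D\chi_{E_j}|}\right\rangle^4|D\chi_{E_j}|\ \le\ r^{1-n}\mathcal{F}_S(\{E_j\},B_r)+Cr.$$
   Context: $B_t$ is the open ball of radius $t$ centered at $0$. $D\chi_{E}$ is the vector-valued Radon measure derivative of $\chi_E$, $|D\chi_E|$ its total variation measure, and $D\chi_E/|D\chi_E|$ the Radon–Nikodym density. Constants: $\sigma_{01},\sigma_{02},\sigma_{12}$ are surface tensions, $\alpha_0=\frac12(\sigma_{01}+\sigma_{02}-\sigma_{12})$, $\alpha_1=\frac12(\sigma_{01}+\sigma_{12}-\sigma_{02})$, $\alpha_2=\frac12(\sigma_{02}+\sigma_{12}-\sigma_{01})$, and $\alpha_j>0$ for all $j$. A triple of open sets $\{E_j\}$ is permissible in $\Omega$ (here $\Omega=B_R$) if the $E_j$ are disjoint sets of finite perimeter and the union of their closures is $\overline{\Omega}$; it is V-permissible if moreover $|E_j|=v_j$ for prescribed $v_j$, $j=0,1,2$. $\mathcal{F}_S(\{E_j\},\Omega')=\sum_{j=0}^2\alpha_j\int_{\Omega'}|D\chi_{E_j}|$.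 For $\Omega'\subset\subset\Omega$, $$\Upsilon_V(\{E_j\},\Omega')=\inf\{\mathcal{F}_S(\{\tilde E_j\},\Omega'):\ \mathrm{spt}(\chi_{E_j}-\chi_{\tilde E_j})\subset\Omega' \text{ for all } j,\ \{\tilde E_j\}\text{ V-permissible (same volumes)}\},$$ $$\Psi_V(\{E_j\},\Omega')=\mathcal{F}_S(\{E_j\},\Omega')-\Upsilon_V(\{E_j\},\Omega').$$ *)

theory Defs
  imports "HOL-Analysis.Analysis"
begin

subsection \<open>Vector-valued measures\<close>

text \<open>
  An \<open>'b\<close>-valued measure on the Borel subsets of \<open>\<Omega>\<close>, as a set function; its values on other sets
  are irrelevant. For Euclidean \<open>'b\<close> such a measure has finite total variation, hence on an open
  subset of a Euclidean space it is automatically a finite Radon measure.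
\<close>

definition vector_measure ::
    "'a::topological_space set \<Rightarrow> ('a set \<Rightarrow> 'b::real_normed_vector) \<Rightarrow> bool" where
  "vector_measure \<Omega> D \<longleftrightarrow>
     D {} = 0 \<and>
     (\<forall>A :: nat \<Rightarrow> 'a set. range A \<subseteq> sets (restrict_space borel \<Omega>) \<longrightarrow> disjoint_family A \<longrightarrow>
        (\<lambda>i. D (A i)) sums D (\<Union>i. A i))"

definition total_variation ::
    "'a::topological_space set \<Rightarrow> ('a set \<Rightarrow> 'b::real_normed_vector) \<Rightarrow> 'a measure" where
  "total_variation \<Omega> D =
     measure_of \<Omega> (sets (restrict_space borel \<Omega>))
       (\<lambda>B. SUP A \<in> {A :: nat \<Rightarrow> 'a set. range A \<subseteq> sets (restrict_space borel \<Omega>) \<and>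
                       disjoint_family A \<and> (\<Union>i. A i) = B}.
              \<Sum>i. ennreal (norm (D (A i))))"

text \<open>The Radon--Nikodym density \<open>D/|D|\<close>, unique up to \<open>|D|\<close>-null sets.\<close>

definition rn_density ::
    "'a::topological_space set \<Rightarrow> ('a set \<Rightarrow> 'b::euclidean_space) \<Rightarrow> 'a \<Rightarrow> 'b" where
  "rn_density \<Omega> D =
     (SOME g. integrable (total_variation \<Omega> D) g \<and>
        (\<forall>B \<in> sets (restrict_space borel \<Omega>). D B = (LINT x:B|total_variation \<Omega> D. g x)))"

text \<open>\<open>\<integral> \<langle>\<phi>, dD\<rangle>\<close>\<close>

definition vm_integral ::
    "'a::topological_space set \<Rightarrow> ('a set \<Rightarrow> 'b::euclidean_space) \<Rightarrow> ('a \<Rightarrow> 'b) \<Rightarrow> real" where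
  "vm_integral \<Omega> D \<phi> = (LINT x|total_variation \<Omega> D. \<phi> x \<bullet> rn_density \<Omega> D x)"

subsection \<open>Functions of bounded variation and sets of finite perimeter\<close>

definition spt :: "('a::topological_space \<Rightarrow> 'b::zero) \<Rightarrow> 'a set" where
  "spt f = closure {x. f x \<noteq> 0}"

text \<open>\<open>C\<^sup>1\<close> vector fields with compact support in \<open>\<Omega>\<close>\<close>

definition C1c_fields :: "'a::euclidean_space set \<Rightarrow> ('a \<Rightarrow> 'a) set" where
  "C1c_fields \<Omega> =
     {\<phi>. (\<exists>\<phi>' :: 'a \<Rightarrow> ('a \<Rightarrow>\<^sub>L 'a).
            (\<forall>x. (\<phi> has_derivative blinfun_apply (\<phi>' x)) (at x)) \<and> continuous_on UNIV \<phi>') \<and>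
         compact (spt \<phi>) \<and> spt \<phi> \<subseteq> \<Omega>}"

definition divergence :: "('a::euclidean_space \<Rightarrow> 'a) \<Rightarrow> 'a \<Rightarrow> real" where
  "divergence \<phi> x = (\<Sum>b\<in>Basis. frechet_derivative \<phi> (at x) b \<bullet> b)"

text \<open>\<open>D\<close> represents the distributional gradient of \<open>u\<close> in \<open>\<Omega>\<close>.\<close>

definition derivative_measure ::
    "'a::euclidean_space set \<Rightarrow> ('a \<Rightarrow> real) \<Rightarrow> ('a set \<Rightarrow> 'a) \<Rightarrow> bool" where
  "derivative_measure \<Omega> u D \<longleftrightarrow>
     vector_measure \<Omega> D \<and>
     (\<forall>\<phi> \<in> C1c_fields \<Omega>. (LINT x:\<Omega>|lebesgue. u x * divergence \<phi> x) = - vm_integral \<Omega> D \<phi>)"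

definition BV :: "'a::euclidean_space set \<Rightarrow> ('a \<Rightarrow> real) set" where
  "BV \<Omega> = {u. set_integrable lebesgue \<Omega> u \<and> (\<exists>D. derivative_measure \<Omega> u D)}"

text \<open>
  \<open>E\<close> need not have finite Lebesgue measure in \<open>\<Omega>\<close> here; for bounded \<open>\<Omega>\<close> this is the same as
  \<open>indicator E \<in> BV \<Omega>\<close>.
\<close>

definition finite_perimeter :: "'a::euclidean_space set \<Rightarrow> 'a set \<Rightarrow> bool" where
  "finite_perimeter \<Omega> E \<longleftrightarrow>
     E \<inter> \<Omega> \<in> sets lebesgue \<and> (\<exists>D. derivative_measure \<Omega> (indicator E) D)"

text \<open>
  \<open>D\<chi>\<^sub>E\<close> in \<open>\<Omega>\<close>. It is determined on the Borel subsets of \<open>\<Omega>\<close>, where alone it is used; elsewhere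
  its values are arbitrary, whence SOME instead of THE.
\<close>

definition Dchi :: "'a::euclidean_space set \<Rightarrow> 'a set \<Rightarrow> 'a set \<Rightarrow> 'a" where
  "Dchi \<Omega> E = (SOME D. derivative_measure \<Omega> (indicator E) D)"

subsection \<open>The three-fluid functional\<close>

definition alpha :: "real \<Rightarrow> real \<Rightarrow> real \<Rightarrow> nat \<Rightarrow> real" where
  "alpha \<sigma>01 \<sigma>02 \<sigma>12 j =
     (if j = 0 then (\<sigma>01 + \<sigma>02 - \<sigma>12) / 2
      else if j = 1 then (\<sigma>01 + \<sigma>12 - \<sigma>02) / 2
      else (\<sigma>02 + \<sigma>12 - \<sigma>01) / 2)"

text \<open>Triples are functions on \<open>nat\<close> of which only the values at 0, 1, 2 matter.\<close>

definition permissible :: "'a::euclidean_space set \<Rightarrow> (nat \<Rightarrow> 'a set) \<Rightarrow> bool" where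
  "permissible \<Omega> E \<longleftrightarrow>
     (\<forall>j\<le>2. open (E j) \<and> finite_perimeter \<Omega> (E j)) \<and>
     disjoint_family_on E {..2} \<and>
     (\<Union>j\<le>2. closure (E j)) = closure \<Omega>"

definition V_permissible ::
    "'a::euclidean_space set \<Rightarrow> (nat \<Rightarrow> real) \<Rightarrow> (nat \<Rightarrow> 'a set) \<Rightarrow> bool" where
  "V_permissible \<Omega> v E \<longleftrightarrow> permissible \<Omega> E \<and> (\<forall>j\<le>2. emeasure lebesgue (E j) = ennreal (v j) \<and> 0 \<le> v j)"

text \<open>\<open>\<Omega>\<close> is the ambient set in which the triple lives, \<open>U\<close> the Borel subset of \<open>\<Omega>\<close> of integration.\<close>

definition F_S ::
    "(nat \<Rightarrow> real) \<Rightarrow> 'a::euclidean_space set \<Rightarrow> (nat \<Rightarrow> 'a set) \<Rightarrow> 'a set \<Rightarrow> real" where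
  "F_S \<alpha> \<Omega> E U = (\<Sum>j\<le>2. \<alpha> j * measure (total_variation \<Omega> (Dchi \<Omega> (E j))) U)"

definition compactly_inside :: "'a::euclidean_space set \<Rightarrow> 'a set \<Rightarrow> bool"
    (infix \<open>\<subset>\<subset>\<close> 50) where
  "U \<subset>\<subset> \<Omega> \<longleftrightarrow> open U \<and> compact (closure U) \<and> closure U \<subseteq> \<Omega>"

definition Upsilon_V ::
    "(nat \<Rightarrow> real) \<Rightarrow> 'a::euclidean_space set \<Rightarrow> (nat \<Rightarrow> real) \<Rightarrow> (nat \<Rightarrow> 'a set) \<Rightarrow> 'a set \<Rightarrow> real" where
  "Upsilon_V \<alpha> \<Omega> v E U =
     Inf {F_S \<alpha> \<Omega> E' U | E'.
            V_permissible \<Omega> v E' \<and>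
            (\<forall>j\<le>2. spt (\<lambda>x. indicator (E j) x - indicator (E' j) x :: real) \<subseteq> U)}"

definition Psi_V ::
    "(nat \<Rightarrow> real) \<Rightarrow> 'a::euclidean_space set \<Rightarrow> (nat \<Rightarrow> real) \<Rightarrow> (nat \<Rightarrow> 'a set) \<Rightarrow> 'a set \<Rightarrow> real" where
  "Psi_V \<alpha> \<Omega> v E U = F_S \<alpha> \<Omega> E U - Upsilon_V \<alpha> \<Omega> v E U"

end

(*
The monotonicity formula follows from testing stationarity with the radial field
X(x) = (max(|x|,rho)^(1-n) - r^(1-n))_+ x.

Only the deformations phi(x) = x + t eta(x) e in a fixed direction e are needed, because the first
variation is linear in the field and X is the sum of its components X_e e. The Jacobian of phi is
1 + t d_e eta, so the volumes of the images depend on t in an exactly affine way: if the integrals of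
d_e eta over all E_j vanish, then all volumes are preserved, and no implicit function theorem is needed
to construct admissible competitors. Elementary linear algebra then gives, for every direction e,
multipliers c_(e,j) for which the first variation in direction e is the sum of c_(e,j) times the
integral of d_e eta over E_j. For a nonincreasing profile the divergence theorem bounds the
right-hand side for X by a constant times the integral of max(|x|,rho)^(1-n) - r^(1-n) over B_r,
which equals (n-1) |B_1| (r - rho) and accounts for the term C (r - rho).

The perimeter of phi(E) is controlled through the transported measure with density
J nu - t (e . nu) grad eta, whose norm is at most 1 + t (d_e eta - (e . nu) d_nu eta) + O(t^2).
*)
theory Submission
  imports Defs
begin

subsection \<open>Total variation of a vector measure\<close>

text \<open>The derivative of a one-directional shear is the identity plus a rank-one map, so its
  cofactor matrix is explicit and polynomial in t. Piola's identity becomes a finite computation,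
  and the change of variables reduces to translation invariance of Lebesgue measure and
  differentiation under the integral sign.

  The multipliers are fixed for the coordinate directions before any profile is chosen, hence before
  \<rho> and r; this is what makes C independent of both radii.

  Inequalities suffice in two places. An upper bound for the total variation of the transported
  measure is enough, because minimality compares in that direction. For the density \<nu> of the
  perimeter, \<open>norm \<nu> \<le> 1\<close> is enough, because \<nu> enters through the
  coefficient n - |\<nu>|^2, which is then at least n - 1.

  The computation yields the weight c^2, with c the inner product of x/|x| and \<nu>; since |c|
  \<le> 1 it dominates c^4/8. The final estimate carries a factor n - 1 on both sides, so dimension
  one is handled apart; there the claim is almost bare monotonicity of the perimeter
  measures.\<close>

lemma suminf_swap_ennreal:
  fixes f :: "nat \<Rightarrow> nat \<Rightarrow> ennreal"
  shows "(\<Sum>i. \<Sum>j. f i j) = (\<Sum>j. \<Sum>i. f i j)"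
proof -
  have "(\<Sum>i. \<Sum>j. f i j) = (\<integral>\<^sup>+i. (\<Sum>j. f i j) \<partial>count_space UNIV)"
    by (simp add: nn_integral_count_space_nat)
  also have "\<dots> = (\<Sum>j. \<integral>\<^sup>+i. f i j \<partial>count_space UNIV)"
    by (rule nn_integral_suminf) simp
  finally show ?thesis by (simp add: nn_integral_count_space_nat)
qed

lemma ennreal_norm_sums_le:
  fixes f :: "nat \<Rightarrow> 'b::real_normed_vector"
  assumes "f sums s"
  shows "ennreal (norm s) \<le> (\<Sum>i. ennreal (norm (f i)))"
proof (rule LIMSEQ_le)
  show "(\<lambda>n. ennreal (norm (\<Sum>i<n. f i))) \<longlonglongrightarrow> ennreal (norm s)"
    using assms unfolding sums_def by (intro tendsto_intros)
  show "(\<lambda>n. \<Sum>i<n. ennreal (norm (f i))) \<longlonglongrightarrow> (\<Sum>i. ennreal (norm (f i)))"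
    by (rule summable_LIMSEQ) simp
  show "\<exists>N. \<forall>n\<ge>N. ennreal (norm (\<Sum>i<n. f i)) \<le> (\<Sum>i<n. ennreal (norm (f i)))"
    by (auto intro!: exI[of _ 0] ennreal_leI norm_sum)
qed

locale vec_measure =
  fixes \<Omega> :: "'a::topological_space set" and D :: "'a set \<Rightarrow> 'b::euclidean_space"
  assumes vm: "vector_measure \<Omega> D"
begin

abbreviation "S \<equiv> sets (restrict_space borel \<Omega>)"
abbreviation "TV \<equiv> total_variation \<Omega> D"

definition partitions :: "'a set \<Rightarrow> (nat \<Rightarrow> 'a set) set" where
  "partitions B = {A. range A \<subseteq> S \<and> disjoint_family A \<and> (\<Union>i. A i) = B}"

text \<open>The set function inside \<open>total_variation\<close>. Since \<open>measure_of\<close>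
  returns it only once it is known to be a measure, it is studied on its own first.\<close>

definition tv :: "'a set \<Rightarrow> ennreal" where
  "tv B = (SUP A \<in> partitions B. \<Sum>i. ennreal (norm (D (A i))))"

lemma D_empty [simp]: "D {} = 0"
  using vm by (simp add: vector_measure_def)

lemma D_sums: "range A \<subseteq> S \<Longrightarrow> disjoint_family A \<Longrightarrow> (\<lambda>i. D (A i)) sums D (\<Union>i. A i)"
  using vm unfolding vector_measure_def by blast

lemma space_S: "space (restrict_space borel \<Omega>) = \<Omega>"
  by (simp add: space_restrict_space)

lemma sigma_algebra_S: "sigma_algebra \<Omega> S"
  using sets.sigma_algebra_axioms[of "restrict_space borel \<Omega>"] by (simp add: space_S)

lemma S_subset: "B \<in> S \<Longrightarrow> B \<subseteq> \<Omega>"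
  using sets.sets_into_space[of B "restrict_space borel \<Omega>"] by (simp add: space_S)

lemma Omega_in_S [simp]: "\<Omega> \<in> S"
  using sets.top[of "restrict_space borel \<Omega>"] by (simp add: space_S)

lemma binary_partition:
  assumes "X \<in> S" "Y \<in> S" "X \<inter> Y = {}"
  shows "binaryset X Y \<in> partitions (X \<union> Y)"
proof -
  have "range (binaryset X Y) \<subseteq> S"
    using assms sets.empty_sets[of "restrict_space borel \<Omega>"] by (simp add: range_binaryset_eq)
  moreover have "disjoint_family (binaryset X Y)"
    using assms by (simp add: disjoint_family_on_def binaryset_def Int_commute)
  moreover have "(\<Union>i. binaryset X Y i) = X \<union> Y" by (rule UN_binaryset_eq)
  ultimately show ?thesis unfolding partitions_def by simp
qed

lemma D_Un:
  assumes "X \<in> S" "Y \<in> S" "X \<inter> Y = {}"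
  shows "D (X \<union> Y) = D X + D Y"
proof -
  have "(\<lambda>i. D (binaryset X Y i)) sums D (X \<union> Y)"
    using D_sums[of "binaryset X Y"] binary_partition[OF assms] unfolding partitions_def by auto
  moreover have "(\<lambda>i. D (binaryset X Y i)) sums (D X + D Y)"
    by (rule binaryset_sums) simp
  ultimately show ?thesis by (rule sums_unique2)
qed

lemma D_Diff:
  assumes "X \<in> S" "Y \<in> S" "X \<subseteq> Y"
  shows "D (Y - X) = D Y - D X"
proof -
  have "D (X \<union> (Y - X)) = D X + D (Y - X)" using assms by (intro D_Un) auto
  moreover have "X \<union> (Y - X) = Y" using assms by auto
  ultimately show ?thesis by simp
qed

lemma D_finite_UN:
  assumes "finite I" "\<And>i. i \<in> I \<Longrightarrow> A i \<in> S" "disjoint_family_on A I"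
  shows "D (\<Union>i\<in>I. A i) = (\<Sum>i\<in>I. D (A i))"
  using assms
proof (induction I rule: finite_induct)
  case (insert x F)
  have "D (A x \<union> (\<Union>i\<in>F. A i)) = D (A x) + D (\<Union>i\<in>F. A i)"
    using insert.prems insert.hyps by (intro D_Un sets.finite_UN) (auto simp: disjoint_family_on_def)
  then show ?case using insert by (auto simp: disjoint_family_on_def)
qed auto

lemma tv_empty: "tv {} = 0"
proof -
  have "(\<Sum>i. ennreal (norm (D (A i)))) \<le> 0" if A: "A \<in> partitions {}" for A
  proof -
    have "A i = {}" for i using A unfolding partitions_def by auto
    then have "A = (\<lambda>_. {})" by (intro ext)
    then show ?thesis by simp
  qed
  then have "tv {} \<le> 0" unfolding tv_def by (rule SUP_least)
  then show ?thesis by simp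
qed

lemma partition_le_tv: "A \<in> partitions B \<Longrightarrow> (\<Sum>i. ennreal (norm (D (A i)))) \<le> tv B"
  unfolding tv_def by (rule SUP_upper)

lemma norm_D_le_tv:
  assumes "B \<in> S" shows "ennreal (norm (D B)) \<le> tv B"
proof -
  have "(\<Sum>i. ennreal (norm (D (binaryset B {} i)))) = ennreal (norm (D B)) + ennreal (norm (D {}))"
    by (rule suminf_binaryset_eq) simp
  then show ?thesis
    using partition_le_tv[OF binary_partition[of B "{}"]] assms by simp
qed


lemma partitions_nonempty: "B \<in> S \<Longrightarrow> partitions B \<noteq> {}"
  using binary_partition[of B "{}"] by auto

text \<open>A partition of X placed at the even indices and one of Y placed at the odd indices form
  a partition of the union, whose sum is the sum of the two.\<close>

lemma tv_superadditive:
  assumes "X \<in> S" "Y \<in> S" "X \<inter> Y = {}"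
  shows "tv X + tv Y \<le> tv (X \<union> Y)"
proof -
  let ?f = "\<lambda>A. \<Sum>i. ennreal (norm (D (A i)))"
  have *: "?f A + ?f B \<le> tv (X \<union> Y)" if "A \<in> partitions X" "B \<in> partitions Y" for A B
  proof -
    define C where "C i = (if even i then A (i div 2) else B (i div 2))" for i
    have "range C \<subseteq> S" using that unfolding partitions_def C_def by auto
    moreover have "disjoint_family C"
      unfolding disjoint_family_on_def
    proof (intro ballI impI)
      fix i j :: nat assume "i \<noteq> j"
      have AX: "A k \<subseteq> X" "B k \<subseteq> Y" for k using that unfolding partitions_def by auto
      have dA: "A k \<inter> A l = {}" "B k \<inter> B l = {}" if "k \<noteq> l" for k l
        using \<open>A \<in> _\<close> \<open>B \<in> _\<close> that unfolding partitions_def disjoint_family_on_def by auto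
      have "A k \<inter> B l = {}" "B l \<inter> A k = {}" for k l
        using AX[of k] AX[of l] assms(3) by blast+
      moreover have "i div 2 \<noteq> j div 2" if "even i = even j"
        using that \<open>i \<noteq> j\<close> by presburger
      ultimately show "C i \<inter> C j = {}"
        unfolding C_def using dA[of "i div 2" "j div 2"] by (cases "even i"; cases "even j") simp_all
    qed
    moreover have "(\<Union>i. C i) = X \<union> Y"
    proof -
      have "A k = C (2 * k)" "B k = C (2 * k + 1)" for k by (simp_all add: C_def)
      then have "(\<Union>i. A i) \<union> (\<Union>i. B i) \<subseteq> (\<Union>i. C i)" by blast
      moreover have "(\<Union>i. C i) \<subseteq> (\<Union>i. A i) \<union> (\<Union>i. B i)" unfolding C_def by auto
      ultimately show ?thesis using that unfolding partitions_def by auto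
    qed
    ultimately have C: "C \<in> partitions (X \<union> Y)" unfolding partitions_def by simp
    have "?f A + ?f B = (\<Sum>i. ennreal (norm (D (A i))) + ennreal (norm (D (B i))))"
      by (rule suminf_add) simp_all
    also have "\<dots> \<le> ?f C"
    proof (rule suminf_le_const)
      fix n
      have "(\<Sum>i<n. ennreal (norm (D (A i))) + ennreal (norm (D (B i)))) = (\<Sum>i<2*n. ennreal (norm (D (C i))))"
        by (induction n) (simp_all add: C_def add.assoc)
      also have "\<dots> \<le> ?f C" by (rule sum_le_suminf) simp_all
      finally show "(\<Sum>i<n. ennreal (norm (D (A i))) + ennreal (norm (D (B i)))) \<le> ?f C" .
    qed simp
    also have "\<dots> \<le> tv (X \<union> Y)" by (rule partition_le_tv[OF C])
    finally show ?thesis .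
  qed
  have "tv X + tv Y = (SUP A \<in> partitions X. ?f A + tv Y)"
    unfolding tv_def[of X] by (rule ennreal_SUP_add_left[symmetric]) (rule partitions_nonempty[OF assms(1)])
  also have "\<dots> = (SUP A \<in> partitions X. SUP B \<in> partitions Y. ?f B + ?f A)"
    unfolding tv_def[of Y] by (subst ennreal_SUP_add_left[OF partitions_nonempty[OF assms(2)]]) (simp add: add.commute)
  also have "\<dots> \<le> tv (X \<union> Y)"
    using * by (intro SUP_least) (simp add: add.commute)
  finally show ?thesis .
qed

lemma tv_mono:
  assumes "X \<in> S" "Y \<in> S" "X \<subseteq> Y"
  shows "tv X \<le> tv Y"
proof -
  have "tv X + tv (Y - X) \<le> tv (X \<union> (Y - X))"
    using assms by (intro tv_superadditive) auto
  moreover have "X \<union> (Y - X) = Y" using assms by auto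
  ultimately have "tv X + tv (Y - X) \<le> tv Y" by simp
  moreover have "tv X \<le> tv X + tv (Y - X)" by simp
  ultimately show ?thesis by (rule order_trans[rotated])
qed

text \<open>One inequality follows from superadditivity on finite unions and monotonicity. For the
  other, a partition A of the union is refined to the sets \<open>A k \<inter> B i\<close>: by the
  triangle inequality refinement can only increase the sum, and after exchanging the two sums each
  inner sum runs over a partition of one \<open>B i\<close>.\<close>

lemma tv_countably_additive: "countably_additive S tv"
proof (rule countably_additiveI)
  fix B :: "nat \<Rightarrow> 'a set"
  assume B: "range B \<subseteq> S" "disjoint_family B" "(\<Union>i. B i) \<in> S"
  show "(\<Sum>i. tv (B i)) = tv (\<Union>i. B i)"
  proof (rule antisym)
    show "(\<Sum>i. tv (B i)) \<le> tv (\<Union>i. B i)"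
    proof (rule suminf_le_const)
      fix n
      have "(\<Sum>i<n. tv (B i)) \<le> tv (\<Union>i<n. B i)"
      proof (induction n)
        case 0 show ?case by (simp add: tv_empty)
      next
        case (Suc n)
        have "(\<Sum>i<Suc n. tv (B i)) \<le> tv (\<Union>i<n. B i) + tv (B n)"
          using Suc by (simp add: add_right_mono)
        also have "\<dots> \<le> tv ((\<Union>i<n. B i) \<union> B n)"
        proof (rule tv_superadditive)
          show "(\<Union>i<n. B i) \<inter> B n = {}"
            using B(2) unfolding disjoint_family_on_def by (auto dest: less_imp_neq)
        qed (use B(1) in auto)
        finally show ?case by (simp add: lessThan_Suc Un_commute)
      qed
      also have "\<dots> \<le> tv (\<Union>i. B i)" using B by (intro tv_mono) auto
      finally show "(\<Sum>i<n. tv (B i)) \<le> tv (\<Union>i. B i)" .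
    qed simp
    show "tv (\<Union>i. B i) \<le> (\<Sum>i. tv (B i))"
      unfolding tv_def[of "\<Union>i. B i"]
    proof (rule SUP_least)
      fix A assume "A \<in> partitions (\<Union>i. B i)"
      then have A: "range A \<subseteq> S" "disjoint_family A" "(\<Union>i. A i) = (\<Union>i. B i)"
        by (auto simp: partitions_def)
      have AB: "A k \<inter> B i \<in> S" for k i using A(1) B(1) by (intro sets.Int) auto
      have "ennreal (norm (D (A k))) \<le> (\<Sum>i. ennreal (norm (D (A k \<inter> B i))))" for k
      proof (rule ennreal_norm_sums_le)
        have "(\<lambda>i. D (A k \<inter> B i)) sums D (\<Union>i. A k \<inter> B i)"
        proof (intro D_sums)
          show "disjoint_family (\<lambda>i. A k \<inter> B i)"
            using B(2) unfolding disjoint_family_on_def by blast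
        qed (use AB in auto)
        moreover have "(\<Union>i. A k \<inter> B i) = A k" using A(3) by auto
        ultimately show "(\<lambda>i. D (A k \<inter> B i)) sums D (A k)" by simp
      qed
      then have "(\<Sum>k. ennreal (norm (D (A k)))) \<le> (\<Sum>k. \<Sum>i. ennreal (norm (D (A k \<inter> B i))))"
        by (intro suminf_le) simp_all
      also have "\<dots> = (\<Sum>i. \<Sum>k. ennreal (norm (D (A k \<inter> B i))))" by (rule suminf_swap_ennreal)
      also have "\<dots> \<le> (\<Sum>i. tv (B i))"
      proof (rule suminf_le)
        fix i
        have "(\<lambda>k. A k \<inter> B i) \<in> partitions (B i)"
          unfolding partitions_def
        proof (intro CollectI conjI)
          show "(\<Union>k. A k \<inter> B i) = B i" using A(3) by blast
          show "disjoint_family (\<lambda>k. A k \<inter> B i)"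
            using A(2) unfolding disjoint_family_on_def by blast
        qed (use AB in auto)
        then show "(\<Sum>k. ennreal (norm (D (A k \<inter> B i)))) \<le> tv (B i)" by (rule partition_le_tv)
      qed simp_all
      finally show "(\<Sum>k. ennreal (norm (D (A k)))) \<le> (\<Sum>i. tv (B i))" .
    qed
  qed
qed

section \<open>The total variation as a finite measure, and the density of D\<close>

lemma TV_eq: "TV = measure_of \<Omega> S tv"
  unfolding total_variation_def tv_def partitions_def by simp

lemma S_Pow: "S \<subseteq> Pow \<Omega>" using S_subset by auto

lemma sets_TV [simp, measurable_cong]: "sets TV = S"
  unfolding TV_eq by (simp add: sets_measure_of[OF S_Pow] sigma_algebra.sigma_sets_eq[OF sigma_algebra_S])

lemma space_TV [simp]: "space TV = \<Omega>"
  unfolding TV_eq by (simp add: space_measure_of[OF S_Pow])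

lemma emeasure_TV: "B \<in> S \<Longrightarrow> emeasure TV B = tv B"
  unfolding TV_eq
  by (rule emeasure_measure_of_sigma[OF sigma_algebra_S])
     (simp_all add: positive_def tv_empty tv_countably_additive)

text \<open>Finitely many pieces of some partition have norms adding up to more than 2 n c'. One of
  the n coordinates therefore contributes more than 2 c' in absolute values, and its terms of one
  sign more than c'. Terms of equal sign do not cancel, so the union of these pieces has a measure
  of norm above c'.\<close>

lemma large_subset:
  assumes "B \<in> S" "tv B = \<infinity>"
  shows "\<exists>A\<in>S. A \<subseteq> B \<and> norm (D A) > c"
proof -
  define n where "n = real DIM('b)"
  have n: "n > 0" unfolding n_def by simp
  define c' where "c' = max c 0"
  have "ennreal (2 * n * c') < tv B" using assms(2) by simp
  then obtain P where P: "P \<in> partitions B" and "ennreal (2 * n * c') < (\<Sum>i. ennreal (norm (D (P i))))"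
    unfolding tv_def less_SUP_iff by blast
  then obtain N where N: "ennreal (2 * n * c') < (\<Sum>i<N. ennreal (norm (D (P i))))"
    unfolding suminf_eq_SUP less_SUP_iff by auto
  have PS: "P i \<in> S" for i using P unfolding partitions_def by auto
  let ?z = "\<lambda>i. D (P i)"
  have "2 * n * c' < (\<Sum>i<N. norm (?z i))"
    using N n by (simp add: sum_nonneg ennreal_less_iff c'_def)
  also have "\<dots> \<le> (\<Sum>i<N. \<Sum>b\<in>Basis. \<bar>?z i \<bullet> b\<bar>)" by (intro sum_mono norm_le_l1)
  also have "\<dots> = (\<Sum>b\<in>Basis. \<Sum>i<N. \<bar>?z i \<bullet> b\<bar>)" by (rule sum.swap)
  finally have *: "(\<Sum>b\<in>(Basis::'b set). 2 * c') < (\<Sum>b\<in>Basis. \<Sum>i<N. \<bar>?z i \<bullet> b\<bar>)"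
    by (simp add: n_def mult_ac)
  obtain b :: 'b where b: "b \<in> Basis" "2 * c' < (\<Sum>i<N. \<bar>?z i \<bullet> b\<bar>)"
    using sum_mono[of Basis "\<lambda>b. \<Sum>i<N. \<bar>?z i \<bullet> b\<bar>" "\<lambda>_. 2 * c'"] * by (meson not_le)
  define I where "I = {i. i < N \<and> ?z i \<bullet> b > 0}"
  define J where "J = {i. i < N \<and> \<not> ?z i \<bullet> b > 0}"
  have IJ: "finite I" "finite J" "{..<N} = I \<union> J" "I \<inter> J = {}" unfolding I_def J_def by auto
  have "(\<Sum>i<N. \<bar>?z i \<bullet> b\<bar>) = (\<Sum>i\<in>I. \<bar>?z i \<bullet> b\<bar>) + (\<Sum>i\<in>J. \<bar>?z i \<bullet> b\<bar>)"
    using IJ by (simp add: sum.union_disjoint)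
  also have "\<dots> = (\<Sum>i\<in>I. ?z i \<bullet> b) - (\<Sum>i\<in>J. ?z i \<bullet> b)"
    unfolding diff_conv_add_uminus sum_negf[symmetric]
    by (intro arg_cong2[where f="(+)"] sum.cong) (auto simp: I_def J_def)
  finally have "c' < \<bar>\<Sum>i\<in>I. ?z i \<bullet> b\<bar> \<or> c' < \<bar>\<Sum>i\<in>J. ?z i \<bullet> b\<bar>" using b(2) by linarith
  then obtain K where K: "finite K" "c' < \<bar>\<Sum>i\<in>K. ?z i \<bullet> b\<bar>" using IJ by blast
  have "D (\<Union>i\<in>K. P i) = (\<Sum>i\<in>K. ?z i)"
    using P by (intro D_finite_UN K PS) (auto simp: partitions_def disjoint_family_on_def)
  then have "\<bar>\<Sum>i\<in>K. ?z i \<bullet> b\<bar> \<le> norm (D (\<Union>i\<in>K. P i))"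
    using Basis_le_norm[OF b(1), of "\<Sum>i\<in>K. ?z i"] by (simp add: inner_sum_left)
  then have "c < norm (D (\<Union>i\<in>K. P i))" using K(2) unfolding c'_def by linarith
  moreover have "(\<Union>i\<in>K. P i) \<in> S" using PS K(1) by auto
  moreover have "(\<Union>i\<in>K. P i) \<subseteq> B" using P unfolding partitions_def by auto
  ultimately show ?thesis by blast
qed

(* A set of infinite variation splits off a piece of norm > 1 leaving infinite variation; iterating,
   the disjoint pieces contradict the convergence of the series of their measures. *)
lemma tv_finite: "tv \<Omega> < \<infinity>"
proof (rule ccontr)
  assume "\<not> tv \<Omega> < \<infinity>"
  then have inf: "tv \<Omega> = \<infinity>" by (simp add: less_top[symmetric])
  let ?P = "\<lambda>(n::nat) B. B \<in> S \<and> tv B = \<infinity>"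
  have "\<exists>Q. \<forall>n. ?P n (Q n) \<and> Q (Suc n) \<subseteq> Q n \<and> norm (D (Q n - Q (Suc n))) > 1"
  proof (rule dependent_nat_choice)
    show "\<exists>B. ?P 0 B" using inf Omega_in_S by blast
  next
    fix B and n :: nat assume B: "?P n B"
    \<comment> \<open>The margin \<open>norm (D B)\<close> gives both A and \<open>B - A\<close> a
      measure of norm above 1, so whichever of them has infinite variation can be kept while the
      other is split off.\<close>
    then obtain A where A: "A \<in> S" "A \<subseteq> B" "norm (D A) > 1 + norm (D B)"
      using large_subset[of B "1 + norm (D B)"] by auto
    have "norm (D (B - A)) > 1"
    proof -
      have "D (B - A) = D B - D A" using B by (intro D_Diff A) simp
      then have "norm (D (B - A)) \<ge> norm (D A) - norm (D B)"
        using norm_triangle_ineq2[of "D A" "D B"] by (simp only: norm_minus_commute)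
      then show ?thesis using A(3) by linarith
    qed
    moreover have "norm (D (B - (B - A))) > 1"
    proof -
      have "B - (B - A) = A" using A by auto
      moreover have "norm (D A) > 1" using A(3) norm_ge_zero[of "D B"] by linarith
      ultimately show ?thesis by simp
    qed
    moreover have "tv A = \<infinity> \<or> tv (B - A) = \<infinity>"
    proof -
      have "emeasure TV A + emeasure TV (B - A) = emeasure TV B"
        using A B plus_emeasure[of A TV "B - A"] sets.Diff[of B "restrict_space borel \<Omega>" A]
        by (simp add: Un_absorb1)
      then show ?thesis using A B emeasure_TV[of "B - A"] by (simp add: emeasure_TV sets.Diff)
    qed
    ultimately show "\<exists>C. ?P (Suc n) C \<and> C \<subseteq> B \<and> norm (D (B - C)) > 1"
      using A B by (metis Diff_subset sets.Diff)
  qed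
  then obtain Q where Q: "\<And>n. Q n \<in> S" "\<And>n. Q (Suc n) \<subseteq> Q n" "\<And>n. norm (D (Q n - Q (Suc n))) > 1"
    by auto
  have dec: "Q n \<subseteq> Q m" if "m \<le> n" for m n using lift_Suc_antimono_le[of Q, OF Q(2) that] .
  have "disjoint_family (\<lambda>n. Q n - Q (Suc n))"
    unfolding disjoint_family_on_def
  proof (intro ballI impI)
    fix m n :: nat assume "m \<noteq> n"
    then consider "Suc m \<le> n" | "Suc n \<le> m" by linarith
    then show "(Q m - Q (Suc m)) \<inter> (Q n - Q (Suc n)) = {}"
      using dec by cases blast+
  qed
  then have "(\<lambda>n. D (Q n - Q (Suc n))) sums D (\<Union>n. Q n - Q (Suc n))"
    using Q(1) by (intro D_sums) auto
  then have "(\<lambda>n. D (Q n - Q (Suc n))) \<longlonglongrightarrow> 0" using summable_LIMSEQ_zero sums_summable by blast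
  then have "(\<lambda>n. norm (D (Q n - Q (Suc n)))) \<longlonglongrightarrow> 0" by (rule tendsto_norm_zero)
  then have "eventually (\<lambda>n. norm (D (Q n - Q (Suc n))) < 1) sequentially"
    by (rule order_tendstoD) simp
  then show False using Q(3) by (auto simp: eventually_sequentially not_less[symmetric] intro: less_asym)
qed

sublocale TV: finite_measure TV
  by (rule finite_measureI) (use tv_finite in \<open>simp add: emeasure_TV\<close>)

lemma norm_D_le: "B \<in> S \<Longrightarrow> norm (D B) \<le> measure TV B"
  using norm_D_le_tv[of B] emeasure_TV[of B] TV.emeasure_eq_measure[of B]
  by (metis ennreal_le_iff measure_nonneg)

text \<open>Radon-Nikodym is stated for nonnegative measures. As
  \<open>\<bar>D B \<bullet> b\<bar>\<close> is at most the total variation of B, adding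
  \<open>TV\<close> to the component gives a finite measure that is absolutely continuous with
  respect to \<open>TV\<close>; subtracting 1 from its density undoes the shift.\<close>

lemma component_density:
  assumes b: "norm b \<le> 1"
  shows "\<exists>g. integrable TV g \<and> (\<forall>B\<in>S. D B \<bullet> b = (LINT x:B|TV. g x))"
proof -
  define \<nu> where "\<nu> B = ennreal (measure TV B + D B \<bullet> b)" for B
  have pos: "0 \<le> measure TV B + D B \<bullet> b" "measure TV B + D B \<bullet> b \<le> 2 * measure TV B" if "B \<in> S" for B
  proof -
    have "\<bar>D B \<bullet> b\<bar> \<le> norm (D B) * norm b" by (rule Cauchy_Schwarz_ineq2)
    also have "\<dots> \<le> measure TV B"
      using norm_D_le[OF that] b by (meson mult_left_le norm_ge_zero order_trans)
    finally show "0 \<le> measure TV B + D B \<bullet> b" "measure TV B + D B \<bullet> b \<le> 2 * measure TV B" by linarith+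
  qed
  define N where "N = measure_of \<Omega> S \<nu>"
  have ca: "countably_additive S \<nu>"
  proof (rule countably_additiveI)
    fix A :: "nat \<Rightarrow> 'a set" assume A: "range A \<subseteq> S" "disjoint_family A" "(\<Union>i. A i) \<in> S"
    have "(\<lambda>i. measure TV (A i)) sums measure TV (\<Union>i. A i)"
      using A TV.finite_measure_UNION by auto
    moreover have "(\<lambda>i. D (A i) \<bullet> b) sums (D (\<Union>i. A i) \<bullet> b)"
      using bounded_linear.sums[OF bounded_linear_inner_left D_sums[OF A(1,2)]] .
    ultimately have s: "(\<lambda>i. measure TV (A i) + D (A i) \<bullet> b) sums (measure TV (\<Union>i. A i) + D (\<Union>i. A i) \<bullet> b)"
      by (rule sums_add)
    show "(\<Sum>i. \<nu> (A i)) = \<nu> (\<Union>i. A i)"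
      unfolding \<nu>_def using A(1) pos(1) s
      by (subst suminf_ennreal2) (auto simp: sums_iff)
  qed
  have [simp]: "sets N = S" "space N = \<Omega>"
    unfolding N_def by (simp_all add: sets_measure_of[OF S_Pow] space_measure_of[OF S_Pow]
        sigma_algebra.sigma_sets_eq[OF sigma_algebra_S])
  have emN: "emeasure N B = \<nu> B" if "B \<in> S" for B
    unfolding N_def
    by (rule emeasure_measure_of_sigma[OF sigma_algebra_S]) (use ca that in \<open>simp_all add: positive_def \<nu>_def\<close>)
  interpret N: finite_measure N
    by (rule finite_measureI) (simp add: emN \<nu>_def)
  have "absolutely_continuous TV N"
    unfolding absolutely_continuous_def
  proof
    fix B assume B: "B \<in> null_sets TV"
    then have "B \<in> S" by auto
    moreover from B have "measure TV B = 0" by (simp add: measure_def null_setsD1)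
    ultimately show "B \<in> null_sets N" using pos[of B] by (intro null_setsI) (auto simp: emN \<nu>_def)
  qed
  from TV.real_RN_deriv[OF N.finite_measure_axioms this] obtain d where
    d: "d \<in> borel_measurable TV" "AE x in TV. RN_deriv TV N x = ennreal (d x)" "\<And>x. 0 \<le> d x"
    by (metis \<open>sets N = S\<close> sets_TV)
  have N_eq: "N = density TV (\<lambda>x. ennreal (d x))"
  proof -
    have "density TV (\<lambda>x. ennreal (d x)) = density TV (RN_deriv TV N)"
    proof (rule density_cong)
      show "AE x in TV. ennreal (d x) = RN_deriv TV N x"
        using d(2) by eventually_elim simp
    qed (use d(1) in auto)
    then show ?thesis using TV.density_RN_deriv[OF \<open>absolutely_continuous TV N\<close>] by simp
  qed
  have intN: "integrable TV (\<lambda>x. d x * f x) \<longleftrightarrow> integrable N f" "integral\<^sup>L N f = (LINT x|TV. d x * f x)"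
    if "f \<in> borel_measurable TV" for f :: "'a \<Rightarrow> real"
    unfolding N_eq using that d by (simp_all add: integrable_real_density integral_real_density)
  have "integrable TV d" using intN(1)[of "\<lambda>_. 1"] by simp
  have "D B \<bullet> b = (LINT x:B|TV. d x - 1)" if "B \<in> S" for B
  proof -
    have "measure TV B + D B \<bullet> b = measure N B"
      using emN[OF that] pos[OF that] unfolding \<nu>_def measure_def by simp
    also have "\<dots> = (LINT x|TV. d x * indicator B x)"
      using that intN(2)[of "indicator B"] by (simp add: S_subset Int_absorb2)
    also have "\<dots> = (LINT x:B|TV. d x)" unfolding set_lebesgue_integral_def by (simp add: mult.commute)
    finally have *: "measure TV B + D B \<bullet> b = (LINT x:B|TV. d x)" .
    have "set_integrable TV B d" "set_integrable TV B (\<lambda>_. 1 :: real)"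
      unfolding set_integrable_def using that \<open>integrable TV d\<close>
      by (intro integrable_mult_indicator; simp)+
    then have "(LINT x:B|TV. d x - 1) = (LINT x:B|TV. d x) - (LINT x:B|TV. 1)"
      by (rule set_integral_diff)
    moreover have "(LINT x:B|TV. (1::real)) = measure TV B"
      using S_subset[OF that] by (simp add: set_lebesgue_integral_def Int_absorb2)
    ultimately show ?thesis using * by simp
  qed
  then show ?thesis using \<open>integrable TV d\<close> by (intro exI[of _ "\<lambda>x. d x - 1"]) auto
qed


text \<open>The witness for the choice made in \<open>rn_density\<close>, assembled from the
  coordinate densities.\<close>

lemma density_exists: "\<exists>g. integrable TV g \<and> (\<forall>B\<in>S. D B = (LINT x:B|TV. g x))"
proof -
  have "\<exists>g. integrable TV g \<and> (\<forall>B\<in>S. D B \<bullet> b = (LINT x:B|TV. g x))" if "b \<in> Basis" for b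
    using component_density[of b] that by simp
  then obtain g where g: "\<And>b. b \<in> Basis \<Longrightarrow> integrable TV (g b)"
      "\<And>b B. b \<in> Basis \<Longrightarrow> B \<in> S \<Longrightarrow> D B \<bullet> b = (LINT x:B|TV. g b x)"
    by metis
  let ?g = "\<lambda>x. \<Sum>b\<in>Basis. g b x *\<^sub>R b"
  have "D B = (LINT x:B|TV. ?g x)" if "B \<in> S" for B
  proof -
    have i: "integrable TV (\<lambda>x. indicator B x *\<^sub>R g b x)" if "b \<in> Basis" for b
      using \<open>B \<in> S\<close> g(1)[OF that] by (intro integrable_mult_indicator) simp_all
    have "(LINT x:B|TV. ?g x) = (LINT x|TV. (\<Sum>b\<in>Basis. (indicator B x *\<^sub>R g b x) *\<^sub>R b))"
      unfolding set_lebesgue_integral_def by (simp add: scaleR_sum_right)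
    also have "\<dots> = (\<Sum>b\<in>Basis. (LINT x|TV. (indicator B x *\<^sub>R g b x) *\<^sub>R b))"
      by (rule Bochner_Integration.integral_sum) (use i in \<open>auto intro: integrable_scaleR_left\<close>)
    also have "\<dots> = (\<Sum>b\<in>Basis. (D B \<bullet> b) *\<^sub>R b)"
      using i g(2)[OF _ that] unfolding set_lebesgue_integral_def by (intro sum.cong) auto
    finally show ?thesis by (simp add: euclidean_representation)
  qed
  moreover have "integrable TV ?g" using g(1) by auto
  ultimately show ?thesis by (intro exI[of _ ?g]) auto
qed

abbreviation "\<nu> \<equiv> rn_density \<Omega> D"

lemma rn_density: "integrable TV \<nu> \<and> (\<forall>B\<in>S. D B = (LINT x:B|TV. \<nu> x))"
  unfolding rn_density_def by (rule someI_ex[OF density_exists])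

lemma integrable_rn_density: "integrable TV \<nu>"
  and D_eq_integral: "B \<in> S \<Longrightarrow> D B = (LINT x:B|TV. \<nu> x)"
  using rn_density by auto

lemma measurable_rn_density [measurable]: "\<nu> \<in> borel_measurable TV"
  using integrable_rn_density by auto

text \<open>The average of the density over a set A of positive measure is \<open>D A\<close>
  divided by \<open>measure TV A\<close>, a vector of the closed unit ball; by the averaging theorem
  almost all values lie there as well.\<close>

lemma norm_rn_density_le: "AE x in TV. norm (\<nu> x) \<le> 1"
proof -
  have "AE x in TV. \<nu> x \<in> cball 0 1"
  proof (rule TV.averaging_theorem[OF integrable_rn_density])
    fix A assume A: "A \<in> sets TV" "measure TV A > 0"
    then have "norm (LINT x:A|TV. \<nu> x) \<le> measure TV A"
      using norm_D_le[of A] D_eq_integral[of A] by simp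
    then show "(1 / measure TV A) *\<^sub>R set_lebesgue_integral TV A \<nu> \<in> cball 0 1"
      using A by (simp add: divide_simps)
  qed simp
  then show ?thesis by simp
qed

end

section \<open>Push-forwards of vector densities\<close>

lemma integrable_indicator_comp:
  fixes u :: "'a \<Rightarrow> 'b::{banach, second_countable_topology}"
  assumes "integrable N u" "T \<in> N \<rightarrow>\<^sub>M M" "B \<in> sets M"
  shows "integrable N (\<lambda>x. indicator B (T x) *\<^sub>R u x)"
proof -
  have "integrable N (\<lambda>x. indicator (T -` B \<inter> space N) x *\<^sub>R u x)"
    using measurable_sets[OF assms(2,3)] assms(1) by (rule integrable_mult_indicator)
  then show ?thesis
    by (rule Bochner_Integration.integrable_cong[THEN iffD1, rotated -1]) (auto simp: indicator_def)
qed

lemma sums_integral_indicator_comp: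
  fixes u :: "'a \<Rightarrow> 'b::{banach, second_countable_topology}"
  assumes u: "integrable N u" and T: "T \<in> N \<rightarrow>\<^sub>M M"
    and A: "range A \<subseteq> sets M" "disjoint_family A"
  shows "(\<lambda>i. LINT x|N. indicator (A i) (T x) *\<^sub>R u x) sums (LINT x|N. indicator (\<Union>i. A i) (T x) *\<^sub>R u x)"
proof -
  have d: "A i \<inter> A j = {}" if "i \<noteq> j" for i j
    using A(2) that unfolding disjoint_family_on_def by auto
  have i: "integrable N (\<lambda>x. indicator B (T x) *\<^sub>R u x)" if "B \<in> sets M" for B
    by (rule integrable_indicator_comp[OF u T that])
  have [measurable]: "u \<in> borel_measurable N" using u by auto
  have "(\<lambda>n. LINT x|N. (\<Sum>i<n. indicator (A i) (T x)) *\<^sub>R u x) \<longlonglongrightarrow> (LINT x|N. indicator (\<Union>i. A i) (T x) *\<^sub>R u x)"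
  proof (rule integral_dominated_convergence[where w="\<lambda>x. norm (u x)"])
    show "(\<lambda>x. indicator (\<Union>i. A i) (T x) *\<^sub>R u x) \<in> borel_measurable N"
      using i[of "\<Union>i. A i"] A(1) by auto
    show "(\<lambda>x. (\<Sum>i<n. indicator (A i) (T x)) *\<^sub>R u x) \<in> borel_measurable N" for n
    proof -
      have "(\<lambda>x. indicator (A i) (T x) *\<^sub>R u x) \<in> borel_measurable N" for i
        using i[of "A i"] A(1) by auto
      then show ?thesis unfolding scaleR_sum_left by (intro borel_measurable_sum)
    qed
    show "AE x in N. (\<lambda>n. (\<Sum>i<n. indicator (A i) (T x)) *\<^sub>R u x) \<longlonglongrightarrow> indicator (\<Union>i. A i) (T x) *\<^sub>R u x"
      using indicator_sums[OF d] unfolding sums_def by (auto intro!: tendsto_intros)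
    show "AE x in N. norm ((\<Sum>i<n. indicator (A i) (T x)) *\<^sub>R u x) \<le> norm (u x)" for n
    proof (rule AE_I2)
      fix x
      have "(\<Sum>i<n. indicator (A i) (T x)) = (indicator (\<Union>i<n. A i) (T x) :: real)"
        using d by (intro indicator_UN_disjoint[symmetric]) (auto simp: disjoint_family_on_def)
      then show "norm ((\<Sum>i<n. indicator (A i) (T x)) *\<^sub>R u x) \<le> norm (u x)"
        by (simp add: indicator_def)
    qed
  qed (use u in auto)
  moreover have "(LINT x|N. (\<Sum>i<n. indicator (A i) (T x)) *\<^sub>R u x) = (\<Sum>k<n. LINT x|N. indicator (A k) (T x) *\<^sub>R u x)" for n
    unfolding scaleR_sum_left using A(1) by (intro Bochner_Integration.integral_sum i) auto
  ultimately show ?thesis unfolding sums_def by simp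
qed

text \<open>Two densities of the same vector measure, one on M and one on N seen through T,
  integrate bounded fields alike: by linearity for simple fields, then by dominated convergence.
  This lets an explicit density replace the one selected by \<open>rn_density\<close>.\<close>

lemma integral_inner_transfer:
  fixes g w :: "_ \<Rightarrow> 'b::euclidean_space"
  assumes g: "integrable M g" and w: "integrable N w"
    and T [measurable]: "T \<in> N \<rightarrow>\<^sub>M M"
    and eq: "\<And>B. B \<in> sets M \<Longrightarrow> (LINT x:B|M. g x) = (LINT x|N. indicator B (T x) *\<^sub>R w x)"
    and \<psi> [measurable]: "\<psi> \<in> borel_measurable M"
    and K: "\<And>x. x \<in> space M \<Longrightarrow> norm (\<psi> x) \<le> K"
  shows "(LINT x|M. \<psi> x \<bullet> g x) = (LINT x|N. \<psi> (T x) \<bullet> w x)"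
proof -
  have [measurable]: "g \<in> borel_measurable M" "w \<in> borel_measurable N" using g w by auto
  obtain s where s: "\<And>i. simple_function M (s i)" "\<And>x. x \<in> space M \<Longrightarrow> (\<lambda>i. s i x) \<longlonglongrightarrow> \<psi> x"
      "\<And>i x. x \<in> space M \<Longrightarrow> norm (s i x) \<le> 2 * norm (\<psi> x)"
    using borel_measurable_implies_sequence_metric[OF \<psi>, of 0] unfolding norm_conv_dist by metis
  have [measurable]: "s i \<in> borel_measurable M" for i
    using s(1) by (rule borel_measurable_simple_function)
  have bd: "norm (s i x) \<le> 2 * K" if "x \<in> space M" for i x
    using s(3)[OF that, of i] K[OF that] by linarith
  have eq_s: "(LINT x|M. s i x \<bullet> g x) = (LINT x|N. s i (T x) \<bullet> w x)" for i
  proof -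
    define Y where "Y = s i ` space M"
    define A where "A y = s i -` {y} \<inter> space M" for y
    have Y: "finite Y" unfolding Y_def using s(1) by (simp add: simple_function_def)
    have A: "A y \<in> sets M" for y unfolding A_def using s(1)[of i]
      by (cases "y \<in> Y") (auto simp: simple_function_def Y_def intro: back_subst[of "\<lambda>B. B \<in> sets M" "{}"])
    have rep: "s i x = (\<Sum>y\<in>Y. indicator (A y) x *\<^sub>R y)" if "x \<in> space M" for x
    proof -
      have "(\<Sum>y\<in>Y. indicator (A y) x *\<^sub>R y) = (\<Sum>y\<in>Y. if y = s i x then y else 0)"
        using that by (intro sum.cong) (auto simp: A_def)
      also have "\<dots> = s i x" using that Y by (simp add: Y_def)
      finally show ?thesis by simp
    qed
    have iM: "integrable M (\<lambda>x. indicator (A y) x *\<^sub>R g x)" for y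
      using A g by (intro integrable_mult_indicator)
    have iN: "integrable N (\<lambda>x. indicator (A y) (T x) *\<^sub>R w x)" for y
      using A w T by (intro integrable_indicator_comp)
    have "(LINT x|M. s i x \<bullet> g x) = (LINT x|M. (\<Sum>y\<in>Y. y \<bullet> (indicator (A y) x *\<^sub>R g x)))"
      by (intro Bochner_Integration.integral_cong) (auto simp: rep inner_sum_left)
    also have "\<dots> = (\<Sum>y\<in>Y. y \<bullet> (LINT x:A y|M. g x))"
      using iM by (simp add: set_lebesgue_integral_def del: inner_scaleR_right real_scaleR_def)
    also have "\<dots> = (\<Sum>y\<in>Y. y \<bullet> (LINT x|N. indicator (A y) (T x) *\<^sub>R w x))"
      using eq A by simp
    also have "\<dots> = (LINT x|N. (\<Sum>y\<in>Y. y \<bullet> (indicator (A y) (T x) *\<^sub>R w x)))"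
      using iN by (simp del: inner_scaleR_right)
    also have "\<dots> = (LINT x|N. s i (T x) \<bullet> w x)"
      using measurable_space[OF T]
      by (intro Bochner_Integration.integral_cong) (auto simp: rep inner_sum_left)
    finally show ?thesis .
  qed
  have "(\<lambda>i. LINT x|M. s i x \<bullet> g x) \<longlonglongrightarrow> (LINT x|M. \<psi> x \<bullet> g x)"
  proof (rule integral_dominated_convergence[where w="\<lambda>x. 2 * K * norm (g x)"])
    show "AE x in M. (\<lambda>i. s i x \<bullet> g x) \<longlonglongrightarrow> \<psi> x \<bullet> g x"
      using s(2) by (auto intro!: tendsto_intros)
    show "AE x in M. norm (s i x \<bullet> g x) \<le> 2 * K * norm (g x)" for i
    proof (rule AE_I2)
      fix x assume "x \<in> space M"
      have "norm (s i x \<bullet> g x) \<le> norm (s i x) * norm (g x)" by (simp add: Cauchy_Schwarz_ineq2)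
      also have "\<dots> \<le> 2 * K * norm (g x)" using bd[OF \<open>x \<in> space M\<close>] by (intro mult_right_mono) auto
      finally show "norm (s i x \<bullet> g x) \<le> 2 * K * norm (g x)" .
    qed
  qed (use g in auto)
  moreover have "(\<lambda>i. LINT x|N. s i (T x) \<bullet> w x) \<longlonglongrightarrow> (LINT x|N. \<psi> (T x) \<bullet> w x)"
  proof (rule integral_dominated_convergence[where w="\<lambda>x. 2 * K * norm (w x)"])
    show "AE x in N. (\<lambda>i. s i (T x) \<bullet> w x) \<longlonglongrightarrow> \<psi> (T x) \<bullet> w x"
      using s(2) measurable_space[OF T] by (auto intro!: tendsto_intros)
    show "AE x in N. norm (s i (T x) \<bullet> w x) \<le> 2 * K * norm (w x)" for i
    proof (rule AE_I2)
      fix x assume "x \<in> space N"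
      have "norm (s i (T x) \<bullet> w x) \<le> norm (s i (T x)) * norm (w x)" by (simp add: Cauchy_Schwarz_ineq2)
      also have "\<dots> \<le> 2 * K * norm (w x)"
        using bd[OF measurable_space[OF T \<open>x \<in> space N\<close>]] by (intro mult_right_mono) auto
      finally show "norm (s i (T x) \<bullet> w x) \<le> 2 * K * norm (w x)" .
    qed
  qed (use w in auto)
  ultimately show ?thesis using eq_s LIMSEQ_unique by simp
qed

text \<open>D is the push-forward under T of the vector measure with density w on N. On every piece
  of a partition the norm of the integral is at most the integral of the norm, which bounds the
  total variation by the push-forward of \<open>norm (w x)\<close>.\<close>

lemma transported_vector_measure:
  fixes w :: "'a::topological_space \<Rightarrow> 'b::euclidean_space"
  assumes w: "integrable N w" and T [measurable]: "T \<in> N \<rightarrow>\<^sub>M restrict_space borel \<Omega>"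
  defines "D \<equiv> \<lambda>B. LINT x|N. indicator B (T x) *\<^sub>R w x"
  shows "vector_measure \<Omega> D"
    and "B \<in> sets (restrict_space borel \<Omega>) \<Longrightarrow>
      measure (total_variation \<Omega> D) B \<le> (LINT x|N. indicator B (T x) * norm (w x))"
    and "\<psi> \<in> borel_measurable (restrict_space borel \<Omega>) \<Longrightarrow> (\<And>x. x \<in> \<Omega> \<Longrightarrow> norm (\<psi> x) \<le> K) \<Longrightarrow>
      vm_integral \<Omega> D \<psi> = (LINT x|N. \<psi> (T x) \<bullet> w x)"
proof -
  let ?S = "sets (restrict_space borel \<Omega>)"
  have [measurable]: "w \<in> borel_measurable N" using w by auto
  note sums = sums_integral_indicator_comp[OF _ T]
  show vmD: "vector_measure \<Omega> D"
    unfolding vector_measure_def D_def using sums[OF w] by auto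
  interpret vec_measure \<Omega> D by unfold_locales fact
  show "measure TV B \<le> (LINT x|N. indicator B (T x) * norm (w x))" if B: "B \<in> ?S"
  proof -
    have "tv B \<le> ennreal (LINT x|N. indicator B (T x) *\<^sub>R norm (w x))"
      unfolding tv_def
    proof (rule SUP_least)
      fix A assume "A \<in> partitions B"
      then have A: "range A \<subseteq> ?S" "disjoint_family A" "(\<Union>i. A i) = B" by (auto simp: partitions_def)
      have s: "(\<lambda>i. LINT x|N. indicator (A i) (T x) *\<^sub>R norm (w x)) sums (LINT x|N. indicator B (T x) *\<^sub>R norm (w x))"
        using sums[OF integrable_norm[OF w] A(1,2)] A(3) by simp
      have "(\<Sum>i. ennreal (norm (D (A i)))) \<le> (\<Sum>i. ennreal (LINT x|N. indicator (A i) (T x) *\<^sub>R norm (w x)))"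
      proof (intro suminf_le ennreal_leI)
        fix i
        have "norm (D (A i)) \<le> (LINT x|N. norm (indicator (A i) (T x) *\<^sub>R w x))"
          unfolding D_def by (rule integral_norm_bound)
        then show "norm (D (A i)) \<le> (LINT x|N. indicator (A i) (T x) *\<^sub>R norm (w x))" by simp
      qed simp_all
      also have "\<dots> = ennreal (LINT x|N. indicator B (T x) *\<^sub>R norm (w x))"
        using s by (subst suminf_ennreal2) (auto simp: sums_iff)
      finally show "(\<Sum>i. ennreal (norm (D (A i)))) \<le> ennreal (LINT x|N. indicator B (T x) *\<^sub>R norm (w x))" .
    qed
    then have "ennreal (measure TV B) \<le> ennreal (LINT x|N. indicator B (T x) *\<^sub>R norm (w x))"
      using emeasure_TV[OF B] TV.emeasure_eq_measure[of B] by simp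
    then show ?thesis by (subst (asm) ennreal_le_iff) auto
  qed
  show "vm_integral \<Omega> D \<psi> = (LINT x|N. \<psi> (T x) \<bullet> w x)"
    if \<psi>: "\<psi> \<in> borel_measurable (restrict_space borel \<Omega>)" "\<And>x. x \<in> \<Omega> \<Longrightarrow> norm (\<psi> x) \<le> K"
    unfolding vm_integral_def
  proof (rule integral_inner_transfer[OF integrable_rn_density w])
    show "T \<in> N \<rightarrow>\<^sub>M TV" using T by (simp cong: measurable_cong_sets)
    show "\<psi> \<in> borel_measurable TV" using \<psi>(1) by (simp cong: measurable_cong_sets)
    show "(LINT x:B|TV. \<nu> x) = (LINT x|N. indicator B (T x) *\<^sub>R w x)" if "B \<in> sets TV" for B
    proof -
      have "B \<in> ?S" using that by (simp only: sets_TV)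
      from D_eq_integral[OF this] show ?thesis unfolding D_def by simp
    qed
  qed (use \<psi>(2) in auto)
qed

subsection \<open>Continuously differentiable functions and uniqueness of derivative measures\<close>

definition C1 :: "('a::euclidean_space \<Rightarrow> 'b::real_normed_vector) \<Rightarrow> bool" where
  "C1 f \<longleftrightarrow> (\<exists>f' :: 'a \<Rightarrow> ('a \<Rightarrow>\<^sub>L 'b).
     (\<forall>x. (f has_derivative blinfun_apply (f' x)) (at x)) \<and> continuous_on UNIV f')"

text \<open>In finite dimension, continuity of the derivative in operator norm follows from
  continuity along each fixed direction h, so derivatives can be handled as plain functions.\<close>

lemma C1I:
  fixes f :: "'a::euclidean_space \<Rightarrow> 'b::real_normed_vector"
  assumes d: "\<And>x. (f has_derivative f' x) (at x)"
    and c: "\<And>h. continuous_on UNIV (\<lambda>x. f' x h)"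
  shows "C1 f"
proof -
  have bl: "bounded_linear (f' x)" for x using d by (rule has_derivative_bounded_linear)
  have "continuous_on UNIV (\<lambda>x. Blinfun (f' x))"
    using c by (intro continuous_on_blinfun_componentwise) (simp add: bounded_linear_Blinfun_apply bl)
  then show ?thesis
    unfolding C1_def using d
    by (intro exI[of _ "\<lambda>x. Blinfun (f' x)"]) (simp add: bounded_linear_Blinfun_apply bl)
qed

text \<open>Base point and direction may vary together, as happens when both depend on the time
  parameter of a deformation. The type \<open>'c\<close> of the parameter space is fixed at each
  use.\<close>

lemma C1E_joint:
  fixes f :: "'a::euclidean_space \<Rightarrow> 'b::real_normed_vector"
  assumes "C1 f"
  obtains f' where "\<And>x. (f has_derivative f' x) (at x)"
    "\<And>(S :: 'c::topological_space set) p q. continuous_on S p \<Longrightarrow> continuous_on S q \<Longrightarrow>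
      continuous_on S (\<lambda>y. f' (p y) (q y))"
proof -
  from assms obtain F where F: "\<And>x. (f has_derivative blinfun_apply (F x)) (at x)" "continuous_on UNIV F"
    unfolding C1_def by auto
  have "continuous_on S (\<lambda>y. F (p y) (q y))" if "continuous_on S p" "continuous_on S q"
    for S :: "'c::topological_space set" and p q
    using that continuous_on_compose2[OF F(2) that(1)] by (intro continuous_intros) auto
  then show thesis by (intro that[of "\<lambda>x. blinfun_apply (F x)"] F(1)) auto
qed

lemma C1E:
  fixes f :: "'a::euclidean_space \<Rightarrow> 'b::real_normed_vector"
  assumes "C1 f"
  obtains f' where "\<And>x. (f has_derivative f' x) (at x)" "\<And>h. continuous_on UNIV (\<lambda>x. f' x h)"
proof -
  obtain f' where "\<And>x. (f has_derivative f' x) (at x)"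
    "\<And>(S :: 'a set) p q. continuous_on S p \<Longrightarrow> continuous_on S q \<Longrightarrow>
      continuous_on S (\<lambda>y. f' (p y) (q y))"
    by (rule C1E_joint[OF assms, where 'c='a]) (rule that)
  then show thesis by (intro that[of f']) (auto intro: continuous_on_id continuous_on_const)
qed

lemma C1_continuous: "C1 f \<Longrightarrow> continuous_on S f"
  unfolding C1_def by (meson continuous_at_imp_continuous_on has_derivative_continuous)

lemma C1_measurable: "C1 f \<Longrightarrow> f \<in> borel_measurable borel"
  by (rule borel_measurable_continuous_onI) (rule C1_continuous)

lemma C1_const: "C1 (\<lambda>_. c)"
  by (rule C1I[of _ "\<lambda>_ _. 0"]) (auto intro!: derivative_eq_intros)

lemma C1_bounded_linear: "bounded_linear f \<Longrightarrow> C1 f"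
  by (rule C1I[of _ "\<lambda>_. f"]) (auto intro: bounded_linear_imp_has_derivative)

lemma C1_ident: "C1 (\<lambda>x. x)"
  by (rule C1_bounded_linear) (rule bounded_linear_ident)

lemma C1_compose:
  fixes f :: "'a::euclidean_space \<Rightarrow> 'b::euclidean_space"
  assumes "C1 f" "C1 g"
  shows "C1 (\<lambda>x. g (f x))"
proof -
  obtain f' where f': "\<And>x. (f has_derivative f' x) (at x)" "\<And>h. continuous_on UNIV (\<lambda>x. f' x h)"
    by (rule C1E[OF assms(1)]) (rule that)
  obtain g' where g': "\<And>x. (g has_derivative g' x) (at x)"
    "\<And>(S::'a set) p q. continuous_on S p \<Longrightarrow> continuous_on S q \<Longrightarrow> continuous_on S (\<lambda>y. g' (p y) (q y))"
    by (rule C1E_joint[OF assms(2), where 'c='a]) (rule that)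
  show ?thesis
  proof (rule C1I)
    show "((\<lambda>x. g (f x)) has_derivative (\<lambda>h. g' (f x) (f' x h))) (at x)" for x
      using has_derivative_compose[OF f'(1) g'(1)] by simp
    show "continuous_on UNIV (\<lambda>x. g' (f x) (f' x h))" for h
      by (intro g'(2) f'(2) C1_continuous assms)
  qed
qed

lemma C1_bilinear:
  fixes f :: "'a::euclidean_space \<Rightarrow> 'b::real_normed_vector"
  assumes "bounded_bilinear prd" "C1 f" "C1 g"
  shows "C1 (\<lambda>x. prd (f x) (g x))"
proof -
  interpret bounded_bilinear prd by fact
  obtain f' where f': "\<And>x. (f has_derivative f' x) (at x)" "\<And>h. continuous_on UNIV (\<lambda>x. f' x h)"
    by (rule C1E[OF assms(2)]) (rule that)
  obtain g' where g': "\<And>x. (g has_derivative g' x) (at x)" "\<And>h. continuous_on UNIV (\<lambda>x. g' x h)"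
    by (rule C1E[OF assms(3)]) (rule that)
  show ?thesis
  proof (rule C1I)
    show "((\<lambda>x. prd (f x) (g x)) has_derivative (\<lambda>h. prd (f x) (g' x h) + prd (f' x h) (g x))) (at x)" for x
      by (rule FDERIV[OF f'(1) g'(1)])
    show "continuous_on UNIV (\<lambda>x. prd (f x) (g' x h) + prd (f' x h) (g x))" for h
      using C1_continuous[OF assms(2)] C1_continuous[OF assms(3)] f'(2) g'(2)
      by (intro continuous_on_add continuous_on) auto
  qed
qed

lemmas C1_scaleR = C1_bilinear[OF bounded_bilinear_scaleR]
lemmas C1_mult = C1_bilinear[OF bounded_bilinear_mult]
lemmas C1_inner = C1_bilinear[OF bounded_bilinear_inner]

lemma C1_add:
  assumes "C1 f" "C1 g"
  shows "C1 (\<lambda>x. f x + g x)"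
proof -
  obtain f' where f': "\<And>x. (f has_derivative f' x) (at x)" "\<And>h. continuous_on UNIV (\<lambda>x. f' x h)"
    by (rule C1E[OF assms(1)]) (rule that)
  obtain g' where g': "\<And>x. (g has_derivative g' x) (at x)" "\<And>h. continuous_on UNIV (\<lambda>x. g' x h)"
    by (rule C1E[OF assms(2)]) (rule that)
  show ?thesis
    by (rule C1I[OF has_derivative_add[OF f'(1) g'(1)]]) (intro continuous_on_add f'(2) g'(2))
qed

lemma C1_minus: "C1 f \<Longrightarrow> C1 (\<lambda>x. - f x)"
  using C1_scaleR[OF C1_const[of "-1"]] by simp

lemma C1_diff: "C1 f \<Longrightarrow> C1 g \<Longrightarrow> C1 (\<lambda>x. f x - g x)"
  using C1_add[OF _ C1_minus] by simp

lemma C1_sum: "(\<And>i. i \<in> I \<Longrightarrow> C1 (f i)) \<Longrightarrow> C1 (\<lambda>x. \<Sum>i\<in>I. f i x)"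
  by (induction I rule: infinite_finite_induct) (auto intro: C1_const C1_add)

lemma C1_real:
  assumes "\<And>y. (u has_real_derivative u' y) (at y)" "continuous_on UNIV u'"
  shows "C1 u"
  by (rule C1I[of u "\<lambda>x h. u' x * h"])
    (use assms in \<open>auto simp: has_field_derivative_def intro!: continuous_intros\<close>)

lemmas C1_intros = C1_const C1_ident C1_scaleR C1_mult C1_inner C1_add C1_minus C1_diff C1_sum

lemma C1c_fields_iff: "\<phi> \<in> C1c_fields \<Omega> \<longleftrightarrow> C1 \<phi> \<and> compact (spt \<phi>) \<and> spt \<phi> \<subseteq> \<Omega>"
  unfolding C1c_fields_def C1_def by simp

lemma spt_subsetI: "closed K \<Longrightarrow> (\<And>x. x \<notin> K \<Longrightarrow> f x = 0) \<Longrightarrow> spt f \<subseteq> K"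
  unfolding spt_def by (rule closure_minimal) auto

lemma notin_spt: "x \<notin> spt f \<Longrightarrow> f x = 0"
  unfolding spt_def using closure_subset[of "{x. f x \<noteq> 0}"] by auto

lemma closed_spt: "closed (spt f)"
  unfolding spt_def by simp

lemma compact_spt_subset: "compact K \<Longrightarrow> spt f \<subseteq> K \<Longrightarrow> compact (spt f)"
  by (metis closed_spt compact_Int_closed inf.absorb_iff2)

text \<open>The squared positive part is the C^1 building block of the bump functions below and of
  \<open>ramp\<close>.\<close>

lemma DERIV_pos_part_square: "((\<lambda>y::real. (max 0 y)\<^sup>2) has_real_derivative 2 * max 0 y) (at y)"
proof (cases "y = 0")
  case True
  have "((\<lambda>h::real. (max 0 h)\<^sup>2 / h) \<longlongrightarrow> 0) (at 0)"
  proof (rule tendsto_sandwich[where f="\<lambda>h. - \<bar>h\<bar>" and h="\<lambda>h. \<bar>h\<bar>"])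
    have *: "\<bar>(max 0 h)\<^sup>2 / h\<bar> \<le> \<bar>h\<bar>" for h :: real
      by (auto simp: max_def power2_eq_square)
    have b: "- \<bar>h\<bar> \<le> (max 0 h)\<^sup>2 / h \<and> (max 0 h)\<^sup>2 / h \<le> \<bar>h\<bar>" for h :: real
      using *[of h] by linarith
    show "\<forall>\<^sub>F h::real in at 0. - \<bar>h\<bar> \<le> (max 0 h)\<^sup>2 / h" by (intro always_eventually allI conjunct1[OF b])
    show "\<forall>\<^sub>F h::real in at 0. (max 0 h)\<^sup>2 / h \<le> \<bar>h\<bar>" by (intro always_eventually allI conjunct2[OF b])
  qed (auto intro!: tendsto_eq_intros)
  then show ?thesis using True by (simp add: DERIV_def)
next
  case False
  have "((\<lambda>y::real. if y > 0 then y\<^sup>2 else 0) has_real_derivative 2 * max 0 y) (at y)" 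
  proof (cases "y > 0")
    case True
    have "((\<lambda>y::real. y\<^sup>2) has_real_derivative 2 * max 0 y) (at y)"
      using True by (auto intro!: derivative_eq_intros)
    then show ?thesis
      by (rule DERIV_cong_ev[THEN iffD1, rotated -1, OF _ refl _ refl])
        (use True in \<open>auto simp: eventually_nhds intro!: exI[of _ "{0<..}"]\<close>)
  next
    case F: False
    have "((\<lambda>y::real. 0) has_real_derivative 2 * max 0 y) (at y)"
      using F by (auto intro!: derivative_eq_intros)
    then show ?thesis
      by (rule DERIV_cong_ev[THEN iffD1, rotated -1, OF _ refl _ refl])
        (use F False in \<open>auto simp: eventually_nhds intro!: exI[of _ "{..<0}"]\<close>)
  qed
  moreover have "(\<lambda>y::real. if y > 0 then y\<^sup>2 else 0) = (\<lambda>y. (max 0 y)\<^sup>2)" by (auto simp: max_def)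
  ultimately show ?thesis by simp
qed

section \<open>Smooth approximation of indicators of open sets\<close>

lemma open_as_balls:
  fixes U :: "'a::euclidean_space set"
  assumes "open U" "U \<noteq> {}"
  shows "\<exists>(a :: nat \<Rightarrow> 'a) e. (\<forall>i. e i > 0 \<and> cball (a i) (e i) \<subseteq> U) \<and> U = (\<Union>i. ball (a i) (e i))"
proof -
  let ?F = "{B. \<exists>x e. e > 0 \<and> cball x e \<subseteq> U \<and> B = ball x e}"
  obtain F where F: "F \<subseteq> ?F" "countable F" "\<Union>F = \<Union>?F"
    using Lindelof[of ?F] by auto
  have "\<Union>?F = U"
  proof
    show "U \<subseteq> \<Union>?F"
    proof
      fix x assume "x \<in> U"
      then obtain e where "e > 0" "cball x e \<subseteq> U" using assms(1) open_contains_cball by metis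
      then show "x \<in> \<Union>?F" by (auto intro!: exI[of _ "ball x e"])
    qed
  qed (use ball_subset_cball in blast)
  then have ne: "F \<noteq> {}" using F(3) assms(2) by auto
  let ?B = "from_nat_into F"
  have "?B i \<in> ?F" for i using F(1) from_nat_into[OF ne] by blast
  then have "\<forall>i. \<exists>p. snd p > 0 \<and> cball (fst p) (snd p) \<subseteq> U \<and> ?B i = ball (fst p) (snd p)" by fastforce
  then obtain p where p: "\<And>i. snd (p i) > 0" "\<And>i. cball (fst (p i)) (snd (p i)) \<subseteq> U"
      "\<And>i. ?B i = ball (fst (p i)) (snd (p i))" by metis
  have "U = (\<Union>i. ball (fst (p i)) (snd (p i)))"
    using \<open>\<Union>?F = U\<close> F(3) range_from_nat_into[OF ne F(2)] p(3) by auto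
  then show ?thesis
    using p by (intro exI[of _ "\<lambda>i. fst (p i)"] exI[of _ "\<lambda>i. snd (p i)"]) auto
qed

text \<open>\<open>c i\<close> is a C^1 bump that is positive exactly on the i-th ball. Only
  finitely many bumps enter \<open>f k\<close>, so its support is compact, and it stays in U because
  the closed balls do. The growing factor k drives the exponential to 0 wherever some bump is
  positive.\<close>

lemma indicator_open_limit_C1:
  fixes U :: "'a::euclidean_space set"
  assumes "open U"
  obtains f :: "nat \<Rightarrow> 'a \<Rightarrow> real"
  where "\<And>k. C1 (f k)" "\<And>k. compact (spt (f k))" "\<And>k. spt (f k) \<subseteq> U"
    "\<And>k x. 0 \<le> f k x" "\<And>k x. f k x \<le> 1" "\<And>x. (\<lambda>k. f k x) \<longlonglongrightarrow> indicator U x"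
proof (cases "U = {}")
  case True
  show thesis
  proof (rule that[of "\<lambda>_ _. 0"])
    show "spt (\<lambda>_. 0) \<subseteq> U" by (simp add: spt_def)
  qed (auto simp: C1_const spt_def True)
next
  case False
  obtain a :: "nat \<Rightarrow> 'a" and e where "(\<forall>i. e i > 0 \<and> cball (a i) (e i) \<subseteq> U) \<and> U = (\<Union>i. ball (a i) (e i))"
    using open_as_balls[OF assms False] by blast
  then have ae: "\<And>i. e i > 0" "\<And>i. cball (a i) (e i) \<subseteq> U" "U = (\<Union>i. ball (a i) (e i))"
    by blast+
  define c where "c i x = (max 0 ((e i)\<^sup>2 - (x - a i) \<bullet> (x - a i)))\<^sup>2" for i :: nat and x
  have c_pos: "0 < c i x \<longleftrightarrow> x \<in> ball (a i) (e i)" for i x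
  proof -
    have "0 < c i x \<longleftrightarrow> (norm (x - a i))\<^sup>2 < (e i)\<^sup>2"
    proof -
      have "0 < (max 0 y)\<^sup>2 \<longleftrightarrow> 0 < y" for y :: real by (cases "0 < y") (auto simp: max_def)
      then show ?thesis unfolding c_def dot_square_norm by simp
    qed
    also have "\<dots> \<longleftrightarrow> norm (x - a i) < e i"
      using ae(1)[of i] by (auto intro: power2_less_imp_less power_strict_mono)
    finally show ?thesis by (simp add: dist_norm norm_minus_commute)
  qed
  have c_nonneg: "0 \<le> c i x" for i x unfolding c_def by simp
  have C1_c: "C1 (c i)" for i
    unfolding c_def
    by (rule C1_compose[OF _ C1_real[OF DERIV_pos_part_square]]) (auto intro!: C1_intros continuous_intros)
  define f where "f k x = 1 - exp (- (real k * (\<Sum>i<k. c i x)))" for k x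
  have C1_exp: "C1 (exp :: real \<Rightarrow> real)"
    by (rule C1_real[of _ exp]) (auto intro!: derivative_eq_intros continuous_intros)
  have sptf: "spt (f k) \<subseteq> (\<Union>i<k. cball (a i) (e i))" for k
  proof (rule spt_subsetI)
    fix x assume "x \<notin> (\<Union>i<k. cball (a i) (e i))"
    then have "c i x = 0" if "i < k" for i
    proof -
      have "x \<notin> ball (a i) (e i)" using \<open>x \<notin> _\<close> that ball_subset_cball by blast
      then show ?thesis using c_pos[of i x] c_nonneg[of i x] by linarith
    qed
    then show "f k x = 0" by (simp add: f_def)
  qed auto
  show thesis
  proof (rule that[of f])
    show "C1 (f k)" for k
      unfolding f_def by (intro C1_diff C1_const C1_compose[OF _ C1_exp] C1_minus C1_mult C1_sum C1_c)
    show "compact (spt (f k))" for k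
      by (rule compact_spt_subset[OF _ sptf]) auto
    show "spt (f k) \<subseteq> U" for k using sptf[of k] ae(2) by blast
    show "0 \<le> f k x" for k x
      unfolding f_def using c_nonneg by (simp add: sum_nonneg)
    show "f k x \<le> 1" for k x unfolding f_def by simp
    show "(\<lambda>k. f k x) \<longlonglongrightarrow> indicator U x" for x
    proof (cases "x \<in> U")
      case True
      then obtain i where i: "0 < c i x" using ae(3) c_pos by auto
      have "(\<lambda>k. 1 - exp (- (real k * c i x))) \<longlonglongrightarrow> 1 - 0"
      proof (intro tendsto_intros filterlim_compose[OF exp_at_bot])
        show "filterlim (\<lambda>k. - (real k * c i x)) at_bot sequentially"
          unfolding filterlim_uminus_at_bot using i
          filterlim_tendsto_pos_mult_at_top[OF tendsto_const i filterlim_real_sequentially]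
          by (simp add: mult.commute)
      qed
      then have l: "(\<lambda>k. 1 - exp (- (real k * c i x))) \<longlonglongrightarrow> 1" by simp
      have "(\<lambda>k. f k x) \<longlonglongrightarrow> 1"
      proof (rule tendsto_sandwich[OF _ _ l tendsto_const])
        show "\<forall>\<^sub>F k in sequentially. 1 - exp (- (real k * c i x)) \<le> f k x"
          using eventually_gt_at_top[of i]
        proof eventually_elim
          case (elim k)
          have "c i x \<le> (\<Sum>i<k. c i x)" using elim c_nonneg by (intro member_le_sum) auto
          then show ?case unfolding f_def by (simp add: mult_left_mono)
        qed
      qed (simp add: f_def)
      then show ?thesis using True by simp
    next
      case False
      have "c i x = 0" for i
      proof -
        have "x \<notin> ball (a i) (e i)" using False ae(3) by blast
        then show ?thesis using c_pos[of i x] c_nonneg[of i x] by linarith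
      qed
      then have "f k x = 0" for k by (simp add: f_def)
      then show ?thesis using False by simp
    qed
  qed
qed

section \<open>Uniqueness of the derivative measure\<close>

lemma sets_restrict_borel_open:
  fixes \<Omega> :: "'a::topological_space set"
  assumes "open \<Omega>"
  shows "sets (restrict_space borel \<Omega>) = sigma_sets \<Omega> {U. open U \<and> U \<subseteq> \<Omega>}"
proof -
  have "sets (restrict_space borel \<Omega>) = (\<inter>) \<Omega> ` sigma_sets UNIV {S. open S}"
    by (simp add: sets_restrict_space borel_def)
  also have "\<dots> = sigma_sets \<Omega> ((\<inter>) \<Omega> ` {S. open S})" by (rule sigma_sets_Int) (use assms in \<open>auto intro: sigma_sets.Basic\<close>)
  also have "(\<inter>) \<Omega> ` {S. open S} = {U. open U \<and> U \<subseteq> \<Omega>}"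
    using assms by (auto intro!: image_eqI[of _ "(\<inter>) \<Omega>"])
  finally show ?thesis .
qed

lemma open_in_restrict_borel: "open \<Omega> \<Longrightarrow> open U \<Longrightarrow> U \<subseteq> \<Omega> \<Longrightarrow> U \<in> sets (restrict_space borel \<Omega>)"
  by (auto simp: sets_restrict_borel_open)

lemma (in vec_measure) vm_integral_tendsto:
  assumes "open U" "U \<subseteq> \<Omega>" "open \<Omega>"
    and f: "\<And>k. f k \<in> borel_measurable borel" "\<And>k x. 0 \<le> f k x" "\<And>k x. f k x \<le> (1::real)"
      "\<And>x. (\<lambda>k. f k x) \<longlonglongrightarrow> indicator U x"
  shows "(\<lambda>k. vm_integral \<Omega> D (\<lambda>x. f k x *\<^sub>R b)) \<longlonglongrightarrow> D U \<bullet> b"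
proof -
  have U: "U \<in> S" by (rule open_in_restrict_borel) fact+
  have [measurable]: "f k \<in> borel_measurable TV" for k
    using measurable_restrict_space1[OF f(1)] by (simp cong: measurable_cong_sets)
  have [measurable]: "U \<in> sets TV" using U by simp
  have "(\<lambda>k. LINT x|TV. f k x *\<^sub>R \<nu> x) \<longlonglongrightarrow> (LINT x|TV. indicator U x *\<^sub>R \<nu> x)"
  proof (rule integral_dominated_convergence[where w="\<lambda>x. norm (\<nu> x)"])
    show "AE x in TV. (\<lambda>k. f k x *\<^sub>R \<nu> x) \<longlonglongrightarrow> indicator U x *\<^sub>R \<nu> x"
      using f(4) by (auto intro!: tendsto_intros)
    show "AE x in TV. norm (f k x *\<^sub>R \<nu> x) \<le> norm (\<nu> x)" for k
      using f(2,3) by (auto intro!: mult_left_le_one_le)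
  qed (use integrable_rn_density in auto)
  then have "(\<lambda>k. (LINT x|TV. f k x *\<^sub>R \<nu> x) \<bullet> b) \<longlonglongrightarrow> D U \<bullet> b"
    unfolding D_eq_integral[OF U] set_lebesgue_integral_def by (intro tendsto_intros)
  moreover have "(LINT x|TV. f k x *\<^sub>R \<nu> x) \<bullet> b = vm_integral \<Omega> D (\<lambda>x. f k x *\<^sub>R b)" for k
  proof -
    have "integrable TV (\<lambda>x. f k x *\<^sub>R \<nu> x)"
      by (rule Bochner_Integration.integrable_bound[OF integrable_norm[OF integrable_rn_density]])
        (use f(2,3) in \<open>auto intro!: mult_left_le_one_le\<close>)
    then show ?thesis unfolding vm_integral_def
      by (subst integral_inner_left[symmetric]) (auto simp: inner_commute)
  qed
  ultimately show ?thesis by simp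
qed

text \<open>The fields \<open>f k x *\<^sub>R b\<close>, with \<open>f k\<close> tending to the
  indicator of an open set, recover every coordinate of the measure of that set. The open subsets
  form an intersection-stable generator, so a Dynkin argument reaches all Borel sets.\<close>

lemma derivative_measure_unique:
  fixes \<Omega> :: "'a::euclidean_space set"
  assumes "open \<Omega>" and D1: "derivative_measure \<Omega> u D1" and D2: "derivative_measure \<Omega> u D2"
    and B: "B \<in> sets (restrict_space borel \<Omega>)"
  shows "D1 B = D2 B"
proof -
  interpret D1: vec_measure \<Omega> D1 using D1 by unfold_locales (simp add: derivative_measure_def)
  interpret D2: vec_measure \<Omega> D2 using D2 by unfold_locales (simp add: derivative_measure_def)
  have eq_open: "D1 U = D2 U" if U: "open U" "U \<subseteq> \<Omega>" for U
  proof (rule euclidean_eqI)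
    fix b :: 'a
    obtain f :: "nat \<Rightarrow> 'a \<Rightarrow> real" where f: "\<And>k. C1 (f k)" "\<And>k. compact (spt (f k))" "\<And>k. spt (f k) \<subseteq> U"
      "\<And>k x. 0 \<le> f k x" "\<And>k x. f k x \<le> 1" "\<And>x. (\<lambda>k. f k x) \<longlonglongrightarrow> indicator U x"
      by (rule indicator_open_limit_C1[OF U(1)]) (rule that, assumption+)
    have "(\<lambda>x. f k x *\<^sub>R b) \<in> C1c_fields \<Omega>" for k
    proof -
      have s: "spt (\<lambda>x. f k x *\<^sub>R b) \<subseteq> spt (f k)"
        by (rule spt_subsetI[OF closed_spt]) (simp add: notin_spt)
      show ?thesis unfolding C1c_fields_iff
        using s f(3)[of k] U(2) by (intro conjI C1_intros f compact_spt_subset[OF f(2) s]) auto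
    qed
    then have "vm_integral \<Omega> D1 (\<lambda>x. f k x *\<^sub>R b) = vm_integral \<Omega> D2 (\<lambda>x. f k x *\<^sub>R b)" for k
      using D1 D2 unfolding derivative_measure_def by (metis neg_equal_iff_equal)
    moreover note D1.vm_integral_tendsto[OF U assms(1) C1_measurable[OF f(1)] f(4,5,6), of b]
      D2.vm_integral_tendsto[OF U assms(1) C1_measurable[OF f(1)] f(4,5,6), of b]
    ultimately show "D1 U \<bullet> b = D2 U \<bullet> b" using LIMSEQ_unique by simp
  qed
  let ?G = "{U. open U \<and> U \<subseteq> \<Omega>}"
  have "Int_stable ?G" by (auto intro!: Int_stableI)
  moreover have "?G \<subseteq> Pow \<Omega>" by auto
  moreover have "B \<in> sigma_sets \<Omega> ?G" using B by (simp add: sets_restrict_borel_open[OF assms(1)])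
  ultimately show ?thesis
  proof (induction rule: sigma_sets_induct_disjoint)
    case (basic U)
    then show ?case using eq_open by auto
  next
    case (compl A)
    then have A: "A \<in> D1.S" by (simp add: sets_restrict_borel_open[OF assms(1)])
    then have "A \<subseteq> \<Omega>" by (rule D1.S_subset)
    then show ?case
      using compl D1.D_Diff[OF A D1.Omega_in_S] D2.D_Diff[OF A D2.Omega_in_S] eq_open[OF assms(1)] by simp
  next
    case (union A)
    then have A: "range A \<subseteq> D1.S" by (simp add: sets_restrict_borel_open[OF assms(1)])
    show ?case
      using D1.D_sums[OF A union(1)] D2.D_sums[OF A union(1)] union(3) by (simp add: sums_unique2)
  qed simp
qed

text \<open>\<open>Dchi\<close> is merely some choice of a derivative measure. With this lemma
  \<open>F_S\<close> of a competitor can be estimated through an explicit, transported one.\<close>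

lemma total_variation_derivative_unique:
  fixes \<Omega> :: "'a::euclidean_space set"
  assumes "open \<Omega>" "derivative_measure \<Omega> u D1" "derivative_measure \<Omega> u D2"
  shows "total_variation \<Omega> D1 = total_variation \<Omega> D2"
proof -
  have "D1 (A i) = D2 (A i)" if "range A \<subseteq> sets (restrict_space borel \<Omega>)" for A :: "nat \<Rightarrow> 'a set" and i
    using that by (intro derivative_measure_unique[OF assms]) auto
  then show ?thesis unfolding total_variation_def
    by (intro arg_cong2[where f="measure_of \<Omega>"] refl ext SUP_cong) auto
qed

subsection \<open>Shears and their change of variables\<close>

lemma derivative_notin_spt:
  assumes "(f has_derivative f') (at x)" "x \<notin> spt f"
  shows "f' h = 0"
proof -
  have "((\<lambda>_. 0) has_derivative f') (at x)"
    by (rule has_derivative_transform_within_open[OF assms(1), of "- spt f"])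
      (use assms(2) closed_spt notin_spt in \<open>auto simp: open_Compl\<close>)
  then have "f' = (\<lambda>_. 0)" by (rule has_derivative_unique) (rule has_derivative_const)
  then show ?thesis by simp
qed

lemma continuous_compact_spt_bounded:
  fixes f :: "'a::t2_space \<Rightarrow> 'b::real_normed_vector"
  assumes "continuous_on UNIV f" "compact (spt f)"
  obtains K where "0 \<le> K" "\<And>x. norm (f x) \<le> K"
proof -
  have "bounded (f ` spt f)"
    using assms by (intro compact_imp_bounded compact_continuous_image) (auto intro: continuous_on_subset)
  then obtain K where K: "\<And>x. x \<in> spt f \<Longrightarrow> norm (f x) \<le> K" unfolding bounded_iff by auto
  have "norm (f x) \<le> max K 0" for x
    using K[of x] notin_spt[of x f] by (cases "x \<in> spt f") auto
  then show thesis by (intro that[of "max K 0"]) auto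
qed

lemma lborel_integral_cbox:
  fixes f :: "'a::euclidean_space \<Rightarrow> real"
  assumes "continuous_on UNIV f" "\<And>x. x \<notin> cbox a b \<Longrightarrow> f x = 0"
  shows "integrable lborel f" "f integrable_on cbox a b" "integral (cbox a b) f = (LINT x|lborel. f x)"
proof -
  have i: "set_integrable lborel (cbox a b) f"
    unfolding set_integrable_def
    using assms(1) by (intro borel_integrable_compact) (auto intro: continuous_on_subset)
  moreover have eq: "(\<lambda>x. indicator (cbox a b) x *\<^sub>R f x) = f"
    using assms(2) by (auto simp: fun_eq_iff indicator_def)
  ultimately show "integrable lborel f" unfolding set_integrable_def by simp
  show "f integrable_on cbox a b" "integral (cbox a b) f = (LINT x|lborel. f x)"
    using set_borel_integral_eq_integral[OF i] eq unfolding set_lebesgue_integral_def by simp_all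
qed

lemma lborel_integral_translation:
  fixes f :: "'a::euclidean_space \<Rightarrow> real"
  assumes "f \<in> borel_measurable borel"
  shows "(LINT x|lborel. f (x + c)) = (LINT x|lborel. f x)"
proof -
  have "(LINT x|lborel. f x) = (LINT x|distr lborel borel ((+) c). f x)"
    by (simp add: lborel_distr_plus)
  also have "\<dots> = (LINT x|lborel. f (c + x))"
    using assms by (intro integral_distr) simp_all
  finally show ?thesis by (simp add: add.commute)
qed

text \<open>By translation invariance the integral of \<open>g (x + s *\<^sub>R e)\<close> does not
  depend on s, and its derivative at s = 0 is the integral in question. The cube exceeds the support
  by \<open>norm e\<close>, so that it contains all translates with s in \<open>{-1..1}\<close> and
  differentiation under the integral takes place over a compact set.\<close>

lemma integral_directional_derivative:
  fixes g :: "'a::euclidean_space \<Rightarrow> real"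
  assumes g': "\<And>x. (g has_derivative g' x) (at x)"
    and cont: "continuous_on UNIV (\<lambda>x. g' x e)"
    and cpt: "compact (spt g)"
  shows "(LINT x|lborel. g' x e) = 0"
proof -
  have cg: "continuous_on S g" for S
    using g' has_derivative_continuous by (blast intro: continuous_at_imp_continuous_on)
  obtain B where B: "\<And>x. x \<in> spt g \<Longrightarrow> norm x \<le> B"
    using compact_imp_bounded[OF cpt] unfolding bounded_iff by auto
  obtain a where a: "cball (0::'a) (B + norm e) \<subseteq> cbox (- a) a"
    using bounded_subset_cbox_symmetric[of "cball (0::'a) (B + norm e)"] by auto
  have out: "x + s *\<^sub>R e \<notin> spt g" if "s \<in> {-1..1}" "x \<notin> cbox (- a) a" for s x
  proof
    assume "x + s *\<^sub>R e \<in> spt g"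
    then have "norm (x + s *\<^sub>R e) \<le> B" by (rule B)
    moreover have "norm x \<le> norm (x + s *\<^sub>R e) + norm (s *\<^sub>R e)"
      using norm_triangle_ineq4[of "x + s *\<^sub>R e" "s *\<^sub>R e"] by simp
    moreover have "norm (s *\<^sub>R e) \<le> norm e" using that(1) by (auto intro!: mult_left_le_one_le)
    ultimately have "x \<in> cball 0 (B + norm e)" by simp
    then show False using a that(2) by blast
  qed
  let ?\<Phi> = "\<lambda>s. integral (cbox (- a) a) (\<lambda>x. g (x + s *\<^sub>R e))"
  have c1: "continuous_on UNIV (\<lambda>x. g (x + s *\<^sub>R e))" for s
    by (rule continuous_on_compose2[OF cg[of UNIV]]) (auto intro!: continuous_intros)
  have "(?\<Phi> has_field_derivative integral (cbox (- a) a) (\<lambda>x. g' (x + 0 *\<^sub>R e) e)) (at 0 within {-1..1})"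
  proof (rule leibniz_rule_field_derivative)
    fix s x
    have "((\<lambda>s. g (x + s *\<^sub>R e)) has_derivative (\<lambda>h. g' (x + s *\<^sub>R e) (h *\<^sub>R e))) (at s within {-1..1})"
      by (rule has_derivative_compose[OF _ g', of "\<lambda>s. x + s *\<^sub>R e", simplified])
        (auto intro!: derivative_eq_intros)
    moreover have "g' y (h *\<^sub>R e) = g' y e * h" for y h
      using linear_cmul[OF has_derivative_linear[OF g'[of y]]] by (simp add: mult.commute)
    ultimately show "((\<lambda>s. g (x + s *\<^sub>R e)) has_field_derivative g' (x + s *\<^sub>R e) e) (at s within {-1..1})"
      by (simp add: has_field_derivative_def)
    show "(\<lambda>x. g (x + s *\<^sub>R e)) integrable_on cbox (- a) a"
      by (rule integrable_continuous) (rule continuous_on_subset[OF c1], simp)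
    show "continuous_on ({-1..1} \<times> cbox (- a) a) (\<lambda>(s, x). g' (x + s *\<^sub>R e) e)"
      unfolding split_beta
      by (rule continuous_on_compose2[OF cont]) (auto intro!: continuous_intros)
  qed auto
  moreover have "?\<Phi> s = (LINT x|lborel. g x)" if "s \<in> {-1..1}" for s
  proof -
    have "?\<Phi> s = (LINT x|lborel. g (x + s *\<^sub>R e))"
      using out[OF that] by (intro lborel_integral_cbox(3)[OF c1] notin_spt) 
    then show ?thesis
      by (simp add: lborel_integral_translation borel_measurable_continuous_onI[OF cg])
  qed
  then have "(?\<Phi> has_field_derivative 0) (at 0 within {-1..1})"
    by (intro has_field_derivative_transform_within[OF DERIV_const, where d=1]) simp_all
  moreover have "at (0::real) within {-1..1} = at 0"
    by (rule at_within_interior) (auto simp: interior_atLeastAtMost_real)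
  ultimately have "integral (cbox (- a) a) (\<lambda>x. g' (x + 0 *\<^sub>R e) e) = 0"
    using DERIV_unique by metis
  then have "integral (cbox (- a) a) (\<lambda>x. g' x e) = 0" by simp
  moreover have "integral (cbox (- a) a) (\<lambda>x. g' x e) = (LINT x|lborel. g' x e)"
    by (rule lborel_integral_cbox(3)[OF cont])
      (use out[of 0] derivative_notin_spt[OF g'] in auto)
  ultimately show ?thesis by simp
qed

locale shear_field =
  fixes \<eta> :: "'a::euclidean_space \<Rightarrow> real" and G :: "'a \<Rightarrow> 'a" and e :: 'a
  assumes der: "\<And>x. (\<eta> has_derivative (\<lambda>h. G x \<bullet> h)) (at x)"
    and contG: "continuous_on UNIV G"
    and cpt: "compact (spt \<eta>)"
begin

lemma C1_\<eta>: "C1 \<eta>"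
  by (rule C1I[OF der]) (intro continuous_intros contG)

lemma G_notin_spt: "x \<notin> spt \<eta> \<Longrightarrow> G x = 0"
  using derivative_notin_spt[OF der, of x "G x"] by simp

lemma compact_spt_G: "compact (spt G)"
  by (rule compact_spt_subset[OF cpt]) (rule spt_subsetI, rule closed_spt, rule G_notin_spt)

lemma integral_div_zero: "(LINT x|lborel. G x \<bullet> e) = 0"
  by (rule integral_directional_derivative[OF der _ cpt]) (intro continuous_intros contG)

definition \<phi> :: "real \<Rightarrow> 'a \<Rightarrow> 'a" where "\<phi> t x = x + (t * \<eta> x) *\<^sub>R e"

text \<open>The determinant of the derivative of \<open>\<phi> t\<close>, which is the identity plus
  a rank-one map. That it governs the change of variables is derived from
  \<open>shear_integral_C1\<close>, without speaking of determinants.\<close>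

definition J :: "real \<Rightarrow> 'a \<Rightarrow> real" where "J t x = 1 + t * (G x \<bullet> e)"

lemma \<phi>_notin_spt: "x \<notin> spt \<eta> \<Longrightarrow> \<phi> t x = x"
  by (simp add: \<phi>_def notin_spt)

lemma \<phi>_has_derivative: "(\<phi> t has_derivative (\<lambda>h. h + (t * (G x \<bullet> h)) *\<^sub>R e)) (at x)"
  unfolding \<phi>_def by (auto intro!: derivative_eq_intros der)

lemma C1_\<phi>: "C1 (\<phi> t)"
  unfolding \<phi>_def by (intro C1_intros C1_\<eta>)

lemma continuous_J: "continuous_on S (J t)"
  unfolding J_def using contG by (intro continuous_intros) (auto intro: continuous_on_subset)

(* The derivative in t of the integral on the left is the integral of the directional derivative
   along e of (f o phi t) * eta, hence zero. *)
lemma shear_integral_C1: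
  fixes f :: "'a \<Rightarrow> real"
  assumes f: "C1 f" "compact (spt f)"
  shows "(LINT x|lborel. f (\<phi> t x) * J t x) = (LINT x|lborel. f x)"
proof -
  obtain f' where f': "\<And>x. (f has_derivative f' x) (at x)"
    "\<And>(S::(real \<times> 'a) set) p q. continuous_on S p \<Longrightarrow> continuous_on S q \<Longrightarrow> continuous_on S (\<lambda>y. f' (p y) (q y))"
    by (rule C1E_joint[OF f(1), where 'c="real \<times> 'a"]) (rule that)
  \<comment> \<open>The same derivative is obtained again because \<open>C1E_joint\<close> fixes one
    type of parameter space: pairs of time and point above, points here.\<close>
  obtain f1' where f1': "\<And>x. (f has_derivative f1' x) (at x)"
    "\<And>(S::'a set) p q. continuous_on S p \<Longrightarrow> continuous_on S q \<Longrightarrow> continuous_on S (\<lambda>y. f1' (p y) (q y))"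
    by (rule C1E_joint[OF f(1), where 'c='a]) (rule that)
  have f1'_eq: "f1' = f'" using has_derivative_unique[OF f1'(1) f'(1)] by (rule ext)
  have cf: "continuous_on S f" for S by (rule C1_continuous[OF f(1)])
  have c\<eta>: "continuous_on S \<eta>" for S by (rule C1_continuous[OF C1_\<eta>])
  have cG: "continuous_on S G" for S using contG by (rule continuous_on_subset) simp
  have lin: "linear (f' x)" for x using f'(1) by (rule has_derivative_linear)
  have "bounded (spt \<eta> \<union> spt f)" using cpt f(2) by (simp add: compact_imp_bounded)
  then obtain a where a: "spt \<eta> \<union> spt f \<subseteq> cbox (- a) a" using bounded_subset_cbox_symmetric by metis
  have out: "f (\<phi> t x) = 0" "\<eta> x = 0" if "x \<notin> cbox (- a) a" for t x
  proof -
    have "x \<notin> spt \<eta>" "x \<notin> spt f" using a that by auto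
    then show "f (\<phi> t x) = 0" "\<eta> x = 0" by (simp_all add: \<phi>_notin_spt notin_spt)
  qed
  let ?H = "\<lambda>t. integral (cbox (- a) a) (\<lambda>x. f (\<phi> t x) * J t x)"
  let ?d = "\<lambda>t x. f' (\<phi> t x) (\<eta> x *\<^sub>R e) * J t x + f (\<phi> t x) * (G x \<bullet> e)"
  have c\<phi>: "continuous_on S (\<phi> t)" for S t by (rule C1_continuous[OF C1_\<phi>])
  have cfJ: "continuous_on UNIV (\<lambda>x. f (\<phi> t x) * J t x)" for t
    by (intro continuous_on_mult continuous_J continuous_on_compose2[OF cf[of UNIV] c\<phi>]) auto
  have dH: "(?H has_field_derivative integral (cbox (- a) a) (?d t)) (at t within UNIV)" for t
  proof (rule leibniz_rule_field_derivative)
    fix t x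
    have "((\<lambda>t. f (\<phi> t x)) has_derivative (\<lambda>h. f' (\<phi> t x) ((h * \<eta> x) *\<^sub>R e))) (at t)"
    proof (rule has_derivative_compose[OF _ f'(1)])
      show "((\<lambda>t. \<phi> t x) has_derivative (\<lambda>h. (h * \<eta> x) *\<^sub>R e)) (at t)"
        unfolding \<phi>_def by (auto intro!: derivative_eq_intros)
    qed
    moreover have "f' y ((h * \<eta> x) *\<^sub>R e) = f' y (\<eta> x *\<^sub>R e) * h" for y h
      using linear_cmul[OF lin, of y h "\<eta> x *\<^sub>R e"] by (simp add: mult.commute)
    ultimately have "((\<lambda>t. f (\<phi> t x)) has_field_derivative f' (\<phi> t x) (\<eta> x *\<^sub>R e)) (at t)"
      by (simp add: has_field_derivative_def)
    moreover have "((\<lambda>t. J t x) has_field_derivative (G x \<bullet> e)) (at t)"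
      unfolding J_def by (auto intro!: derivative_eq_intros)
    ultimately show "((\<lambda>t. f (\<phi> t x) * J t x) has_field_derivative ?d t x) (at t within UNIV)"
      by (auto intro!: derivative_eq_intros)
    show "(\<lambda>x. f (\<phi> t x) * J t x) integrable_on cbox (- a) a"
      by (rule integrable_continuous) (rule continuous_on_subset[OF cfJ], simp)
    have c1: "continuous_on S (\<lambda>p. \<eta> (snd p))" "continuous_on S (\<lambda>p. G (snd p))" for S :: "(real \<times> 'a) set"
      by (rule continuous_on_compose2[OF c\<eta>[of UNIV]] continuous_on_compose2[OF cG[of UNIV]];
          auto intro!: continuous_intros)+
    have c2: "continuous_on S (\<lambda>p. \<phi> (fst p) (snd p))" "continuous_on S (\<lambda>p. J (fst p) (snd p))" for S :: "(real \<times> 'a) set"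
      unfolding \<phi>_def J_def by (intro continuous_intros c1)+
    show "continuous_on (UNIV \<times> cbox (- a) a) (\<lambda>(t, x). ?d t x)"
      unfolding split_beta
      by (intro continuous_intros f'(2) c1 c2 continuous_on_compose2[OF cf[of UNIV] c2(1)]) auto
  qed auto
  have "integral (cbox (- a) a) (?d t) = 0" for t
  proof -
    let ?g = "\<lambda>x. f (\<phi> t x) * \<eta> x"
    let ?g' = "\<lambda>x h. f (\<phi> t x) * (G x \<bullet> h) + f' (\<phi> t x) (h + (t * (G x \<bullet> h)) *\<^sub>R e) * \<eta> x"
    have g': "(?g has_derivative ?g' x) (at x)" for x
      by (rule has_derivative_mult[OF has_derivative_compose[OF \<phi>_has_derivative f'(1)] der])
    \<comment> \<open>The derivative of the shear maps e to J e, so the derivative of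
      \<open>f (\<phi> t x) * \<eta> x\<close> along e reproduces the factor J of the time
      derivative.\<close>
    have "(\<lambda>x. ?g' x e) = (\<lambda>x. ?d t x)"
    proof
      fix x
      have "e + (t * (G x \<bullet> e)) *\<^sub>R e = J t x *\<^sub>R e" by (simp add: J_def algebra_simps)
      then show "?g' x e = ?d t x" by (simp add: linear_cmul[OF lin])
    qed
    moreover have cd: "continuous_on UNIV (\<lambda>x. ?d t x)"
      by (intro continuous_intros continuous_J f1'(2)[unfolded f1'_eq] c\<phi> c\<eta> cG continuous_on_compose2[OF cf[of UNIV] c\<phi>]) auto
    moreover have "compact (spt ?g)"
      by (rule compact_spt_subset[OF cpt], rule spt_subsetI[OF closed_spt]) (simp add: notin_spt)
    ultimately have "(LINT x|lborel. ?d t x) = 0"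
      using integral_directional_derivative[where g="?g" and g'="?g'" and e=e, OF g'] by metis
    moreover have "?d t x = 0" if "x \<notin> cbox (- a) a" for x
    proof -
      have "x \<notin> spt \<eta>" using a that by auto
      then show ?thesis using out(1)[OF that, of t] out(2)[OF that] linear_0[OF lin] by (simp add: G_notin_spt)
    qed
    ultimately show ?thesis using lborel_integral_cbox(3)[OF cd] by simp
  qed
  then have "\<forall>t. (?H has_field_derivative 0) (at t)" using dH by simp
  then have "?H t = ?H 0" by (rule DERIV_isconst_all)
  moreover have H: "?H t = (LINT x|lborel. f (\<phi> t x) * J t x)" for t
    by (rule lborel_integral_cbox(3)[OF cfJ]) (simp add: out)
  ultimately have "(LINT x|lborel. f (\<phi> t x) * J t x) = (LINT x|lborel. f (\<phi> 0 x) * J 0 x)"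
    using H[of 0] by metis
  then show ?thesis by (simp add: \<phi>_def J_def)
qed

end

text \<open>The bound 1/2 makes the displacement a contraction, hence the shear a homeomorphism with
  Lipschitz inverse, and keeps the Jacobian between 1/2 and 3/2.\<close>

locale shear = shear_field +
  fixes t :: real
  assumes small: "\<And>x. \<bar>t\<bar> * norm (G x) * norm e \<le> 1/2"
begin

abbreviation "\<Phi> \<equiv> \<phi> t"

lemma J_pos: "1/2 \<le> J t x" "J t x \<le> 3/2"
proof -
  have "\<bar>t * (G x \<bullet> e)\<bar> \<le> \<bar>t\<bar> * (norm (G x) * norm e)"
    unfolding abs_mult by (intro mult_left_mono Cauchy_Schwarz_ineq2) auto
  then show "1/2 \<le> J t x" "J t x \<le> 3/2"
    using small[of x] unfolding J_def by (auto simp: mult.assoc)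
qed

lemma J_nonneg: "0 \<le> J t x"
  using J_pos(1)[of x] by linarith

lemma displacement_lipschitz: "norm ((\<Phi> x - x) - (\<Phi> y - y)) \<le> 1/2 * norm (x - y)"
proof (rule differentiable_bound[of UNIV])
  show "((\<lambda>x. \<Phi> x - x) has_derivative (\<lambda>h. (t * (G x \<bullet> h)) *\<^sub>R e)) (at x within UNIV)" for x
    using has_derivative_diff[OF \<phi>_has_derivative has_derivative_ident] by simp
  show "onorm (\<lambda>h. (t * (G x \<bullet> h)) *\<^sub>R e) \<le> 1/2" for x
  proof (rule onorm_le)
    fix h
    have "norm ((t * (G x \<bullet> h)) *\<^sub>R e) = \<bar>t\<bar> * \<bar>G x \<bullet> h\<bar> * norm e" by (simp add: abs_mult)
    also have "\<dots> \<le> \<bar>t\<bar> * (norm (G x) * norm h) * norm e"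
      by (intro mult_mono Cauchy_Schwarz_ineq2) auto
    also have "\<dots> = (\<bar>t\<bar> * norm (G x) * norm e) * norm h" by simp
    also have "\<dots> \<le> 1/2 * norm h" by (intro mult_right_mono small) auto
    finally show "norm ((t * (G x \<bullet> h)) *\<^sub>R e) \<le> 1/2 * norm h" .
  qed
qed auto

lemma \<Phi>_expanding: "norm (x - y) \<le> 2 * norm (\<Phi> x - \<Phi> y)"
proof -
  have "norm (x - y) \<le> norm (\<Phi> x - \<Phi> y) + norm ((\<Phi> x - x) - (\<Phi> y - y))"
    using norm_triangle_ineq4[of "\<Phi> x - \<Phi> y" "(\<Phi> x - x) - (\<Phi> y - y)"] by simp
  then show ?thesis using displacement_lipschitz[of x y] by linarith
qed

lemma bij_\<Phi>: "bij \<Phi>"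
proof (rule bijI)
  show "inj \<Phi>"
    using \<Phi>_expanding by (intro injI) (metis eq_iff_diff_eq_0 mult_zero_right norm_le_zero_iff norm_zero)
  show "surj \<Phi>"
  proof (intro surjI)
    fix y
    \<comment> \<open>A fixed point of this contraction is a preimage of y.\<close>
    have "\<exists>!x. y - (\<Phi> x - x) = x"
    proof (rule banach_fix_type[of "1/2"])
      show "\<forall>x x'. dist (y - (\<Phi> x - x)) (y - (\<Phi> x' - x')) \<le> 1/2 * dist x x'"
      proof (intro allI)
        fix x x'
        show "dist (y - (\<Phi> x - x)) (y - (\<Phi> x' - x')) \<le> 1/2 * dist x x'"
          using displacement_lipschitz[of x' x] by (simp add: dist_norm norm_minus_commute algebra_simps)
      qed
    qed auto
    then have "\<exists>x. \<Phi> x = y" by (auto simp: algebra_simps)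
    then show "\<Phi> (SOME x. \<Phi> x = y) = y" by (rule someI_ex)
  qed
qed

lemma inj_\<Phi>: "inj \<Phi>" using bij_\<Phi> by (rule bij_is_inj)

lemma continuous_\<Phi>: "continuous_on S \<Phi>" by (rule C1_continuous[OF C1_\<phi>])

lemma homeomorphism_\<Phi>: "homeomorphism UNIV UNIV \<Phi> (inv \<Phi>)"
proof (rule homeomorphismI)
  have "\<Phi> (inv \<Phi> y) = y" for y using bij_\<Phi> by (simp add: bij_is_surj surj_f_inv_f)
  then have "2-lipschitz_on UNIV (inv \<Phi>)"
    using \<Phi>_expanding[of "inv \<Phi> x" "inv \<Phi> y" for x y]
    by (intro lipschitz_onI) (auto simp: dist_norm)
  then show "continuous_on UNIV (inv \<Phi>)" by (rule lipschitz_on_continuous_on)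
qed (use bij_\<Phi> in \<open>auto simp: continuous_\<Phi> bij_is_surj surj_f_inv_f bij_is_inj\<close>)

lemma open_\<Phi>: "open U \<Longrightarrow> open (\<Phi> ` U)"
  using homeomorphism_imp_open_map[OF homeomorphism_\<Phi>, of U] by simp

lemma closure_\<Phi>: "closure (\<Phi> ` U) = \<Phi> ` closure U"
proof (rule antisym)
  have "closed (\<Phi> ` closure U)"
    using homeomorphism_imp_closed_map[OF homeomorphism_\<Phi>, of "closure U"] by simp
  then show "closure (\<Phi> ` U) \<subseteq> \<Phi> ` closure U"
    by (intro closure_minimal image_mono closure_subset)
  show "\<Phi> ` closure U \<subseteq> closure (\<Phi> ` U)"
    by (intro image_closure_subset continuous_\<Phi>) (auto intro: closure_subset[THEN subsetD])
qed

text \<open>The shear fixes every point where \<eta> vanishes, so as a bijection it permutes any set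
  that contains all other points. It is applied to the domain, to its closure and to the set U in
  which competitors may differ.\<close>

lemma \<Phi>_image_eq:
  assumes "{x. \<eta> x \<noteq> 0} \<subseteq> U"
  shows "\<Phi> ` U = U"
proof
  have fixp: "\<Phi> x = x" if "\<eta> x = 0" for x using that by (simp add: \<phi>_def)
  show "\<Phi> ` U \<subseteq> U"
  proof
    fix y assume "y \<in> \<Phi> ` U"
    then obtain x where x: "x \<in> U" "y = \<Phi> x" by auto
    show "y \<in> U"
    proof (cases "\<eta> y = 0")
      case True
      then have "\<Phi> y = \<Phi> x" using fixp x(2) by simp
      then show ?thesis using x(1) inj_\<Phi> by (simp add: inj_eq)
    qed (use assms in auto)
  qed
  show "U \<subseteq> \<Phi> ` U"
  proof
    fix y assume y: "y \<in> U"
    obtain x where x: "y = \<Phi> x" using bij_\<Phi> by (metis bij_pointE)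
    have "x \<in> U"
    proof (cases "\<eta> x = 0")
      case True then show ?thesis using fixp x y by simp
    qed (use assms in auto)
    then show "y \<in> \<Phi> ` U" using x by auto
  qed
qed

lemma \<Phi>_measurable [measurable]: "\<Phi> \<in> borel_measurable borel"
  by (rule borel_measurable_continuous_onI[OF continuous_\<Phi>])

lemma J_measurable [measurable]: "J t \<in> borel_measurable borel"
  by (rule borel_measurable_continuous_onI[OF continuous_J])

text \<open>Lebesgue measure is determined by its values on boxes, and the identity for C^1
  functions extends to the indicator of a box by dominated convergence. Since the shear shrinks
  distances at most by a factor 2, the preimage of the box is bounded, and its indicator supplies
  the dominating function.\<close>

lemma lborel_eq_distr: "lborel = distr (density lborel (\<lambda>x. ennreal (J t x))) borel \<Phi>"
proof (rule lborel_eqI)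
  fix l u :: 'a assume lu: "\<And>b. b \<in> Basis \<Longrightarrow> l \<bullet> b \<le> u \<bullet> b"
  define V where "V = \<Phi> -` box l u"
  have V: "open V" unfolding V_def by (intro open_vimage open_box continuous_\<Phi>)
  have [measurable]: "V \<in> sets borel" using V by simp
  have "bounded V"
  proof -
    obtain B where B: "\<And>y. y \<in> box l u \<Longrightarrow> norm y \<le> B" using bounded_box[of l u] unfolding bounded_iff by auto
    have "norm x \<le> norm (0::'a) + 2 * (B + norm (\<Phi> 0))" if "x \<in> V" for x
      using \<Phi>_expanding[of x 0] norm_triangle_ineq4[of "\<Phi> x" "\<Phi> 0"] B[of "\<Phi> x"] that unfolding V_def by simp
    then show ?thesis unfolding bounded_iff by blast
  qed
  then have emV: "emeasure lborel V < \<infinity>" by (rule emeasure_bounded_finite)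
  then have iV: "integrable lborel (indicator V :: 'a \<Rightarrow> real)" by simp
  obtain f :: "nat \<Rightarrow> 'a \<Rightarrow> real" where f: "\<And>k. C1 (f k)" "\<And>k. compact (spt (f k))" "\<And>k. spt (f k) \<subseteq> box l u"
      "\<And>k x. 0 \<le> f k x" "\<And>k x. f k x \<le> 1" "\<And>x. (\<lambda>k. f k x) \<longlonglongrightarrow> indicator (box l u) x"
    by (rule indicator_open_limit_C1[OF open_box]) (rule that, assumption+)
  have f_le: "f k x \<le> indicator (box l u) x" for k x
    using subsetD[OF f(3)[of k], of x] f(5)[of k x] notin_spt[of x "f k"] by (cases "x \<in> spt (f k)") simp_all
  have [measurable]: "f k \<in> borel_measurable borel" for k by (rule C1_measurable[OF f(1)])
  have "(\<lambda>k. LINT x|lborel. f k x) \<longlonglongrightarrow> (LINT x|lborel. indicator (box l u) x)"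
  proof (rule integral_dominated_convergence[where w="indicator (box l u)"])
    show "AE x in lborel. norm (f k x) \<le> indicator (box l u) x" for k
      using f_le f(4) by auto
    show "integrable lborel (indicator (box l u) :: 'a \<Rightarrow> real)"
      using emeasure_bounded_finite[OF bounded_box, of l u] by simp
  qed (use f(6) in auto)
  moreover have "(\<lambda>k. LINT x|lborel. f k (\<Phi> x) * J t x) \<longlonglongrightarrow> (LINT x|lborel. indicator V x * J t x)"
  proof (rule integral_dominated_convergence[where w="\<lambda>x. 3/2 * indicator V x"])
    have ind: "indicator (box l u) (\<Phi> x) = (indicator V x :: real)" for x by (simp add: V_def indicator_def)
    show "AE x in lborel. norm (f k (\<Phi> x) * J t x) \<le> 3/2 * indicator V x" for k
    proof (rule AE_I2)
      fix x
      have "norm (f k (\<Phi> x) * J t x) = J t x * f k (\<Phi> x)" using f(4)[of k "\<Phi> x"] J_pos(1)[of x] by (simp add: abs_mult)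
      also have "\<dots> \<le> 3/2 * indicator V x"
        using f_le[of k "\<Phi> x"] f(4)[of k "\<Phi> x"] J_pos[of x] unfolding ind by (intro mult_mono) auto
      finally show "norm (f k (\<Phi> x) * J t x) \<le> 3/2 * indicator V x" .
    qed
    show "AE x in lborel. (\<lambda>k. f k (\<Phi> x) * J t x) \<longlonglongrightarrow> indicator V x * J t x"
      using f(6) unfolding ind[symmetric] by (auto intro!: tendsto_intros)
  qed (use iV in auto)
  ultimately have eq: "(LINT x|lborel. indicator V x * J t x) = measure lborel (box l u)"
    using shear_integral_C1[OF f(1,2)] LIMSEQ_unique by (simp add: emeasure_bounded_finite)
  have iJ: "integrable lborel (\<lambda>x. indicator V x * J t x)"
  proof (rule Bochner_Integration.integrable_bound[of _ "\<lambda>x. 3/2 * indicator V x"])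
    show "AE x in lborel. norm (indicator V x * J t x) \<le> norm (3/2 * indicator V x :: real)"
      using J_pos(2) J_nonneg by (simp add: indicator_def)
  qed (use iV in auto)
  have "emeasure (distr (density lborel (\<lambda>x. ennreal (J t x))) borel \<Phi>) (box l u)
      = emeasure (density lborel (\<lambda>x. ennreal (J t x))) V"
    by (subst emeasure_distr) (auto simp: V_def)
  also have "\<dots> = (\<integral>\<^sup>+x. ennreal (indicator V x * J t x) \<partial>lborel)"
    by (subst emeasure_density) (auto intro!: nn_integral_cong simp: indicator_def)
  also have "\<dots> = ennreal (measure lborel (box l u))"
    unfolding eq[symmetric] using J_nonneg
    by (intro nn_integral_eq_integral iJ) (auto simp: indicator_def)
  also have "\<dots> = ennreal (\<Prod>b\<in>Basis. (u - l) \<bullet> b)" using lu by (simp add: measure_lborel_box_eq)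
  finally show "emeasure (distr (density lborel (\<lambda>x. ennreal (J t x))) borel \<Phi>) (box l u) = ennreal (\<Prod>b\<in>Basis. (u - l) \<bullet> b)" .
qed simp

lemma shear_integral:
  fixes f :: "'a \<Rightarrow> real"
  assumes [measurable]: "f \<in> borel_measurable borel"
  shows "(LINT x|lborel. f x) = (LINT x|lborel. J t x * f (\<Phi> x))"
proof -
  have "(LINT x|lborel. f x) = (LINT x|density lborel (\<lambda>x. ennreal (J t x)). f (\<Phi> x))"
    by (subst lborel_eq_distr) (simp add: integral_distr)
  also have "\<dots> = (LINT x|lborel. J t x * f (\<Phi> x))"
    using J_nonneg by (subst integral_density) auto
  finally show ?thesis .
qed

lemma measure_\<Phi>_image:
  assumes "open U" "bounded U"
  shows "measure lborel (\<Phi> ` U) = measure lborel U + t * (LINT x:U|lborel. G x \<bullet> e)"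
proof -
  have [measurable]: "U \<in> sets borel" "\<Phi> ` U \<in> sets borel" using assms open_\<Phi> by auto
  have iU: "integrable lborel (indicator U :: 'a \<Rightarrow> real)"
    using emeasure_bounded_finite[OF assms(2)] by simp
  obtain K where K: "0 \<le> K" "\<And>x. norm (G x) \<le> K"
    by (rule continuous_compact_spt_bounded[OF contG compact_spt_G]) (rule that)
  have [measurable]: "G \<in> borel_measurable borel" by (rule borel_measurable_continuous_onI[OF contG])
  have iG: "integrable lborel (\<lambda>x. indicator U x * (G x \<bullet> e))"
  proof (rule Bochner_Integration.integrable_bound[of _ "\<lambda>x. K * norm e * indicator U x"])
    show "AE x in lborel. norm (indicator U x * (G x \<bullet> e)) \<le> norm (K * norm e * indicator U x)"
    proof (rule AE_I2)
      fix x
      have "\<bar>G x \<bullet> e\<bar> \<le> K * norm e"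
        using K(2)[of x] by (intro order_trans[OF Cauchy_Schwarz_ineq2] mult_right_mono) auto
      then show "norm (indicator U x * (G x \<bullet> e)) \<le> norm (K * norm e * indicator U x)"
        using K(1) by (simp add: indicator_def)
    qed
  qed (use iU in auto)
  have "measure lborel (\<Phi> ` U) = (LINT x|lborel. indicator (\<Phi> ` U) x)" by simp
  also have "\<dots> = (LINT x|lborel. J t x * indicator (\<Phi> ` U) (\<Phi> x))" by (rule shear_integral) simp
  also have "\<dots> = (LINT x|lborel. indicator U x + t * (indicator U x * (G x \<bullet> e)))"
    using inj_\<Phi> by (intro Bochner_Integration.integral_cong) (auto simp: J_def indicator_def inj_image_mem_iff)
  also have "\<dots> = measure lborel U + t * (LINT x|lborel. indicator U x * (G x \<bullet> e))"
    using iU iG by simp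
  finally show ?thesis by (simp add: set_lebesgue_integral_def)
qed

end

subsection \<open>Sets of finite perimeter under shears\<close>

lemma divergence_eq: "(f has_derivative f') (at x) \<Longrightarrow> divergence f x = (\<Sum>b\<in>Basis. f' b \<bullet> b)"
  unfolding divergence_def using frechet_derivative_at by metis

lemma continuous_divergence: "C1 f \<Longrightarrow> continuous_on UNIV (divergence f)"
proof -
  assume "C1 f"
  then obtain f' where f': "\<And>x. (f has_derivative f' x) (at x)" "\<And>h. continuous_on UNIV (\<lambda>x. f' x h)"
    by (rule C1E) (rule that)
  have "divergence f = (\<lambda>x. \<Sum>b\<in>Basis. f' x b \<bullet> b)" using divergence_eq[OF f'(1)] by (rule ext)
  then show ?thesis using f'(2) by (auto intro!: continuous_intros)
qed

lemma Dchi_derivative_measure: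
  "finite_perimeter \<Omega> E \<Longrightarrow> derivative_measure \<Omega> (indicator E) (Dchi \<Omega> E)"
  unfolding Dchi_def by (rule someI_ex[where P="derivative_measure \<Omega> (indicator E)"]) (simp add: finite_perimeter_def)

context shear
begin

text \<open>J times the inverse of the derivative of the shear, applied to \<psi> at the image
  point. The inverse of identity plus rank one has denominator J, which the factor J clears.\<close>

definition pullback :: "('a \<Rightarrow> 'a) \<Rightarrow> 'a \<Rightarrow> 'a" where
  "pullback \<psi> x = J t x *\<^sub>R \<psi> (\<Phi> x) - (t * (G x \<bullet> \<psi> (\<Phi> x))) *\<^sub>R e"

text \<open>The gradient G itself occurs in the pullback. This is why the coefficient of a shear has
  to be C^2 for the pullback to be an admissible test field.\<close>

lemma pullback_C1c_fields:
  assumes "C1 G" "spt \<eta> \<subseteq> \<Omega>" "\<psi> \<in> C1c_fields \<Omega>"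
  shows "pullback \<psi> \<in> C1c_fields \<Omega>"
proof -
  have \<psi>: "C1 \<psi>" "compact (spt \<psi>)" "spt \<psi> \<subseteq> \<Omega>" using assms(3) unfolding C1c_fields_iff by auto
  have s: "spt (pullback \<psi>) \<subseteq> spt \<eta> \<union> spt \<psi>"
  proof (rule spt_subsetI)
    fix x assume "x \<notin> spt \<eta> \<union> spt \<psi>"
    then show "pullback \<psi> x = 0"
      by (simp add: pullback_def \<phi>_notin_spt G_notin_spt notin_spt)
  qed (intro closed_Un closed_spt)
  have "C1 (pullback \<psi>)"
    unfolding pullback_def J_def by (intro C1_intros assms(1) C1_compose[OF C1_\<phi> \<psi>(1)])
  moreover have "compact (spt (pullback \<psi>))"
    by (rule compact_spt_subset[OF _ s]) (intro compact_Un cpt \<psi>(2))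
  ultimately show ?thesis unfolding C1c_fields_iff using s assms(2) \<psi>(3) by blast
qed

(* Piola's identity for shears: pullback is the cofactor transform of psi. *)
lemma divergence_pullback:
  assumes G': "\<And>x. (G has_derivative G' x) (at x)" and sym: "\<And>x h k. G' x h \<bullet> k = G' x k \<bullet> h"
    and \<psi>: "C1 \<psi>"
  shows "divergence (pullback \<psi>) x = J t x * divergence \<psi> (\<Phi> x)"
proof -
  obtain \<psi>' where \<psi>': "\<And>x. (\<psi> has_derivative \<psi>' x) (at x)" by (rule C1E[OF \<psi>]) (rule that)
  define y where "y = \<Phi> x"
  let ?d = "\<lambda>h. h + (t * (G x \<bullet> h)) *\<^sub>R e"
  have lin: "linear (\<psi>' y)" using \<psi>' by (rule has_derivative_linear)
  have d\<psi>: "((\<lambda>x. \<psi> (\<Phi> x)) has_derivative (\<lambda>h. \<psi>' y (?d h))) (at x)"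
    unfolding y_def by (rule has_derivative_compose[OF \<phi>_has_derivative \<psi>'])
  let ?Y' = "\<lambda>h. J t x *\<^sub>R \<psi>' y (?d h) + (t * (G' x h \<bullet> e)) *\<^sub>R \<psi> y
      - (t * (G x \<bullet> \<psi>' y (?d h) + G' x h \<bullet> \<psi> y)) *\<^sub>R e"
  have dJ: "((\<lambda>x. 1 + t * (G x \<bullet> e)) has_derivative (\<lambda>h. t * (G' x h \<bullet> e))) (at x)"
    by (auto intro!: derivative_eq_intros G')
  have dI: "((\<lambda>x. t * (G x \<bullet> \<psi> (\<Phi> x))) has_derivative (\<lambda>h. t * (G x \<bullet> \<psi>' y (?d h) + G' x h \<bullet> \<psi> (\<Phi> x)))) (at x)"
    by (rule has_derivative_mult_right[OF has_derivative_inner[OF G' d\<psi>]])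
  have "(pullback \<psi> has_derivative ?Y') (at x)"
    using has_derivative_diff[OF has_derivative_scaleR[OF dJ d\<psi>] has_derivative_scaleR_left[OF dI, of e]]
    unfolding pullback_def J_def by (simp add: y_def)
  then have "divergence (pullback \<psi>) x = (\<Sum>b\<in>Basis. ?Y' b \<bullet> b)" by (rule divergence_eq)
  also have "\<dots> = (\<Sum>b\<in>Basis. J t x * (\<psi>' y b \<bullet> b) + J t x * t * ((G x \<bullet> b) * (\<psi>' y e \<bullet> b))
      + t * ((G' x b \<bullet> e) * (\<psi> y \<bullet> b))
      - t * ((G x \<bullet> \<psi>' y b) * (e \<bullet> b)) - t * t * (G x \<bullet> \<psi>' y e) * ((G x \<bullet> b) * (e \<bullet> b)) - t * ((G' x b \<bullet> \<psi> y) * (e \<bullet> b)))"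
  proof (rule sum.cong[OF refl])
    fix b :: 'a assume "b \<in> Basis"
    have "\<psi>' y (?d b) = \<psi>' y b + (t * (G x \<bullet> b)) *\<^sub>R \<psi>' y e"
      by (simp add: linear_add[OF lin] linear_cmul[OF lin])
    then show "?Y' b \<bullet> b = J t x * (\<psi>' y b \<bullet> b) + J t x * t * ((G x \<bullet> b) * (\<psi>' y e \<bullet> b))
      + t * ((G' x b \<bullet> e) * (\<psi> y \<bullet> b))
      - t * ((G x \<bullet> \<psi>' y b) * (e \<bullet> b)) - t * t * (G x \<bullet> \<psi>' y e) * ((G x \<bullet> b) * (e \<bullet> b)) - t * ((G' x b \<bullet> \<psi> y) * (e \<bullet> b))"
      by (simp add: inner_diff_left inner_add_left inner_add_right algebra_simps)
  qed
  also have "\<dots> = J t x * (\<Sum>b\<in>Basis. \<psi>' y b \<bullet> b) + J t x * t * (G x \<bullet> \<psi>' y e)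
      + t * (\<Sum>b\<in>Basis. (G' x b \<bullet> e) * (\<psi> y \<bullet> b))
      - t * (\<Sum>b\<in>Basis. (G x \<bullet> \<psi>' y b) * (e \<bullet> b)) - t * t * (G x \<bullet> \<psi>' y e) * (G x \<bullet> e)
      - t * (\<Sum>b\<in>Basis. (G' x b \<bullet> \<psi> y) * (e \<bullet> b))"
    unfolding sum.distrib sum_subtractf sum_distrib_left[symmetric]
    by (simp only: mult.assoc euclidean_inner[of "G x" e, symmetric] euclidean_inner[of "G x" "\<psi>' y e", symmetric]
        mult.commute[of "e \<bullet> _"])
  \<comment> \<open>By symmetry of the Hessian both sums with second derivatives of \<eta> have this
    value, and they enter with opposite signs. The remaining terms with \<open>\<psi>' y e\<close>
    cancel because J = 1 + t (G \<bullet> e).\<close>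
  also have "(\<Sum>b\<in>Basis. (G' x b \<bullet> e) * (\<psi> y \<bullet> b)) = G' x e \<bullet> \<psi> y"
    by (subst euclidean_inner[of "G' x e"], intro sum.cong refl) (simp only: sym[of x _ e])
  also have "(\<Sum>b\<in>Basis. (G' x b \<bullet> \<psi> y) * (e \<bullet> b)) = G' x e \<bullet> \<psi> y"
  proof -
    have "(\<Sum>b\<in>Basis. (G' x b \<bullet> \<psi> y) * (e \<bullet> b)) = (\<Sum>b\<in>Basis. (G' x (\<psi> y) \<bullet> b) * (e \<bullet> b))"
      by (intro sum.cong refl) (simp only: sym[of x _ "\<psi> y"])
    also have "\<dots> = G' x (\<psi> y) \<bullet> e" by (rule euclidean_inner[symmetric])
    finally show ?thesis by (simp only: sym[of x _ e])
  qed
  also have "(\<Sum>b\<in>Basis. (G x \<bullet> \<psi>' y b) * (e \<bullet> b)) = G x \<bullet> \<psi>' y e"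
  proof -
    have "\<psi>' y e = \<psi>' y (\<Sum>b\<in>Basis. (e \<bullet> b) *\<^sub>R b)" by (simp add: euclidean_representation)
    also have "\<dots> = (\<Sum>b\<in>Basis. (e \<bullet> b) *\<^sub>R \<psi>' y b)"
      by (simp add: linear_sum[OF lin] linear_cmul[OF lin])
    finally show ?thesis by (simp add: inner_sum_right mult.commute)
  qed
  finally show ?thesis
    unfolding divergence_eq[OF \<psi>'] y_def[symmetric] J_def by (simp add: algebra_simps)
qed

text \<open>Substituting the shear and applying Piola's identity turns the divergence integral over
  the image into one over E with test field \<open>pullback \<psi>\<close>. There the derivative
  measure of E is available, and moving the cofactor matrix to the other side of the inner product
  gives the density w = J \<nu> - t (e \<bullet> \<nu>) G, which is then pushed forward by the
  shear.\<close>

lemma shear_derivative_measure: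
  fixes \<Omega> E :: "'a set"
  assumes \<Omega>: "open \<Omega>" "spt \<eta> \<subseteq> \<Omega>"
    and C1G: "C1 G" and G': "\<And>x. (G has_derivative G' x) (at x)" and sym: "\<And>x h k. G' x h \<bullet> k = G' x k \<bullet> h"
    and E: "open E" and D: "derivative_measure \<Omega> (indicator E) D"
  shows "\<exists>D'. derivative_measure \<Omega> (indicator (\<Phi> ` E)) D' \<and>
    (\<forall>B\<in>sets (restrict_space borel \<Omega>). measure (total_variation \<Omega> D') B \<le>
      (LINT x|total_variation \<Omega> D. indicator B (\<Phi> x) *
        norm (J t x *\<^sub>R rn_density \<Omega> D x - (t * (e \<bullet> rn_density \<Omega> D x)) *\<^sub>R G x)))"
proof -
  interpret vec_measure \<Omega> D using D by unfold_locales (simp add: derivative_measure_def)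
  let ?w = "\<lambda>x. J t x *\<^sub>R \<nu> x - (t * (e \<bullet> \<nu> x)) *\<^sub>R G x"
  obtain K where K: "0 \<le> K" "\<And>x. norm (G x) \<le> K"
    by (rule continuous_compact_spt_bounded[OF contG compact_spt_G]) (rule that)
  have \<Phi>\<Omega>: "\<Phi> ` \<Omega> = \<Omega>"
    using \<Omega>(2) notin_spt by (intro \<Phi>_image_eq) blast
  have \<Phi>\<Omega>_iff: "\<Phi> x \<in> \<Omega> \<longleftrightarrow> x \<in> \<Omega>" for x
    using \<Phi>\<Omega> inj_\<Phi> by (metis inj_image_mem_iff)
  have mT: "\<Phi> \<in> TV \<rightarrow>\<^sub>M restrict_space borel \<Omega>"
  proof -
    have "\<Phi> \<in> restrict_space borel \<Omega> \<rightarrow>\<^sub>M restrict_space borel \<Omega>"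
      by (rule measurable_restrict_space3) (use \<Phi>\<Omega>_iff in auto)
    then show ?thesis by (simp cong: measurable_cong_sets)
  qed
  have [measurable]: "G \<in> borel_measurable TV" "J t \<in> borel_measurable TV"
    using measurable_restrict_space1[OF borel_measurable_continuous_onI[OF contG], of \<Omega>]
      measurable_restrict_space1[OF J_measurable, of \<Omega>]
    by (simp_all cong: measurable_cong_sets)
  have w: "integrable TV ?w"
  proof (rule Bochner_Integration.integrable_bound[of _ "\<lambda>x. (3/2 + \<bar>t\<bar> * norm e * K) * norm (\<nu> x)"])
    show "AE x in TV. norm (?w x) \<le> norm ((3/2 + \<bar>t\<bar> * norm e * K) * norm (\<nu> x))"
    proof (rule AE_I2)
      fix x
      have "norm (?w x) \<le> \<bar>J t x\<bar> * norm (\<nu> x) + (\<bar>t\<bar> * \<bar>e \<bullet> \<nu> x\<bar>) * norm (G x)"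
        by (rule order_trans[OF norm_triangle_ineq4]) (simp add: abs_mult)
      also have "\<dots> \<le> 3/2 * norm (\<nu> x) + (\<bar>t\<bar> * (norm e * norm (\<nu> x))) * K"
        using J_pos(2)[of x] J_nonneg[of x] K(2)[of x]
        by (intro add_mono mult_mono Cauchy_Schwarz_ineq2) auto
      finally show "norm (?w x) \<le> norm ((3/2 + \<bar>t\<bar> * norm e * K) * norm (\<nu> x))"
        using K(1) by (simp add: algebra_simps)
    qed
  qed (use integrable_rn_density in auto)
  define D' where "D' = (\<lambda>B. LINT x|TV. indicator B (\<Phi> x) *\<^sub>R ?w x)"
  note tr = transported_vector_measure[OF w mT, folded D'_def]
  have "(LINT x:\<Omega>|lebesgue. indicator (\<Phi> ` E) x * divergence \<psi> x) = - vm_integral \<Omega> D' \<psi>"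
    if \<psi>: "\<psi> \<in> C1c_fields \<Omega>" for \<psi>
  proof -
    have \<psi>': "C1 \<psi>" "compact (spt \<psi>)" using \<psi> unfolding C1c_fields_iff by auto
    have [measurable]: "divergence \<psi> \<in> borel_measurable borel"
      by (rule borel_measurable_continuous_onI[OF continuous_divergence[OF \<psi>'(1)]])
    have Y: "pullback \<psi> \<in> C1c_fields \<Omega>" by (rule pullback_C1c_fields) fact+
    have [measurable]: "divergence (pullback \<psi>) \<in> borel_measurable borel"
      using Y unfolding C1c_fields_iff by (intro borel_measurable_continuous_onI continuous_divergence) auto
    have [measurable]: "E \<in> sets borel" "\<Phi> ` E \<in> sets borel" "\<Omega> \<in> sets borel"
      using E \<Omega> open_\<Phi> by auto
    have "(LINT x:\<Omega>|lebesgue. indicator (\<Phi> ` E) x * divergence \<psi> x)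
        = (LINT x|lborel. indicator \<Omega> x * (indicator (\<Phi> ` E) x * divergence \<psi> x))"
      unfolding set_lebesgue_integral_def by (subst integral_completion) auto
    also have "\<dots> = (LINT x|lborel. J t x * (indicator \<Omega> (\<Phi> x) * (indicator (\<Phi> ` E) (\<Phi> x) * divergence \<psi> (\<Phi> x))))"
      by (rule shear_integral) auto
    also have "\<dots> = (LINT x|lborel. indicator \<Omega> x * (indicator E x * divergence (pullback \<psi>) x))"
      unfolding divergence_pullback[OF G' sym \<psi>'(1)] using inj_\<Phi>
      by (intro Bochner_Integration.integral_cong) (auto simp: indicator_def \<Phi>\<Omega>_iff inj_image_mem_iff)
    also have "\<dots> = (LINT x:\<Omega>|lebesgue. indicator E x * divergence (pullback \<psi>) x)"
      unfolding set_lebesgue_integral_def by (subst integral_completion) auto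
    also have "\<dots> = - vm_integral \<Omega> D (pullback \<psi>)"
      using D Y unfolding derivative_measure_def by blast
    also have "vm_integral \<Omega> D (pullback \<psi>) = (LINT x|TV. \<psi> (\<Phi> x) \<bullet> ?w x)"
      unfolding vm_integral_def pullback_def
      by (intro Bochner_Integration.integral_cong)
        (auto simp: inner_diff_left inner_diff_right inner_commute algebra_simps)
    also have "\<dots> = vm_integral \<Omega> D' \<psi>"
    proof -
      obtain L where L: "\<And>x. norm (\<psi> x) \<le> L"
        by (rule continuous_compact_spt_bounded[OF C1_continuous[OF \<psi>'(1)] \<psi>'(2)]) (rule that)
      show ?thesis
        by (rule tr(3)[symmetric, OF _ L]) (rule measurable_restrict_space1, rule C1_measurable[OF \<psi>'(1)])
    qed
    finally show ?thesis .
  qed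
  then have "derivative_measure \<Omega> (indicator (\<Phi> ` E)) D'"
    unfolding derivative_measure_def using tr(1) by blast
  then show ?thesis using tr(2) by blast
qed

text \<open>The squared norm of the density is expanded first: its linear part is 2 t times the
  tension, its quadratic part at most (K^2 + 2 K^2 + K^2) t^2. The inequality 2 z \<le> 1 + z^2 then
  passes to the norm without expanding a square root and halves the constant 4 to 2.\<close>

lemma norm_transported_density_le:
  assumes "norm e = 1" "norm n \<le> 1" "norm (G x) \<le> K"
  shows "norm (J t x *\<^sub>R n - (t * (e \<bullet> n)) *\<^sub>R G x) \<le> 1 + t * (G x \<bullet> e - (e \<bullet> n) * (G x \<bullet> n)) + 2 * t\<^sup>2 * K\<^sup>2"
proof -
  let ?w = "J t x *\<^sub>R n - (t * (e \<bullet> n)) *\<^sub>R G x"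
  define a c where "a = G x \<bullet> e" and "c = (e \<bullet> n) * (G x \<bullet> n)"
  have K: "0 \<le> K" using assms(3) norm_ge_zero order_trans by blast
  have en: "\<bar>e \<bullet> n\<bar> \<le> 1"
    using Cauchy_Schwarz_ineq2[of e n] assms(1,2) by simp
  have a: "\<bar>a\<bar> \<le> K" unfolding a_def using Cauchy_Schwarz_ineq2[of "G x" e] assms(1,3) by simp
  have Gn: "\<bar>G x \<bullet> n\<bar> \<le> K"
    using Cauchy_Schwarz_ineq2[of "G x" n] mult_mono[OF assms(3,2)] K by simp
  have c: "\<bar>c\<bar> \<le> K"
    unfolding c_def abs_mult using mult_mono[OF en Gn] by simp
  have "(norm ?w)\<^sup>2 = (J t x)\<^sup>2 * (norm n)\<^sup>2 - 2 * J t x * t * c + t\<^sup>2 * (e \<bullet> n)\<^sup>2 * (norm (G x))\<^sup>2"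
    unfolding power2_norm_eq_inner c_def
    by (simp add: inner_diff_left inner_diff_right inner_commute power2_eq_square algebra_simps)
  also have "\<dots> \<le> (J t x)\<^sup>2 * 1 - 2 * J t x * t * c + t\<^sup>2 * 1 * K\<^sup>2"
  proof -
    have "(J t x)\<^sup>2 * (norm n)\<^sup>2 \<le> (J t x)\<^sup>2 * 1"
      using assms(2) by (intro mult_left_mono) (auto simp: power_le_one)
    moreover have "(e \<bullet> n)\<^sup>2 * (norm (G x))\<^sup>2 \<le> 1 * K\<^sup>2"
    proof (rule mult_mono)
      show "(e \<bullet> n)\<^sup>2 \<le> 1" using en by (simp add: abs_square_le_1)
      show "(norm (G x))\<^sup>2 \<le> K\<^sup>2" using assms(3) by (intro power_mono) auto
    qed auto
    then have "t\<^sup>2 * ((e \<bullet> n)\<^sup>2 * (norm (G x))\<^sup>2) \<le> t\<^sup>2 * (1 * K\<^sup>2)"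
      by (intro mult_left_mono) auto
    ultimately show ?thesis by (simp add: mult.assoc)
  qed
  also have "\<dots> = 1 + 2 * t * (a - c) + t\<^sup>2 * (a\<^sup>2 + 2 * (- a * c) + K\<^sup>2)"
    unfolding J_def a_def by (simp add: power2_eq_square algebra_simps)
  also have "\<dots> \<le> 1 + 2 * t * (a - c) + t\<^sup>2 * (K\<^sup>2 + 2 * (K * K) + K\<^sup>2)"
  proof -
    have "a\<^sup>2 \<le> K\<^sup>2" using a by (metis abs_ge_zero power2_abs power_mono)
    moreover have "\<bar>a * c\<bar> \<le> K * K" unfolding abs_mult using a c K by (intro mult_mono) auto
    ultimately have "t\<^sup>2 * (a\<^sup>2 + 2 * (- a * c) + K\<^sup>2) \<le> t\<^sup>2 * (K\<^sup>2 + 2 * (K * K) + K\<^sup>2)"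
      by (intro mult_left_mono) (auto simp: abs_le_iff)
    then show ?thesis by linarith
  qed
  finally have "(norm ?w)\<^sup>2 \<le> 1 + 2 * t * (a - c) + 4 * t\<^sup>2 * K\<^sup>2"
    by (simp add: power2_eq_square)
  moreover have "2 * norm ?w \<le> 1 + (norm ?w)\<^sup>2"
    using sum_squares_bound[of 1 "norm ?w"] by simp
  ultimately show ?thesis unfolding a_def[symmetric] c_def[symmetric] by (simp add: algebra_simps)
qed

end

subsection \<open>First variation under volume constraints\<close>

text \<open>A functional that vanishes on the common kernel of finitely many functionals is a
  combination of them. V carries no vector space structure: it is enough that some element of V
  realizes the values of each combination. In the induction f is first represented on the kernel of
  the last functional, and one element outside that kernel determines the last coefficient.\<close>

lemma linear_functional_multipliers:
  fixes f :: "'v \<Rightarrow> real" and g :: "nat \<Rightarrow> 'v \<Rightarrow> real" and n :: nat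
  assumes "\<And>u v c. u \<in> V \<Longrightarrow> v \<in> V \<Longrightarrow>
      \<exists>w\<in>V. f w = f u + c * f v \<and> (\<forall>i<n. g i w = g i u + c * g i v)"
    and "\<And>u. u \<in> V \<Longrightarrow> (\<And>i. i < n \<Longrightarrow> g i u = 0) \<Longrightarrow> f u = 0"
  shows "\<exists>c. \<forall>u\<in>V. f u = (\<Sum>i<n. c i * g i u)"
  using assms
proof (induction n arbitrary: V)
  case 0
  then show ?case by simp
next
  case (Suc n)
  let ?W = "{u \<in> V. g n u = 0}"
  have "\<exists>c. \<forall>u\<in>?W. f u = (\<Sum>i<n. c i * g i u)"
  proof (rule Suc.IH)
    fix u v c assume "u \<in> ?W" "v \<in> ?W"
    with Suc.prems(1)[of u v c] obtain w where
      "w \<in> V" "f w = f u + c * f v" "\<forall>i<Suc n. g i w = g i u + c * g i v" by auto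
    with \<open>u \<in> ?W\<close> \<open>v \<in> ?W\<close> show "\<exists>w\<in>?W. f w = f u + c * f v \<and> (\<forall>i<n. g i w = g i u + c * g i v)"
      by (intro bexI[of _ w]) auto
  next
    fix u assume "u \<in> ?W" "\<And>i. i < n \<Longrightarrow> g i u = 0"
    then show "f u = 0" using Suc.prems(2)[of u] by (auto simp: less_Suc_eq)
  qed
  then obtain c where c: "\<And>u. u \<in> V \<Longrightarrow> g n u = 0 \<Longrightarrow> f u = (\<Sum>i<n. c i * g i u)" by auto
  show ?case
  proof (cases "\<forall>u\<in>V. g n u = 0")
    case True
    then show ?thesis using c by (intro exI[of _ c]) auto
  next
    case False
    then obtain v where v: "v \<in> V" "g n v \<noteq> 0" by auto
    define d where "d = (f v - (\<Sum>i<n. c i * g i v)) / g n v"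
    have "f u = (\<Sum>i<Suc n. (c(n := d)) i * g i u)" if u: "u \<in> V" for u
    proof -
      define s where "s = - (g n u / g n v)"
      obtain w where w: "w \<in> V" "f w = f u + s * f v" "\<forall>i<Suc n. g i w = g i u + s * g i v"
        using Suc.prems(1)[OF u v(1), of s] by auto
      have "g n w = 0" using w(3) v(2) by (simp add: s_def)
      then have "f u + s * f v = (\<Sum>i<n. c i * (g i u + s * g i v))"
        using c[OF w(1)] w(2,3) by simp
      also have "\<dots> = (\<Sum>i<n. c i * g i u) + s * (\<Sum>i<n. c i * g i v)"
        by (simp add: algebra_simps sum.distrib sum_distrib_left)
      finally have "f u = (\<Sum>i<n. c i * g i u) - s * (f v - (\<Sum>i<n. c i * g i v))"
        by (simp add: algebra_simps)
      also have "- s * (f v - (\<Sum>i<n. c i * g i v)) = d * g n u"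
        using v(2) by (simp add: s_def d_def)
      then have "(\<Sum>i<n. c i * g i u) - s * (f v - (\<Sum>i<n. c i * g i v)) = (\<Sum>i<n. c i * g i u) + d * g n u"
        by linarith
      also have "\<dots> = (\<Sum>i<Suc n. (c(n := d)) i * g i u)" by simp
      finally show ?thesis .
    qed
    then show ?thesis by blast
  qed
qed

text \<open>Tested with a small t of sign opposite to \<delta>, whose size makes the quadratic term
  the smaller one; \<open>C + 1\<close> keeps that size defined for C = 0.\<close>

lemma nonneg_quadratic_linear_zero:
  fixes \<delta> C t0 :: real
  assumes "0 < t0" "0 \<le> C" and nonneg: "\<And>t. \<bar>t\<bar> \<le> t0 \<Longrightarrow> 0 \<le> t * \<delta> + C * t\<^sup>2"
  shows "\<delta> = 0"
proof (rule ccontr)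
  assume "\<delta> \<noteq> 0"
  define s where "s = min t0 (\<bar>\<delta>\<bar> / (2 * (C + 1)))"
  have s: "0 < s" "s \<le> t0" "s \<le> \<bar>\<delta>\<bar> / (2 * (C + 1))" using assms \<open>\<delta> \<noteq> 0\<close> by (auto simp: s_def)
  have "0 \<le> (- s * sgn \<delta>) * \<delta> + C * (- s * sgn \<delta>)\<^sup>2"
    using s \<open>\<delta> \<noteq> 0\<close> by (intro nonneg) (simp add: abs_mult)
  also have "\<dots> = s * (C * s - \<bar>\<delta>\<bar>)"
    using \<open>\<delta> \<noteq> 0\<close> by (simp add: power_mult_distrib power2_eq_square algebra_simps abs_sgn sgn_if)
  finally have "\<bar>\<delta>\<bar> \<le> C * s" using s(1) by (simp add: zero_le_mult_iff)
  also have "\<dots> \<le> C * (\<bar>\<delta>\<bar> / (2 * (C + 1)))" using s(3) assms(2) by (rule mult_left_mono)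
  also have "\<dots> = \<bar>\<delta>\<bar> * (C / (2 * (C + 1)))" by simp
  also have "\<dots> < \<bar>\<delta>\<bar> * 1"
    using \<open>\<delta> \<noteq> 0\<close> assms(2) by (intro mult_strict_left_mono) (auto simp: divide_simps)
  finally show False by simp
qed

text \<open>A C^2 function paired with its gradient. Symmetry of the Hessian is recorded in the
  definition; it is visible in the formula for radial fields and passes to combinations.\<close>

definition test_field :: "'a::euclidean_space set \<Rightarrow> ('a \<Rightarrow> real) \<times> ('a \<Rightarrow> 'a) \<Rightarrow> bool" where
  "test_field \<Omega> p \<longleftrightarrow> (\<forall>x. (fst p has_derivative (\<lambda>h. snd p x \<bullet> h)) (at x)) \<and>
     compact (spt (fst p)) \<and> spt (fst p) \<subseteq> \<Omega> \<and> C1 (snd p) \<and>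
     (\<exists>G'. (\<forall>x. (snd p has_derivative G' x) (at x)) \<and> (\<forall>x h k. G' x h \<bullet> k = G' x k \<bullet> h))"

lemma test_field_combination:
  assumes p: "test_field \<Omega> p" and q: "test_field \<Omega> q"
  shows "test_field \<Omega> (\<lambda>x. fst p x + c * fst q x, \<lambda>x. snd p x + c *\<^sub>R snd q x)"
proof -
  obtain P where P: "\<And>x. (snd p has_derivative P x) (at x)" "\<And>x h k. P x h \<bullet> k = P x k \<bullet> h"
    using p unfolding test_field_def by auto
  obtain Q where Q: "\<And>x. (snd q has_derivative Q x) (at x)" "\<And>x h k. Q x h \<bullet> k = Q x k \<bullet> h"
    using q unfolding test_field_def by auto
  have s: "spt (\<lambda>x. fst p x + c * fst q x) \<subseteq> spt (fst p) \<union> spt (fst q)"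
    by (rule spt_subsetI) (auto simp: closed_spt notin_spt)
  have "compact (spt (\<lambda>x. fst p x + c * fst q x))"
    using p q by (intro compact_spt_subset[OF _ s] compact_Un) (auto simp: test_field_def)
  moreover have "spt (\<lambda>x. fst p x + c * fst q x) \<subseteq> \<Omega>"
    using s p q by (auto simp: test_field_def)
  moreover have "((\<lambda>x. fst p x + c * fst q x) has_derivative (\<lambda>h. (snd p x + c *\<^sub>R snd q x) \<bullet> h)) (at x)" for x
    using p q unfolding test_field_def inner_add_left inner_scaleR_left
    by (intro has_derivative_add has_derivative_mult_right) auto
  moreover have "C1 (\<lambda>x. snd p x + c *\<^sub>R snd q x)"
    using p q unfolding test_field_def by (intro C1_add C1_scaleR C1_const) auto
  moreover have "((\<lambda>x. snd p x + c *\<^sub>R snd q x) has_derivative (\<lambda>h. P x h + c *\<^sub>R Q x h)) (at x)" for x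
    by (intro has_derivative_add has_derivative_scaleR_right P Q)
  moreover have "(P x h + c *\<^sub>R Q x h) \<bullet> k = (P x k + c *\<^sub>R Q x k) \<bullet> h" for x h k
    using P(2)[of x h k] Q(2)[of x h k] by (simp add: inner_add_left)
  ultimately show ?thesis unfolding test_field_def fst_conv snd_conv
    by (intro conjI allI exI[of _ "\<lambda>x h. P x h + c *\<^sub>R Q x h"]) auto
qed

section \<open>The minimizing triple, its sheared competitors and the multipliers\<close>

locale V_minimizer =
  fixes E :: "nat \<Rightarrow> 'a::euclidean_space set" and v \<alpha> :: "nat \<Rightarrow> real" and R :: real
  assumes \<alpha>_pos: "\<And>j. j \<le> 2 \<Longrightarrow> 0 < \<alpha> j"
    and R_pos: "0 < R"
    and V_perm: "V_permissible (ball 0 R) v E"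
    and minimal: "\<And>A. A \<subset>\<subset> ball 0 R \<Longrightarrow> Psi_V \<alpha> (ball 0 R) v E A = 0"
begin

abbreviation "\<Omega> \<equiv> ball (0::'a) R"
abbreviation "DE j \<equiv> Dchi \<Omega> (E j)"
abbreviation "var j \<equiv> total_variation \<Omega> (DE j)"
abbreviation "nrm j \<equiv> rn_density \<Omega> (DE j)"

text \<open>For a unit normal this is the tangential divergence of the field \<eta> e, where G is
  the gradient of \<eta>.\<close>

abbreviation "tension e G j x \<equiv> G x \<bullet> e - (e \<bullet> nrm j x) * (G x \<bullet> nrm j x)"

text \<open>The sum over the coordinate directions e of the tensions of
  \<open>h (x \<bullet> x) * (x \<bullet> e)\<close>, that is, of the components of the radial field
  \<open>h (x \<bullet> x) *\<^sub>R x\<close>. The square of the density is kept instead of 1; as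
  it is at most 1 almost everywhere, the first coefficient is at least n - 1.\<close>

abbreviation "radial_tension h h' j x \<equiv>
  (real DIM('a) - nrm j x \<bullet> nrm j x) * h (x \<bullet> x) + 2 * h' (x \<bullet> x) * (x \<bullet> x - (x \<bullet> nrm j x)\<^sup>2)"

lemma open_E: "j \<le> 2 \<Longrightarrow> open (E j)"
  using V_perm unfolding V_permissible_def permissible_def by blast

lemma DE: "j \<le> 2 \<Longrightarrow> derivative_measure \<Omega> (indicator (E j)) (DE j)"
  using V_perm unfolding V_permissible_def permissible_def by (blast intro: Dchi_derivative_measure)

lemma vec_measure_DE: "j \<le> 2 \<Longrightarrow> vec_measure \<Omega> (DE j)"
  using DE unfolding vec_measure_def derivative_measure_def by blast

lemma E_subset: assumes "j \<le> 2" shows "E j \<subseteq> \<Omega>"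
proof -
  have "E j \<subseteq> closure \<Omega>"
    using V_perm closure_subset[of "E j"] assms unfolding V_permissible_def permissible_def by blast
  then have "E j \<subseteq> interior (cball 0 R)" using open_E[OF assms] R_pos by (intro interior_maximal) auto
  then show ?thesis by (simp add: interior_cball)
qed

definition first_variation :: "'a \<Rightarrow> ('a \<Rightarrow> 'a) \<Rightarrow> real" where
  "first_variation e G = (\<Sum>j\<le>2. \<alpha> j * (LINT x|var j. tension e G j x))"

lemma bounded_field_integrable:
  assumes j: "j \<le> 2" and G: "continuous_on UNIV G" "\<And>x. norm (G x) \<le> K" and e: "norm e = 1"
  shows "integrable (var j) (\<lambda>x. tension e G j x)"
    "integrable (var j) (\<lambda>x. G x \<bullet> e)"
proof -
  interpret vec_measure \<Omega> "DE j" by (rule vec_measure_DE[OF j])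
  have [measurable]: "G \<in> borel_measurable TV"
    using measurable_restrict_space1[OF borel_measurable_continuous_onI[OF G(1)], of \<Omega>]
    by (simp cong: measurable_cong_sets)
  have K: "0 \<le> K" using G(2)[of 0] norm_ge_zero order_trans by blast
  have Ge: "\<bar>G x \<bullet> e\<bar> \<le> K" for x using Cauchy_Schwarz_ineq2[of "G x" e] G(2)[of x] e by simp
  show "integrable TV (\<lambda>x. G x \<bullet> e)"
    by (rule TV.integrable_const_bound[of _ K]) (use Ge in auto)
  have "AE x in TV. norm (G x \<bullet> e - (e \<bullet> \<nu> x) * (G x \<bullet> \<nu> x)) \<le> 2 * K"
    using norm_rn_density_le
  proof eventually_elim
    case (elim x)
    have "\<bar>e \<bullet> \<nu> x\<bar> \<le> 1" using Cauchy_Schwarz_ineq2[of e "\<nu> x"] e elim by simp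
    moreover have "\<bar>G x \<bullet> \<nu> x\<bar> \<le> K"
      using Cauchy_Schwarz_ineq2[of "G x" "\<nu> x"] mult_mono[OF G(2)[of x] elim K] by simp
    ultimately have "\<bar>(e \<bullet> \<nu> x) * (G x \<bullet> \<nu> x)\<bar> \<le> 1 * K" unfolding abs_mult using K by (intro mult_mono) auto
    then show ?case using Ge[of x] by (simp add: abs_le_iff)
  qed
  then show "integrable TV (\<lambda>x. G x \<bullet> e - (e \<bullet> \<nu> x) * (G x \<bullet> \<nu> x))"
    by (rule TV.integrable_const_bound) auto
qed

lemma F_S_nonneg: "0 \<le> F_S \<alpha> \<Omega> E' U"
  unfolding F_S_def
proof (intro sum_nonneg mult_nonneg_nonneg measure_nonneg)
  show "0 \<le> \<alpha> j" if "j \<in> {..2}" for j using \<alpha>_pos[of j] that by simp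
qed

text \<open>The images of the three sets form a V-permissible triple that differs from E only inside
  the support of \<eta>, so minimality makes the energy change in U nonnegative. The bound for the
  transported density expands that change; the coefficient \<open>2 * K\<^sup>2\<close> of the
  quadratic term comes from \<open>norm_transported_density_le\<close>.\<close>

lemma sheared_competitor:
  assumes "shear \<eta> G e t" and C1G: "C1 G" and G': "\<And>x. (G has_derivative G' x) (at x)"
    and sym: "\<And>x h k. G' x h \<bullet> k = G' x k \<bullet> h"
    and U: "spt \<eta> \<subseteq> U" "U \<subset>\<subset> \<Omega>"
    and e: "norm e = 1" and K: "\<And>x. norm (G x) \<le> K"
    and vol: "\<And>j. j \<le> 2 \<Longrightarrow> (LINT x:E j|lborel. G x \<bullet> e) = 0"
  shows "0 \<le> t * first_variation e G + 2 * K\<^sup>2 * F_S \<alpha> \<Omega> E U * t\<^sup>2"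
proof -
  interpret shear \<eta> G e t by fact
  have U': "open U" "U \<subseteq> \<Omega>" "spt \<eta> \<subseteq> \<Omega>"
    using U closure_subset[of U] unfolding compactly_inside_def by auto
  have "\<forall>j\<in>{..2}. \<exists>D'. derivative_measure \<Omega> (indicator (\<Phi> ` E j)) D' \<and>
     (\<forall>B\<in>sets (restrict_space borel \<Omega>). measure (total_variation \<Omega> D') B \<le>
      (LINT x|var j. indicator B (\<Phi> x) * norm (J t x *\<^sub>R nrm j x - (t * (e \<bullet> nrm j x)) *\<^sub>R G x)))"
    by (intro ballI shear_derivative_measure[OF open_ball U'(3) C1G G' sym open_E DE]) auto
  from bchoice[OF this] obtain D' where
    D': "\<And>j. j \<le> 2 \<Longrightarrow> derivative_measure \<Omega> (indicator (\<Phi> ` E j)) (D' j)"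
    "\<And>j B. j \<le> 2 \<Longrightarrow> B \<in> sets (restrict_space borel \<Omega>) \<Longrightarrow> measure (total_variation \<Omega> (D' j)) B \<le>
      (LINT x|var j. indicator B (\<Phi> x) * norm (J t x *\<^sub>R nrm j x - (t * (e \<bullet> nrm j x)) *\<^sub>R G x))"
    by auto
  let ?E = "\<lambda>j. \<Phi> ` E j"
  have supp: "{x. \<eta> x \<noteq> 0} \<subseteq> spt \<eta>" using notin_spt by blast
  have fp: "finite_perimeter \<Omega> (?E j)" if "j \<le> 2" for j
    unfolding finite_perimeter_def
  proof
    show "?E j \<inter> \<Omega> \<in> sets lebesgue" using open_\<Phi>[OF open_E[OF that]] by (auto intro: lmeasurable_open open_Int)
  qed (use D'(1)[OF that] in blast)
  have bE: "bounded (E j)" if "j \<le> 2" for j using E_subset[OF that] bounded_ball bounded_subset by blast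
  have "V_permissible \<Omega> v ?E"
    unfolding V_permissible_def permissible_def
  proof (intro conjI allI impI)
    show "disjoint_family_on ?E {..2}"
      using V_perm inj_\<Phi> unfolding V_permissible_def permissible_def disjoint_family_on_def
      by (metis image_Int image_empty)
    have "(\<Union>j\<le>2. closure (?E j)) = \<Phi> ` (\<Union>j\<le>2. closure (E j))" by (auto simp: closure_\<Phi>)
    also have "\<dots> = \<Phi> ` closure \<Omega>" using V_perm unfolding V_permissible_def permissible_def by simp
    also have "\<dots> = closure \<Omega>" using supp U'(3) closure_subset[of \<Omega>] by (intro \<Phi>_image_eq) blast
    finally show "(\<Union>j\<le>2. closure (?E j)) = closure \<Omega>" .
    fix j :: nat assume j: "j \<le> 2"
    show "open (?E j)" using open_\<Phi>[OF open_E[OF j]] .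
    show "finite_perimeter \<Omega> (?E j)" using fp[OF j] .
    show "0 \<le> v j" using V_perm j unfolding V_permissible_def by blast
    have b: "?E j \<in> sets borel" "E j \<in> sets borel" using open_\<Phi>[OF open_E[OF j]] open_E[OF j] by auto
    have "?E j \<subseteq> \<Phi> ` \<Omega>" using E_subset[OF j] by blast
    also have "\<dots> = \<Omega>" using supp U'(3) by (intro \<Phi>_image_eq) blast
    finally have "bounded (?E j)" using bounded_ball bounded_subset by blast
    then have "emeasure lborel (?E j) = ennreal (measure lborel (?E j))"
      using emeasure_bounded_finite[of "?E j"] by (intro emeasure_eq_ennreal_measure) auto
    also have "measure lborel (?E j) = measure lborel (E j)"
      using measure_\<Phi>_image[OF open_E[OF j] bE[OF j]] vol[OF j] by simp
    also have "ennreal (measure lborel (E j)) = emeasure lborel (E j)"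
      using emeasure_bounded_finite[OF bE[OF j]] by (intro emeasure_eq_ennreal_measure[symmetric]) auto
    also have "\<dots> = ennreal (v j)"
    proof -
      have "emeasure lebesgue (E j) = ennreal (v j)" using V_perm j unfolding V_permissible_def by blast
      then show ?thesis using b by simp
    qed
    finally show "emeasure lebesgue (?E j) = ennreal (v j)" using b by simp
  qed
  moreover have "spt (\<lambda>x. indicator (E j) x - indicator (?E j) x :: real) \<subseteq> U" for j
  proof -
    have "spt (\<lambda>x. indicator (E j) x - indicator (?E j) x :: real) \<subseteq> spt \<eta>"
    proof (rule spt_subsetI[OF closed_spt])
      fix x assume "x \<notin> spt \<eta>"
      then have "\<Phi> x = x" by (rule \<phi>_notin_spt)
      then have "x \<in> ?E j \<longleftrightarrow> x \<in> E j" using inj_\<Phi> by (metis inj_image_mem_iff)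
      then show "indicator (E j) x - indicator (?E j) x = (0::real)" by (simp add: indicator_def)
    qed
    then show ?thesis using U by blast
  qed
  ultimately have mem: "F_S \<alpha> \<Omega> ?E U \<in> {F_S \<alpha> \<Omega> E' U | E'. V_permissible \<Omega> v E' \<and>
            (\<forall>j\<le>2. spt (\<lambda>x. indicator (E j) x - indicator (E' j) x :: real) \<subseteq> U)}" by blast
  have "F_S \<alpha> \<Omega> E U = Upsilon_V \<alpha> \<Omega> v E U" using minimal[OF U(2)] unfolding Psi_V_def by simp
  \<comment> \<open>The infimum of a set of reals lies below its members only if the set is bounded
    below; 0 serves, because \<open>F_S\<close> is nonnegative.\<close>
  also have "\<dots> \<le> F_S \<alpha> \<Omega> ?E U"
    unfolding Upsilon_V_def
  proof (rule cInf_lower[OF mem], rule bdd_belowI[of _ 0])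
    show "0 \<le> z" if "z \<in> {F_S \<alpha> \<Omega> E' U | E'. V_permissible \<Omega> v E' \<and>
            (\<forall>j\<le>2. spt (\<lambda>x. indicator (E j) x - indicator (E' j) x :: real) \<subseteq> U)}" for z
      using that F_S_nonneg by blast
  qed
  also have "F_S \<alpha> \<Omega> ?E U \<le> (\<Sum>j\<le>2. \<alpha> j * (measure (var j) U
      + t * (LINT x|var j. tension e G j x) + 2 * t\<^sup>2 * K\<^sup>2 * measure (var j) U))"
    unfolding F_S_def
  proof (intro sum_mono mult_left_mono)
    fix j :: nat assume "j \<in> {..2}"
    then have j: "j \<le> 2" by simp
    interpret vec_measure \<Omega> "DE j" by (rule vec_measure_DE[OF j])
    let ?w = "\<lambda>x. J t x *\<^sub>R \<nu> x - (t * (e \<bullet> \<nu> x)) *\<^sub>R G x"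
    let ?a = "\<lambda>x. G x \<bullet> e - (e \<bullet> \<nu> x) * (G x \<bullet> \<nu> x)"
    have UB: "U \<in> S" by (rule open_in_restrict_borel[OF open_ball U'(1,2)])
    then have [measurable]: "U \<in> sets TV" by simp
    have ind: "indicator U (\<Phi> x) = (indicator U x :: real)" for x
    proof -
      have "\<Phi> ` U = U" using supp U(1) by (intro \<Phi>_image_eq) blast
      then show ?thesis using inj_\<Phi> by (metis indicator_simps inj_image_mem_iff)
    qed
    have iU: "integrable TV (indicator U :: 'a \<Rightarrow> real)"
      by (rule TV.integrable_const_bound[of _ 1]) (auto simp: indicator_def)
    have ia: "integrable TV ?a" by (rule bounded_field_integrable[OF j contG K e])
    \<comment> \<open>The linear term carries no indicator of U: outside U the gradient G, and with
      it the tension, vanishes. So the integral over the whole domain appears, as in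
      \<open>first_variation\<close>.\<close>
    have ae: "AE x in TV. indicator U x * norm (?w x) \<le> (1 + 2 * t\<^sup>2 * K\<^sup>2) * indicator U x + t * ?a x"
      using norm_rn_density_le
    proof eventually_elim
      case (elim x)
      show ?case
      proof (cases "x \<in> U")
        case True
        then show ?thesis using norm_transported_density_le[OF e elim K] by (simp add: algebra_simps)
      next
        case False
        then have "x \<notin> spt \<eta>" using U by blast
        then show ?thesis using False by (simp add: G_notin_spt)
      qed
    qed
    have "total_variation \<Omega> (Dchi \<Omega> (?E j)) = total_variation \<Omega> (D' j)"
      by (rule total_variation_derivative_unique[OF open_ball Dchi_derivative_measure[OF fp[OF j]] D'(1)[OF j]])
    then have "measure (total_variation \<Omega> (Dchi \<Omega> (?E j))) U \<le> (LINT x|TV. indicator U x * norm (?w x))"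
      using D'(2)[OF j UB] by (simp add: ind)
    also have "\<dots> \<le> (LINT x|TV. (1 + 2 * t\<^sup>2 * K\<^sup>2) * indicator U x + t * ?a x)"
    proof (rule integral_mono_AE'[OF _ ae])
      show "AE x in TV. 0 \<le> (1 + 2 * t\<^sup>2 * K\<^sup>2) * indicator U x + t * ?a x"
        using ae by eventually_elim (rule order_trans[rotated], assumption, simp)
    qed (use iU ia in auto)
    also have "\<dots> = measure TV U + t * (LINT x|TV. ?a x) + 2 * t\<^sup>2 * K\<^sup>2 * measure TV U"
    proof -
      have "(LINT x|TV. (1 + 2 * t\<^sup>2 * K\<^sup>2) * indicator U x + t * ?a x)
          = (1 + 2 * t\<^sup>2 * K\<^sup>2) * (LINT x|TV. indicator U x) + t * (LINT x|TV. ?a x)"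
        by (simp only: Bochner_Integration.integral_add[OF integrable_mult_right[OF iU] integrable_mult_right[OF ia]]
            integral_mult_right_zero)
      also have "(LINT x|TV. indicator U x) = measure TV U" using S_subset[OF UB] by (simp add: Int_absorb2)
      finally show ?thesis by (simp add: algebra_simps)
    qed
    finally show "measure (total_variation \<Omega> (Dchi \<Omega> (?E j))) U \<le>
      measure TV U + t * (LINT x|TV. ?a x) + 2 * t\<^sup>2 * K\<^sup>2 * measure TV U" .
  qed (use \<alpha>_pos in \<open>auto intro: less_imp_le\<close>)
  also have "\<dots> = F_S \<alpha> \<Omega> E U + t * first_variation e G + 2 * K\<^sup>2 * F_S \<alpha> \<Omega> E U * t\<^sup>2"
    unfolding F_S_def first_variation_def by (simp add: algebra_simps sum.distrib sum_distrib_left)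
  finally show ?thesis by simp
qed

text \<open>Shears with t of either sign are competitors, and their energy changes by at most a
  linear term plus O(t^2); hence the linear coefficient vanishes.\<close>

lemma first_variation_zero:
  assumes p: "test_field \<Omega> p" and e: "norm e = 1"
    and vol: "\<And>j. j \<le> 2 \<Longrightarrow> (LINT x:E j|lborel. snd p x \<bullet> e) = 0"
  shows "first_variation e (snd p) = 0"
proof -
  define \<eta> G where "\<eta> = fst p" and "G = snd p"
  have f: "shear_field \<eta> G"
    using p unfolding test_field_def \<eta>_def G_def shear_field_def by (auto intro: C1_continuous)
  interpret shear_field \<eta> G e by (rule f)
  obtain G' where G': "\<And>x. (G has_derivative G' x) (at x)" "\<And>x h k. G' x h \<bullet> k = G' x k \<bullet> h"
    using p unfolding test_field_def G_def by auto
  have C1G: "C1 G" using p unfolding test_field_def G_def by auto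
  obtain K where K: "0 \<le> K" "\<And>x. norm (G x) \<le> K"
    by (rule continuous_compact_spt_bounded[OF contG compact_spt_G]) (rule that)
  \<comment> \<open>Minimality is tested on sets compactly inside the domain. The compact support of
    \<eta> fits into a smaller concentric ball, which serves as U.\<close>
  obtain R' where R': "R' < R" "spt \<eta> \<subseteq> ball 0 R'"
  proof (cases "spt \<eta> = {}")
    case True then show thesis using that[of 0] R_pos by simp
  next
    case False
    obtain x where x: "x \<in> spt \<eta>" "\<And>y. y \<in> spt \<eta> \<Longrightarrow> norm y \<le> norm x"
      using continuous_attains_sup[OF cpt False continuous_on_norm_id] by auto
    have "norm x < R" using p x(1) unfolding test_field_def \<eta>_def by auto
    then obtain R' where "norm x < R'" "R' < R" using dense by blast
    moreover have "spt \<eta> \<subseteq> ball 0 R'"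
    proof
      fix y assume "y \<in> spt \<eta>"
      then have "norm y < R'" using x(2)[of y] \<open>norm x < R'\<close> by linarith
      then show "y \<in> ball 0 R'" by simp
    qed
    ultimately show thesis using that[of R'] by simp
  qed
  have U: "ball (0::'a) R' \<subset>\<subset> \<Omega>"
    unfolding compactly_inside_def using R' closure_mono[OF ball_subset_cball, of "0::'a" R']
    by (auto simp: compact_eq_bounded_closed)
  have "first_variation e G = 0"
  proof (rule nonneg_quadratic_linear_zero)
    \<comment> \<open>This range of t meets the smallness condition of \<open>shear\<close>, since
      |t| K \<le> 1/2.\<close>
    show "0 < 1 / (2 * (K + 1))" using K(1) by simp
    show "0 \<le> 2 * K\<^sup>2 * F_S \<alpha> \<Omega> E (ball 0 R')" using F_S_nonneg by simp
    fix t assume t: "\<bar>t\<bar> \<le> 1 / (2 * (K + 1))"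
    have "shear \<eta> G e t"
    proof (unfold_locales)
      fix x
      have "\<bar>t\<bar> * norm (G x) * norm e \<le> 1 / (2 * (K + 1)) * K * 1"
        using t K e by (intro mult_mono) auto
      also have "\<dots> \<le> 1/2" using K(1) by (simp add: field_simps)
      finally show "\<bar>t\<bar> * norm (G x) * norm e \<le> 1/2" .
    qed
    then show "0 \<le> t * first_variation e G + 2 * K\<^sup>2 * F_S \<alpha> \<Omega> E (ball 0 R') * t\<^sup>2"
      by (rule sheared_competitor[OF _ C1G G' R'(2) U e K(2)]) (use vol in \<open>simp add: G_def\<close>)
  qed
  then show ?thesis by (simp add: G_def)
qed

(* Lagrange multipliers. They may depend on the direction e, which is harmless for the monotonicity
   formula and spares the construction of volume-correcting fields. *)
lemma multipliers:
  assumes e: "norm e = 1"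
  shows "\<exists>c. \<forall>p. test_field \<Omega> p \<longrightarrow>
    first_variation e (snd p) = (\<Sum>j<3. c j * (LINT x:E j|lborel. snd p x \<bullet> e))"
proof -
  have "\<exists>c. \<forall>p\<in>Collect (test_field \<Omega>).
    first_variation e (snd p) = (\<Sum>j<3. c j * (LINT x:E j|lborel. snd p x \<bullet> e))"
  proof (rule linear_functional_multipliers)
    fix p q c assume pq: "p \<in> Collect (test_field \<Omega>)" "q \<in> Collect (test_field \<Omega>)"
    have bd: "\<exists>K. \<forall>x. norm (snd p x) \<le> K" and ct: "continuous_on UNIV (snd p)" if "test_field \<Omega> p" for p
    proof -
      show c: "continuous_on UNIV (snd p)" using that unfolding test_field_def by (auto intro: C1_continuous)
      interpret shear_field "fst p" "snd p" e
        using that c unfolding test_field_def by unfold_locales auto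
      show "\<exists>K. \<forall>x. norm (snd p x) \<le> K"
        by (rule continuous_compact_spt_bounded[OF contG compact_spt_G]) blast
    qed
    obtain K where K: "\<And>x. norm (snd p x) \<le> K" using bd[of p] pq(1) by blast
    obtain L where L: "\<And>x. norm (snd q x) \<le> L" using bd[of q] pq(2) by blast
    have cp: "continuous_on UNIV (snd p)" and cq: "continuous_on UNIV (snd q)" using ct pq by auto
    let ?w = "(\<lambda>x. fst p x + c * fst q x, \<lambda>x. snd p x + c *\<^sub>R snd q x)"
    have "first_variation e (snd ?w) = first_variation e (snd p) + c * first_variation e (snd q)"
    proof -
      have "(LINT x|var j. tension e (snd ?w) j x) =
          (LINT x|var j. tension e (snd p) j x) +
          c * (LINT x|var j. tension e (snd q) j x)" if j: "j \<le> 2" for j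
      proof -
        note ip = bounded_field_integrable(1)[OF j cp K e] and iq = bounded_field_integrable(1)[OF j cq L e]
        have "(LINT x|var j. tension e (snd ?w) j x) =
          (LINT x|var j. (tension e (snd p) j x) +
            c * (tension e (snd q) j x))"
          by (intro Bochner_Integration.integral_cong) (auto simp: inner_add_left algebra_simps)
        also have "\<dots> = (LINT x|var j. tension e (snd p) j x) +
          c * (LINT x|var j. tension e (snd q) j x)"
          by (simp only: Bochner_Integration.integral_add[OF ip integrable_mult_right[OF iq]] integral_mult_right_zero)
        finally show ?thesis .
      qed
      then have "first_variation e (snd ?w) = (\<Sum>j\<le>2. \<alpha> j * ((LINT x|var j. tension e (snd p) j x) +
          c * (LINT x|var j. tension e (snd q) j x)))"
        unfolding first_variation_def by (intro sum.cong) auto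
      then show ?thesis
        unfolding first_variation_def by (simp only: distrib_left sum.distrib sum_distrib_left mult.left_commute)
    qed
    moreover have "(LINT x:E i|lborel. snd ?w x \<bullet> e) =
        (LINT x:E i|lborel. snd p x \<bullet> e) + c * (LINT x:E i|lborel. snd q x \<bullet> e)" if "i < 3" for i
    proof -
      have i: "i \<le> 2" using that by simp
      have int: "set_integrable lborel (E i) (\<lambda>x. G x \<bullet> e)" if "continuous_on UNIV G" for G
      proof -
        have "set_integrable lborel (cball 0 R) (\<lambda>x. G x \<bullet> e)"
          unfolding set_integrable_def
          by (intro borel_integrable_compact continuous_intros) (auto intro: continuous_on_subset that)
        then show ?thesis
          by (rule set_integrable_subset) (use open_E[OF i] E_subset[OF i] in auto)
      qed
      have "(LINT x:E i|lborel. snd ?w x \<bullet> e) = (LINT x:E i|lborel. snd p x \<bullet> e + c * (snd q x \<bullet> e))"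
        by (simp add: inner_add_left)
      also have "\<dots> = (LINT x:E i|lborel. snd p x \<bullet> e) + (LINT x:E i|lborel. c * (snd q x \<bullet> e))"
        by (intro set_integral_add int cp set_integrable_mult_right cq)
      finally show ?thesis by simp
    qed
    moreover have "?w \<in> Collect (test_field \<Omega>)" using test_field_combination[of \<Omega> p q c] pq by simp
    ultimately show "\<exists>w\<in>Collect (test_field \<Omega>). first_variation e (snd w) = first_variation e (snd p) + c * first_variation e (snd q) \<and>
        (\<forall>i<3. (LINT x:E i|lborel. snd w x \<bullet> e) = (LINT x:E i|lborel. snd p x \<bullet> e) + c * (LINT x:E i|lborel. snd q x \<bullet> e))"
      by blast
  next
    fix p assume "p \<in> Collect (test_field \<Omega>)" "\<And>i. i < 3 \<Longrightarrow> (LINT x:E i|lborel. snd p x \<bullet> e) = 0"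
    then show "first_variation e (snd p) = 0" using e by (intro first_variation_zero) auto
  qed
  then show ?thesis by simp
qed

end

subsection \<open>Radial variations\<close>

text \<open>Profiles are functions of the squared radius, so that composition with
  \<open>x \<bullet> x\<close> remains C^2 at the origin.\<close>

definition radial_profile :: "real \<Rightarrow> (real \<Rightarrow> real) \<Rightarrow> (real \<Rightarrow> real) \<Rightarrow> bool" where
  "radial_profile c h h' \<longleftrightarrow> (\<forall>s. (h has_real_derivative h' s) (at s)) \<and>
     (\<exists>h''. (\<forall>s. (h' has_real_derivative h'' s) (at s)) \<and> continuous_on UNIV h'') \<and>
     (\<forall>s\<ge>c. h s = 0) \<and> (\<forall>s. 0 \<le> h s) \<and> (\<forall>s. h' s \<le> 0)"

text \<open>The gradient of \<open>h (x \<bullet> x) * (x \<bullet> e)\<close>, the component along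
  e of the radial field with profile h.\<close>

definition radial_gradient :: "(real \<Rightarrow> real) \<Rightarrow> (real \<Rightarrow> real) \<Rightarrow> 'a::euclidean_space \<Rightarrow> 'a \<Rightarrow> 'a" where
  "radial_gradient h h' e x = h (x \<bullet> x) *\<^sub>R e + (2 * h' (x \<bullet> x) * (x \<bullet> e)) *\<^sub>R x"

lemma radial_test_field:
  fixes e :: "'a::euclidean_space"
  assumes h: "radial_profile c h h'" and c: "0 < c" "c < R\<^sup>2" and R: "0 < R"
  shows "test_field (ball 0 R) (\<lambda>x. h (x \<bullet> x) * (x \<bullet> e), radial_gradient h h' e)"
proof -
  obtain h'' where d: "\<And>s. (h has_real_derivative h' s) (at s)" "\<And>s. (h' has_real_derivative h'' s) (at s)"
    and c'': "continuous_on UNIV h''" using h unfolding radial_profile_def by auto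
  have dq: "((\<lambda>x::'a. x \<bullet> x) has_derivative (\<lambda>v. 2 * (x \<bullet> v))) (at x)" for x
    by (auto intro!: derivative_eq_intros simp: inner_commute)
  have dh: "((\<lambda>x::'a. h (x \<bullet> x)) has_derivative (\<lambda>v. h' (x \<bullet> x) * (2 * (x \<bullet> v)))) (at x)"
    "((\<lambda>x::'a. h' (x \<bullet> x)) has_derivative (\<lambda>v. h'' (x \<bullet> x) * (2 * (x \<bullet> v)))) (at x)" for x
    using has_derivative_compose[OF dq d(1)[unfolded has_field_derivative_def]]
      has_derivative_compose[OF dq d(2)[unfolded has_field_derivative_def]] by auto
  have d1: "((\<lambda>x. h (x \<bullet> x) * (x \<bullet> e)) has_derivative (\<lambda>v. radial_gradient h h' e x \<bullet> v)) (at x)" for x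
  proof (rule has_derivative_eq_rhs)
    show "((\<lambda>x. h (x \<bullet> x) * (x \<bullet> e)) has_derivative (\<lambda>v. h (x \<bullet> x) * (v \<bullet> e) + h' (x \<bullet> x) * (2 * (x \<bullet> v)) * (x \<bullet> e))) (at x)"
      by (rule has_derivative_mult[OF dh(1)]) (auto intro!: derivative_eq_intros)
  qed (auto simp: radial_gradient_def inner_add_left inner_commute algebra_simps)
  let ?G' = "\<lambda>x v. (h' (x \<bullet> x) * (2 * (x \<bullet> v))) *\<^sub>R e
      + ((2 * h' (x \<bullet> x) * (x \<bullet> e)) *\<^sub>R v + (2 * h' (x \<bullet> x) * (v \<bullet> e) + 2 * (h'' (x \<bullet> x) * (2 * (x \<bullet> v))) * (x \<bullet> e)) *\<^sub>R x)"
  have dG: "(radial_gradient h h' e has_derivative ?G' x) (at x)" for x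
  proof -
    have de: "((\<lambda>x. x \<bullet> e) has_derivative (\<lambda>v. v \<bullet> e)) (at x)" by (auto intro!: derivative_eq_intros)
    show ?thesis
      unfolding radial_gradient_def
      by (intro has_derivative_add has_derivative_scaleR_left dh(1)
          has_derivative_scaleR[OF has_derivative_mult[OF has_derivative_mult_right[OF dh(2)] de] has_derivative_ident])
  qed
  have ch'': "continuous_on UNIV (\<lambda>x::'a. h'' (x \<bullet> x))"
    by (rule continuous_on_compose2[OF c'']) (auto intro!: continuous_intros)
  have ch': "continuous_on UNIV (\<lambda>x::'a. h' (x \<bullet> x))"
    using dh(2) has_derivative_continuous by (blast intro: continuous_at_imp_continuous_on)
  have 1: "C1 (radial_gradient h h' e)"
    by (rule C1I[OF dG]) (intro continuous_intros ch' ch'')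
  have 2: "?G' x v \<bullet> w = ?G' x w \<bullet> v" for x v w
    by (simp add: inner_add_left inner_commute algebra_simps)
  have s: "spt (\<lambda>x. h (x \<bullet> x) * (x \<bullet> e)) \<subseteq> cball 0 (sqrt c)"
  proof (rule spt_subsetI)
    fix x :: 'a assume "x \<notin> cball 0 (sqrt c)"
    then have "c \<le> x \<bullet> x"
      using c real_sqrt_le_iff[of c "x \<bullet> x"] by (simp add: norm_eq_sqrt_inner)
    then show "h (x \<bullet> x) * (x \<bullet> e) = 0" using h unfolding radial_profile_def by auto
  qed simp
  have 3: "compact (spt (\<lambda>x. h (x \<bullet> x) * (x \<bullet> e)))" by (rule compact_spt_subset[OF _ s]) simp
  have 4: "cball 0 (sqrt c) \<subseteq> ball (0::'a) R"
    using c R real_less_rsqrt real_sqrt_less_mono[OF c(2)] by auto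
  show ?thesis
    unfolding test_field_def fst_conv snd_conv
    by (intro conjI allI exI[of _ ?G'] d1 dG 1 2 3 order_trans[OF s 4])
qed

lemma sum_Basis_square: "(\<Sum>b\<in>Basis. (x \<bullet> b)\<^sup>2) = x \<bullet> (x::'a::euclidean_space)"
  by (subst euclidean_inner) (simp add: power2_eq_square)

lemma sum_radial_gradient:
  "(\<Sum>b\<in>Basis. radial_gradient h h' b x \<bullet> b) = real DIM('a) * h (x \<bullet> x) + 2 * h' (x \<bullet> x) * (x \<bullet> (x::'a::euclidean_space))"
proof -
  have "(\<Sum>b\<in>Basis. radial_gradient h h' b x \<bullet> b) = (\<Sum>b\<in>Basis. h (x \<bullet> x) + 2 * h' (x \<bullet> x) * (x \<bullet> b)\<^sup>2)"
    by (intro sum.cong) (auto simp: radial_gradient_def inner_add_left power2_eq_square)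
  also have "\<dots> = real DIM('a) * h (x \<bullet> x) + 2 * h' (x \<bullet> x) * (\<Sum>b\<in>Basis. (x \<bullet> b)\<^sup>2)"
    by (simp add: sum.distrib sum_distrib_left)
  finally show ?thesis by (simp add: sum_Basis_square)
qed

lemma sum_radial_gradient_normal:
  fixes x n :: "'a::euclidean_space"
  shows "(\<Sum>b\<in>Basis. (b \<bullet> n) * (radial_gradient h h' b x \<bullet> n)) = h (x \<bullet> x) * (n \<bullet> n) + 2 * h' (x \<bullet> x) * (x \<bullet> n)\<^sup>2"
proof -
  have "(\<Sum>b\<in>Basis. (b \<bullet> n) * (radial_gradient h h' b x \<bullet> n))
      = (\<Sum>b\<in>Basis. h (x \<bullet> x) * (n \<bullet> b)\<^sup>2 + 2 * h' (x \<bullet> x) * (x \<bullet> n) * ((x \<bullet> b) * (n \<bullet> b)))"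
    by (intro sum.cong) (auto simp: radial_gradient_def inner_add_left inner_commute power2_eq_square algebra_simps)
  also have "\<dots> = h (x \<bullet> x) * (\<Sum>b\<in>Basis. (n \<bullet> b)\<^sup>2) + 2 * h' (x \<bullet> x) * (x \<bullet> n) * (\<Sum>b\<in>Basis. (x \<bullet> b) * (n \<bullet> b))"
    by (simp only: sum.distrib sum_distrib_left)
  also have "\<dots> = h (x \<bullet> x) * (n \<bullet> n) + 2 * h' (x \<bullet> x) * (x \<bullet> n) * (x \<bullet> n)"
    by (simp only: sum_Basis_square euclidean_inner[of x n, symmetric])
  finally show ?thesis by (simp add: power2_eq_square)
qed

lemma radial_profile_continuous:
  assumes "radial_profile c h h'"
  shows "continuous_on S h" "continuous_on S h'"
  using assms unfolding radial_profile_def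
  by (meson DERIV_isCont continuous_at_imp_continuous_on)+

lemma radial_profile_deriv_zero:
  assumes "radial_profile c h h'" "c < s"
  shows "h' s = 0"
proof -
  have "((\<lambda>_. 0) has_real_derivative h' s) (at s)"
  proof (rule has_field_derivative_transform_within_open[of h _ _ "{c<..}"])
    show "(h has_real_derivative h' s) (at s)" using assms(1) unfolding radial_profile_def by blast
  qed (use assms in \<open>auto simp: radial_profile_def\<close>)
  then show ?thesis using DERIV_const DERIV_unique by blast
qed

text \<open>The third claim is the divergence theorem for one component of the radial field: the
  integral of \<open>radial_gradient h h' e x \<bullet> e\<close> vanishes. It converts integrals of
  h' into integrals of h.\<close>

lemma radial_integrals:
  fixes e :: "'a::euclidean_space"
  assumes h: "radial_profile c h h'" and c: "0 < c"
  shows "integrable lborel (\<lambda>x::'a. h (x \<bullet> x))"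
    and "integrable lborel (\<lambda>x::'a. h' (x \<bullet> x) * (x \<bullet> e)\<^sup>2)"
    and "e \<in> Basis \<Longrightarrow> (LINT x|lborel. h (x \<bullet> (x::'a))) = - 2 * (LINT x|lborel. h' (x \<bullet> x) * (x \<bullet> e)\<^sup>2)"
proof -
  have c1: "continuous_on UNIV (\<lambda>x::'a. h (x \<bullet> x))" "continuous_on UNIV (\<lambda>x::'a. h' (x \<bullet> x) * (x \<bullet> e)\<^sup>2)"
    by (intro continuous_intros continuous_on_compose2[OF radial_profile_continuous(1)[OF h, of UNIV]]
        continuous_on_compose2[OF radial_profile_continuous(2)[OF h, of UNIV]]; simp)+
  obtain a where a: "cball (0::'a) (sqrt c) \<subseteq> cbox (- a) a"
    using bounded_subset_cbox_symmetric[OF bounded_cball] by metis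
  have out: "c < x \<bullet> x" if "x \<notin> cbox (- a) a" for x
  proof -
    have "sqrt c < norm x" using a that by (auto simp: not_le[symmetric])
    then show ?thesis by (simp add: norm_eq_sqrt_inner)
  qed
  show i1: "integrable lborel (\<lambda>x::'a. h (x \<bullet> x))"
    by (rule lborel_integral_cbox(1)[OF c1(1), of "- a" a]) (use out h in \<open>auto simp: radial_profile_def less_imp_le\<close>)
  show i2: "integrable lborel (\<lambda>x::'a. h' (x \<bullet> x) * (x \<bullet> e)\<^sup>2)"
    by (rule lborel_integral_cbox(1)[OF c1(2), of "- a" a]) (use out radial_profile_deriv_zero[OF h] in auto)
  assume e: "e \<in> Basis"
  have "test_field (ball 0 (sqrt c + 1)) (\<lambda>x. h (x \<bullet> x) * (x \<bullet> e), radial_gradient h h' e)"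
  proof (rule radial_test_field[OF h c])
    show "c < (sqrt c + 1)\<^sup>2" using c by (simp add: power2_sum add_pos_pos)
  qed (use c in \<open>auto simp: add_pos_nonneg\<close>)
  then interpret shear_field "\<lambda>x. h (x \<bullet> x) * (x \<bullet> e)" "radial_gradient h h' e" e
    unfolding test_field_def by unfold_locales (auto intro: C1_continuous)
  have "0 = (LINT x|lborel. radial_gradient h h' e x \<bullet> e)" by (rule integral_div_zero[symmetric])
  also have "\<dots> = (LINT x|lborel. h (x \<bullet> x) + 2 * (h' (x \<bullet> x) * (x \<bullet> e)\<^sup>2))"
    using e by (simp add: radial_gradient_def inner_add_left power2_eq_square algebra_simps)
  also have "\<dots> = (LINT x|lborel. h (x \<bullet> (x::'a))) + 2 * (LINT x|lborel. h' (x \<bullet> x) * (x \<bullet> e)\<^sup>2)"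
    using i1 i2 by simp
  finally show "(LINT x|lborel. h (x \<bullet> (x::'a))) = - 2 * (LINT x|lborel. h' (x \<bullet> x) * (x \<bullet> e)\<^sup>2)" by simp
qed

lemma radial_integral_identity:
  assumes h: "radial_profile c h h'" and c: "0 < c"
  shows "real DIM('a) * (LINT x|lborel. h (x \<bullet> (x::'a))) = - 2 * (LINT x|lborel. h' (x \<bullet> x) * (x \<bullet> (x::'a::euclidean_space)))"
proof -
  have "real DIM('a) * (LINT x|lborel. h (x \<bullet> (x::'a))) = (\<Sum>b\<in>(Basis::'a set). - 2 * (LINT x|lborel. h' (x \<bullet> x) * (x \<bullet> b)\<^sup>2))"
  proof -
    have "(\<Sum>b\<in>(Basis::'a set). - 2 * (LINT x|lborel. h' (x \<bullet> x) * (x \<bullet> b)\<^sup>2)) = (\<Sum>b\<in>(Basis::'a set). (LINT x|lborel. h (x \<bullet> (x::'a))))"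
      by (rule sum.cong[OF refl], rule radial_integrals(3)[OF h c, symmetric])
    then show ?thesis by simp
  qed
  also have "\<dots> = - 2 * (LINT x|lborel. (\<Sum>b\<in>(Basis::'a set). h' (x \<bullet> x) * (x \<bullet> b)\<^sup>2))"
    by (subst Bochner_Integration.integral_sum) (auto intro: radial_integrals(2)[OF h c] simp: sum_distrib_left)
  finally show ?thesis by (simp add: sum_distrib_left[symmetric] sum_Basis_square)
qed

context V_minimizer
begin

text \<open>Summing the multiplier identities over the coordinate directions expresses the radial
  variation through integrals of derivatives over the sets \<open>E j\<close>. \<Lambda> is built
  from the multipliers alone and so serves all profiles at once; its factor 2 is the one in front of
  the integral of h below.\<close>

lemma radial_variation:
  "\<exists>\<Lambda>\<ge>0. \<forall>c h h'. 0 < c \<and> c < R\<^sup>2 \<and> radial_profile c h h' \<longrightarrow>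
    (\<Sum>j\<le>2. \<alpha> j * (LINT x|var j. radial_tension h h' j x))
      \<le> \<Lambda> * (LINT x|lborel. h (x \<bullet> (x::'a)))"
proof -
  have "\<forall>e\<in>(Basis::'a set). \<exists>c. \<forall>p. test_field \<Omega> p \<longrightarrow>
    first_variation e (snd p) = (\<Sum>j<3. c j * (LINT x:E j|lborel. snd p x \<bullet> e))"
    by (intro ballI multipliers) simp
  from bchoice[OF this] obtain l where l: "\<And>e p. e \<in> Basis \<Longrightarrow> test_field \<Omega> p \<Longrightarrow>
    first_variation e (snd p) = (\<Sum>j<3. l e j * (LINT x:E j|lborel. snd p x \<bullet> e))" by blast
  define \<Lambda> where "\<Lambda> = 2 * (\<Sum>e\<in>(Basis::'a set). \<Sum>j<3. \<bar>l e j\<bar>)"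
  show ?thesis
  proof (intro exI[of _ \<Lambda>] conjI allI impI, unfold \<Lambda>_def)
    show "0 \<le> 2 * (\<Sum>e\<in>(Basis::'a set). \<Sum>j<3. \<bar>l e j\<bar>)" by (simp add: sum_nonneg)
    fix c h h' assume "0 < c \<and> c < R\<^sup>2 \<and> radial_profile c h h'"
    then have c: "0 < c" "c < R\<^sup>2" and h: "radial_profile c h h'" by auto
    have h0: "0 \<le> h s" "h' s \<le> 0" for s using h unfolding radial_profile_def by auto
    let ?G = "radial_gradient h h'"
    let ?I = "LINT x|lborel. h (x \<bullet> (x::'a))"
    have tf: "test_field \<Omega> (\<lambda>x. h (x \<bullet> x) * (x \<bullet> e), ?G e)" for e :: 'a
      by (rule radial_test_field[OF h c R_pos])
    have cG: "continuous_on UNIV (?G e)" for e :: 'a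
      using tf[of e] unfolding test_field_def by (auto intro: C1_continuous)
    have bG: "\<exists>K. \<forall>x. norm (?G e x) \<le> K" for e :: 'a
    proof -
      interpret shear_field "\<lambda>x. h (x \<bullet> x) * (x \<bullet> e)" "?G e" e
        using tf[of e] cG[of e] unfolding test_field_def by unfold_locales auto
      show ?thesis by (rule continuous_compact_spt_bounded[OF contG compact_spt_G]) blast
    qed
    have "(LINT x|var j. radial_tension h h' j x)
        = (\<Sum>e\<in>Basis. LINT x|var j. tension e (?G e) j x)" if j: "j \<le> 2" for j
    proof -
      have i: "integrable (var j) (\<lambda>x. tension e (?G e) j x)" if "e \<in> Basis" for e
      proof -
        obtain K where "\<And>x. norm (?G e x) \<le> K" using bG[of e] by blast
        then show ?thesis using that by (intro bounded_field_integrable(1)[OF j cG]) auto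
      qed
      have "(\<Sum>e\<in>Basis. LINT x|var j. tension e (?G e) j x)
          = (LINT x|var j. (\<Sum>e\<in>Basis. tension e (?G e) j x))"
        by (rule Bochner_Integration.integral_sum[symmetric]) (rule i)
      also have "\<dots> = (LINT x|var j. radial_tension h h' j x)"
        unfolding sum_subtractf sum_radial_gradient sum_radial_gradient_normal by (simp add: algebra_simps)
      finally show ?thesis by simp
    qed
    then have "(\<Sum>j\<le>2. \<alpha> j * (LINT x|var j. radial_tension h h' j x))
      = (\<Sum>j\<le>2. \<Sum>e\<in>Basis. \<alpha> j * (LINT x|var j. tension e (?G e) j x))"
      by (simp add: sum_distrib_left)
    also have "\<dots> = (\<Sum>e\<in>Basis. first_variation e (?G e))"
      unfolding first_variation_def by (rule sum.swap)
    also have "\<dots> \<le> (\<Sum>e\<in>(Basis::'a set). \<Sum>j<3. \<bar>l e j\<bar> * (2 * ?I))"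
    proof (rule sum_mono)
      fix e :: 'a assume e: "e \<in> Basis"
      have "first_variation e (?G e) = (\<Sum>j<3. l e j * (LINT x:E j|lborel. ?G e x \<bullet> e))"
        using l[OF e tf] by simp
      also have "\<dots> \<le> (\<Sum>j<3. \<bar>l e j\<bar> * (2 * ?I))"
      proof (rule sum_mono)
        fix j :: nat assume "j \<in> {..<3}"
        then have j: "j \<le> 2" by simp
        let ?f = "\<lambda>x. h (x \<bullet> x) + (- 2) * (h' (x \<bullet> x) * (x \<bullet> e)\<^sup>2)"
        have if': "integrable lborel ?f"
          by (intro Bochner_Integration.integrable_add integrable_mult_right radial_integrals(1,2)[OF h c(1)])
        have "\<bar>LINT x:E j|lborel. ?G e x \<bullet> e\<bar> \<le> (LINT x|lborel. ?f x)"
          unfolding set_lebesgue_integral_def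
        proof (rule order_trans[OF integral_abs_bound integral_mono_AE'])
          have *: "\<bar>indicator (E j) x *\<^sub>R (?G e x \<bullet> e)\<bar> \<le> ?f x" for x
          proof -
            have "?G e x \<bullet> e = h (x \<bullet> x) + 2 * (h' (x \<bullet> x) * (x \<bullet> e)\<^sup>2)"
              using e by (simp add: radial_gradient_def inner_add_left power2_eq_square)
            moreover have "h' (x \<bullet> x) * (x \<bullet> e)\<^sup>2 \<le> 0" using h0(2)[of "x \<bullet> x"] by (simp add: mult_nonpos_nonneg)
            ultimately show ?thesis using h0(1)[of "x \<bullet> x"] by (auto simp: indicator_def)
          qed
          then show "AE x in lborel. \<bar>indicator (E j) x *\<^sub>R (?G e x \<bullet> e)\<bar> \<le> ?f x" by simp
          show "AE x in lborel. 0 \<le> ?f x" using * by (intro AE_I2) (rule order_trans[OF abs_ge_zero])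
        qed (rule if')
        also have "(LINT x|lborel. ?f x) = ?I + (- 2) * (LINT x|lborel. h' (x \<bullet> x) * (x \<bullet> e)\<^sup>2)"
          using radial_integrals(1,2)[OF h c(1), where 'a='a]
          by (simp only: Bochner_Integration.integral_add integrable_mult_right integral_mult_right_zero)
        also have "\<dots> = 2 * ?I" using radial_integrals(3)[OF h c(1) e] by simp
        finally have "\<bar>l e j * (LINT x:E j|lborel. ?G e x \<bullet> e)\<bar> \<le> \<bar>l e j\<bar> * (2 * ?I)"
          unfolding abs_mult by (intro mult_left_mono) auto
        then show "l e j * (LINT x:E j|lborel. ?G e x \<bullet> e) \<le> \<bar>l e j\<bar> * (2 * ?I)" by linarith
      qed
      finally show "first_variation e (?G e) \<le> (\<Sum>j<3. \<bar>l e j\<bar> * (2 * ?I))" .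
    qed
    also have "\<dots> = 2 * (\<Sum>e\<in>(Basis::'a set). \<Sum>j<3. \<bar>l e j\<bar>) * ?I"
      by (simp add: sum_distrib_right sum_distrib_left mult_ac)
    finally show "(\<Sum>j\<le>2. \<alpha> j * (LINT x|var j. radial_tension h h' j x))
      \<le> 2 * (\<Sum>e\<in>(Basis::'a set). \<Sum>j<3. \<bar>l e j\<bar>) * ?I" .
  qed
qed

end

subsection \<open>Smooth cutoffs\<close>

(* A C^2 approximation of the positive part that vanishes exactly on the negative axis. *)
definition ramp :: "real \<Rightarrow> real \<Rightarrow> real" where
  "ramp k y = k * (max 0 y)\<^sup>2 * y / (1 + k * y\<^sup>2)"

definition ramp' :: "real \<Rightarrow> real \<Rightarrow> real" where
  "ramp' k y = k * (max 0 y)\<^sup>2 * (3 + k * y\<^sup>2) / (1 + k * y\<^sup>2)\<^sup>2"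

definition ramp'' :: "real \<Rightarrow> real \<Rightarrow> real" where
  "ramp'' k y = 2 * k * max 0 y * (3 + k * y\<^sup>2) / (1 + k * y\<^sup>2)\<^sup>2
     - k * (max 0 y)\<^sup>2 * (10 * k * y + 2 * k\<^sup>2 * y ^ 3) / (1 + k * y\<^sup>2) ^ 3"

lemma ramp_denominator_pos: "0 \<le> k \<Longrightarrow> 0 < 1 + k * (y::real)\<^sup>2"
  by (simp add: add_pos_nonneg)

lemma DERIV_ramp:
  assumes "0 \<le> k"
  shows "(ramp k has_real_derivative ramp' k y) (at y)"
proof -
  define p q where "p = max 0 y" and "q = 1 + k * y\<^sup>2"
  have q: "q \<noteq> 0" using ramp_denominator_pos[OF assms, of y] by (simp add: q_def)
  have py: "p * y = p\<^sup>2" unfolding p_def by (simp add: max_def power2_eq_square)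
  have "(ramp k has_real_derivative
      ((k * (2 * p) * y + k * p\<^sup>2) * q - k * p\<^sup>2 * y * (k * (2 * y))) / (q * q)) (at y)"
    unfolding ramp_def p_def q_def
  proof (rule DERIV_divide)
    show "((\<lambda>y. k * (max 0 y)\<^sup>2 * y) has_real_derivative k * (2 * max 0 y) * y + k * (max 0 y)\<^sup>2) (at y)"
      using DERIV_mult[OF DERIV_cmult[OF DERIV_pos_part_square, of k] DERIV_ident, of y] by (simp add: mult_ac)
    show "((\<lambda>y. 1 + k * y\<^sup>2) has_real_derivative k * (2 * y)) (at y)"
      by (auto intro!: derivative_eq_intros)
  qed (use q in \<open>simp add: q_def\<close>)
  also have "k * (2 * p) * y = 2 * k * p\<^sup>2" using py by simp
  also have "(2 * k * p\<^sup>2 + k * p\<^sup>2) * q - k * p\<^sup>2 * y * (k * (2 * y)) = k * p\<^sup>2 * (3 + k * y\<^sup>2)"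
    unfolding q_def by (simp add: power2_eq_square algebra_simps)
  finally show ?thesis unfolding ramp'_def p_def q_def by (simp add: power2_eq_square)
qed

lemma DERIV_ramp':
  assumes "0 \<le> k"
  shows "(ramp' k has_real_derivative ramp'' k y) (at y)"
proof -
  define p q where "p = max 0 y" and "q = 1 + k * y\<^sup>2"
  have q: "q \<noteq> 0" using ramp_denominator_pos[OF assms, of y] by (simp add: q_def)
  have "(ramp' k has_real_derivative
      ((k * (2 * p) * (3 + k * y\<^sup>2) + k * p\<^sup>2 * (k * (2 * y))) * q\<^sup>2 - k * p\<^sup>2 * (3 + k * y\<^sup>2) * (2 * q * (k * (2 * y)))) / (q\<^sup>2 * q\<^sup>2)) (at y)"
    unfolding ramp'_def p_def q_def
  proof (rule DERIV_divide)
    have d3: "((\<lambda>y. 3 + k * y\<^sup>2) has_real_derivative k * (2 * y)) (at y)"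
      by (auto intro!: derivative_eq_intros)
    show "((\<lambda>y. k * (max 0 y)\<^sup>2 * (3 + k * y\<^sup>2)) has_real_derivative
        k * (2 * max 0 y) * (3 + k * y\<^sup>2) + k * (max 0 y)\<^sup>2 * (k * (2 * y))) (at y)"
      using DERIV_mult[OF DERIV_cmult[OF DERIV_pos_part_square[of y], of k] d3] by (simp add: mult_ac)
    show "((\<lambda>y. (1 + k * y\<^sup>2)\<^sup>2) has_real_derivative 2 * (1 + k * y\<^sup>2) * (k * (2 * y))) (at y)"
      by (auto intro!: derivative_eq_intros)
  qed (use q in \<open>simp add: q_def\<close>)
  also have "((k * (2 * p) * (3 + k * y\<^sup>2) + k * p\<^sup>2 * (k * (2 * y))) * q\<^sup>2 - k * p\<^sup>2 * (3 + k * y\<^sup>2) * (2 * q * (k * (2 * y)))) / (q\<^sup>2 * q\<^sup>2)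
      = 2 * k * p * (3 + k * y\<^sup>2) / q\<^sup>2 - k * p\<^sup>2 * (2 * (3 + k * y\<^sup>2) * (k * (2 * y)) - k * (2 * y) * q) / q ^ 3"
    using q by (simp add: field_simps power2_eq_square power3_eq_cube)
  also have "2 * (3 + k * y\<^sup>2) * (k * (2 * y)) - k * (2 * y) * q = 10 * k * y + 2 * k\<^sup>2 * y ^ 3"
    unfolding q_def by (simp add: power2_eq_square power3_eq_cube algebra_simps)
  finally show ?thesis unfolding ramp''_def p_def q_def .
qed

lemma continuous_ramp'':
  assumes "0 \<le> k"
  shows "continuous_on UNIV (ramp'' k)"
proof -
  have "1 + k * y\<^sup>2 \<noteq> 0" for y :: real using ramp_denominator_pos[OF assms, of y] by simp
  then show ?thesis unfolding ramp''_def by (auto intro!: continuous_intros)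
qed

lemma ramp_nonpos: "y \<le> 0 \<Longrightarrow> ramp k y = 0" "y \<le> 0 \<Longrightarrow> ramp' k y = 0"
  by (simp_all add: ramp_def ramp'_def)

text \<open>In terms of w = 1/(1 + k y^2), which lies in (0, 1] and tends to 0 as k grows, both
  functions are polynomial; bounds and limits are read off from w.\<close>

lemma ramp_pos:
  assumes "0 \<le> k" "0 < y"
  defines "w \<equiv> inverse (1 + k * y\<^sup>2)"
  shows "ramp k y = y * (1 - w)" "ramp' k y = 1 + w - 2 * w\<^sup>2"
proof -
  define z where "z = k * y\<^sup>2"
  have z: "1 + z \<noteq> 0" using ramp_denominator_pos[OF assms(1), of y] by (simp add: z_def)
  have "ramp k y = z * y / (1 + z)" "ramp' k y = z * (3 + z) / (1 + z)\<^sup>2"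
    using assms(2) by (simp_all add: ramp_def ramp'_def z_def)
  moreover define t where "t = 1 + z"
  ultimately have r: "ramp k y = (t - 1) * y / t" "ramp' k y = (t - 1) * (t + 2) / t\<^sup>2" by simp_all
  have w: "w = inverse t" and t: "t \<noteq> 0" using z by (simp_all add: w_def z_def t_def)
  show "ramp k y = y * (1 - w)" "ramp' k y = 1 + w - 2 * w\<^sup>2"
    unfolding r w using t by (simp_all add: field_simps power2_eq_square)
qed

lemma ramp_bounds:
  assumes "0 \<le> k"
  shows "0 \<le> ramp k y" "ramp k y \<le> max 0 y" "0 \<le> ramp' k y" "ramp' k y \<le> 2"
proof -
  have "0 \<le> ramp k y \<and> ramp k y \<le> max 0 y \<and> 0 \<le> ramp' k y \<and> ramp' k y \<le> 2"
  proof (cases "0 < y")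
    case True
    define w where "w = inverse (1 + k * y\<^sup>2)"
    have "0 \<le> k * y\<^sup>2" using assms by simp
    then have w: "0 < w" "w \<le> 1" by (simp_all add: w_def inverse_le_1_iff add_pos_nonneg)
    have "w\<^sup>2 \<le> w" using w by (simp add: power2_eq_square mult_left_le)
    then have "0 \<le> 1 + w - 2 * w\<^sup>2" using w by linarith
    moreover have "1 + w - 2 * w\<^sup>2 \<le> 2" using w zero_le_power2[of w] by linarith
    moreover have "0 \<le> y * (1 - w)" "y * (1 - w) \<le> y" using w True by (simp_all add: mult_left_le)
    ultimately show ?thesis
      unfolding ramp_pos[OF assms True] w_def[symmetric] by auto
  qed (simp add: ramp_nonpos)
  then show "0 \<le> ramp k y" "ramp k y \<le> max 0 y" "0 \<le> ramp' k y" "ramp' k y \<le> 2" by auto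
qed

lemma ramp_mono: "0 \<le> k \<Longrightarrow> x \<le> y \<Longrightarrow> ramp k x \<le> ramp k y"
  by (rule DERIV_nonneg_imp_nondecreasing, assumption) (intro exI conjI, erule DERIV_ramp, erule ramp_bounds(3))

text \<open>The argument may vary with k because the outer ramp of the cutoff is applied to a
  quantity that already contains a ramp with the same k.\<close>

lemma ramp_tendsto_pos:
  assumes "y \<longlonglongrightarrow> l" "0 < l"
  shows "(\<lambda>k. ramp (real k) (y k)) \<longlonglongrightarrow> l" "(\<lambda>k. ramp' (real k) (y k)) \<longlonglongrightarrow> 1"
proof -
  let ?w = "\<lambda>k. inverse (1 + real k * (y k)\<^sup>2)"
  have "filterlim (\<lambda>k. (y k)\<^sup>2 * real k) at_top sequentially"
    using assms by (intro filterlim_tendsto_pos_mult_at_top[OF tendsto_power[OF assms(1)] _ filterlim_real_sequentially]) simp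
  then have "filterlim (\<lambda>k. 1 + real k * (y k)\<^sup>2) at_top sequentially"
    by (intro filterlim_tendsto_add_at_top[OF tendsto_const]) (simp add: mult.commute)
  then have w: "?w \<longlonglongrightarrow> 0" by (rule tendsto_inverse_0_at_top)
  have ev: "\<forall>\<^sub>F k in sequentially. 0 < y k" using order_tendstoD(1)[OF assms] .
  have "(\<lambda>k. y k * (1 - ?w k)) \<longlonglongrightarrow> l * (1 - 0)" by (intro tendsto_intros assms(1) w)
  then have "(\<lambda>k. y k * (1 - ?w k)) \<longlonglongrightarrow> l" by simp
  then show "(\<lambda>k. ramp (real k) (y k)) \<longlonglongrightarrow> l"
    by (rule Lim_transform_eventually) (use ev in \<open>eventually_elim, simp add: ramp_pos\<close>)
  have "(\<lambda>k. 1 + ?w k - 2 * (?w k)\<^sup>2) \<longlonglongrightarrow> 1 + 0 - 2 * 0\<^sup>2" by (intro tendsto_intros w)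
  then have "(\<lambda>k. 1 + ?w k - 2 * (?w k)\<^sup>2) \<longlonglongrightarrow> 1" by simp
  then show "(\<lambda>k. ramp' (real k) (y k)) \<longlonglongrightarrow> 1"
    by (rule Lim_transform_eventually) (use ev in \<open>eventually_elim, simp add: ramp_pos\<close>)
qed

lemma ramp_tendsto:
  assumes "y \<longlonglongrightarrow> l"
  shows "(\<lambda>k. ramp (real k) (y k)) \<longlonglongrightarrow> max 0 l"
proof (cases "0 < l")
  case True
  then show ?thesis using ramp_tendsto_pos(1)[OF assms True] by simp
next
  case False
  have m: "(\<lambda>k. max 0 (y k)) \<longlonglongrightarrow> 0"
    using tendsto_max[OF tendsto_const[of 0] assms] False by simp
  have "(\<lambda>k. ramp (real k) (y k)) \<longlonglongrightarrow> 0"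
    by (rule tendsto_sandwich[OF _ _ tendsto_const m]) (simp_all add: ramp_bounds)
  then show ?thesis using False by simp
qed

section \<open>Smooth approximation of the truncated power profile\<close>

locale cutoff =
  fixes \<rho> r p :: real
  assumes \<rho>: "0 < \<rho>" "\<rho> < r" and p: "0 < p"
begin

definition base :: "real \<Rightarrow> real \<Rightarrow> real" where "base k s = \<rho>\<^sup>2 + ramp k (s - \<rho>\<^sup>2)"

text \<open>\<open>base\<close> smooths the maximum of \<open>\<rho>\<^sup>2\<close> and s.
  Subtracting its own power at \<open>r\<^sup>2\<close>, instead of the power of
  \<open>r\<^sup>2\<close> itself, makes the profile vanish from \<open>r\<^sup>2\<close> on for
  every k.\<close>

definition arg :: "real \<Rightarrow> real \<Rightarrow> real" where
  "arg k s = base k s powr (- p) - base k (r\<^sup>2) powr (- p)"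

definition arg' :: "real \<Rightarrow> real \<Rightarrow> real" where
  "arg' k s = - p * base k s powr (- p - 1) * ramp' k (s - \<rho>\<^sup>2)"

definition h :: "real \<Rightarrow> real \<Rightarrow> real" where "h k s = ramp k (arg k s)"

definition h' :: "real \<Rightarrow> real \<Rightarrow> real" where "h' k s = ramp' k (arg k s) * arg' k s"

text \<open>In the application p = (n - 1)/2. At s = |x|^2 this is then the profile of the radial
  test field of the monotonicity formula.\<close>

definition H :: "real \<Rightarrow> real" where "H s = max 0 ((max (\<rho>\<^sup>2) s) powr (- p) - (r\<^sup>2) powr (- p))"

text \<open>The value 0 at the two corners is the limit of the smooth derivatives there, not a mere
  convention: the perimeter measures may charge the spheres of radius \<rho> and r.\<close>

definition H' :: "real \<Rightarrow> real" where
  "H' s = (if \<rho>\<^sup>2 < s \<and> s < r\<^sup>2 then - p * s powr (- p - 1) else 0)"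

lemma \<rho>r2: "0 < \<rho>\<^sup>2" "\<rho>\<^sup>2 < r\<^sup>2"
  using \<rho> by (auto intro: power_strict_mono)

lemma base_ge: "0 \<le> k \<Longrightarrow> \<rho>\<^sup>2 \<le> base k s"
  using ramp_bounds(1) by (simp add: base_def)

lemma base_pos: "0 \<le> k \<Longrightarrow> 0 < base k s"
  using base_ge[of k s] \<rho>r2(1) by linarith

lemma base_mono: "0 \<le> k \<Longrightarrow> s \<le> t \<Longrightarrow> base k s \<le> base k t"
  by (simp add: base_def ramp_mono)

lemma arg_nonpos:
  assumes "0 \<le> k" "r\<^sup>2 \<le> s" shows "arg k s \<le> 0"
  using base_mono[OF assms] base_pos[OF assms(1)] p by (simp add: arg_def powr_mono2')

lemma DERIV_base: "0 \<le> k \<Longrightarrow> (base k has_real_derivative ramp' k (s - \<rho>\<^sup>2)) (at s)"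
  unfolding base_def
  using DERIV_add[OF DERIV_const[of "\<rho>\<^sup>2"] DERIV_chain2[OF DERIV_ramp DERIV_diff[OF DERIV_ident DERIV_const[of "\<rho>\<^sup>2"]]]]
  by simp

lemma DERIV_ramp'_shift: "0 \<le> k \<Longrightarrow> ((\<lambda>s. ramp' k (s - \<rho>\<^sup>2)) has_real_derivative ramp'' k (s - \<rho>\<^sup>2)) (at s)"
  using DERIV_chain2[OF DERIV_ramp' DERIV_diff[OF DERIV_ident DERIV_const[of "\<rho>\<^sup>2"]]] by simp

lemma DERIV_base_powr:
  assumes "0 \<le> k"
  shows "((\<lambda>s. base k s powr a) has_real_derivative a * base k s powr (a - 1) * ramp' k (s - \<rho>\<^sup>2)) (at s)"
  using DERIV_chain2[OF has_real_derivative_powr[OF base_pos[OF assms]] DERIV_base[OF assms]] .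

lemma DERIV_arg: "0 \<le> k \<Longrightarrow> (arg k has_real_derivative arg' k s) (at s)"
  unfolding arg_def arg'_def
  using DERIV_diff[OF DERIV_base_powr[of k "- p" s] DERIV_const] by simp

lemma h_profile:
  assumes k: "0 \<le> k"
  shows "radial_profile (r\<^sup>2) (h k) (h' k)"
proof -
  define arg'' where "arg'' s = - p * ((- p - 1) * base k s powr (- p - 1 - 1) * ramp' k (s - \<rho>\<^sup>2) * ramp' k (s - \<rho>\<^sup>2)
      + base k s powr (- p - 1) * ramp'' k (s - \<rho>\<^sup>2))" for s
  have d: "(arg' k has_real_derivative arg'' s) (at s)" for s
    unfolding arg'_def arg''_def
    using DERIV_cmult[OF DERIV_mult[OF DERIV_base_powr[OF k, of "- p - 1" s] DERIV_ramp'_shift[OF k, of s]], of "- p"]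
    by (simp add: mult.assoc add.commute mult.commute mult.left_commute)
  have d1: "(h k has_real_derivative h' k s) (at s)" for s
    unfolding h_def h'_def by (rule DERIV_chain2[OF DERIV_ramp[OF k] DERIV_arg[OF k]])
  have d2: "(h' k has_real_derivative ramp'' k (arg k s) * arg' k s * arg' k s + ramp' k (arg k s) * arg'' s) (at s)" for s
    unfolding h'_def
    using DERIV_mult[OF DERIV_chain2[OF DERIV_ramp'[OF k] DERIV_arg[OF k]] d] by (simp add: add.commute mult.commute)
  have ca: "continuous_on UNIV (arg k)" "continuous_on UNIV (arg' k)" "continuous_on UNIV (ramp' k)"
    by (intro continuous_at_imp_continuous_on ballI DERIV_isCont[OF DERIV_arg[OF k]] DERIV_isCont[OF d]
        DERIV_isCont[OF DERIV_ramp'[OF k]])+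
  have cb: "continuous_on UNIV (\<lambda>s. base k s powr a)" for a
    by (intro continuous_at_imp_continuous_on ballI DERIV_isCont[OF DERIV_base_powr[OF k]])
  have cr: "continuous_on UNIV (\<lambda>s. ramp' k (s - \<rho>\<^sup>2))" "continuous_on UNIV (\<lambda>s. ramp'' k (s - \<rho>\<^sup>2))"
    "continuous_on UNIV (\<lambda>s. ramp' k (arg k s))" "continuous_on UNIV (\<lambda>s. ramp'' k (arg k s))"
    using ca(1) by (auto intro!: continuous_on_compose2[OF ca(3)] continuous_on_compose2[OF continuous_ramp''[OF k]] continuous_intros)
  have c'': "continuous_on UNIV arg''"
    unfolding arg''_def by (intro continuous_on_add continuous_on_mult continuous_on_const cb cr)
  have c3: "continuous_on UNIV (\<lambda>s. ramp'' k (arg k s) * arg' k s * arg' k s + ramp' k (arg k s) * arg'' s)"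
    by (intro continuous_on_add continuous_on_mult ca c'' cr)
  have z: "h k s = 0" if "r\<^sup>2 \<le> s" for s
    unfolding h_def using arg_nonpos[OF k that] by (rule ramp_nonpos)
  have nn: "0 \<le> h k s" for s unfolding h_def by (rule ramp_bounds[OF k])
  have np: "h' k s \<le> 0" for s
  proof -
    have "0 \<le> ramp' k (arg k s) * (p * base k s powr (- p - 1) * ramp' k (s - \<rho>\<^sup>2))"
      using p ramp_bounds(3)[OF k] by (intro mult_nonneg_nonneg) auto
    then show ?thesis unfolding h'_def arg'_def by simp
  qed
  show ?thesis
    unfolding radial_profile_def by (intro conjI exI[of _ "\<lambda>s. ramp'' k (arg k s) * arg' k s * arg' k s + ramp' k (arg k s) * arg'' s"]
        allI impI d1 d2 c3 z nn np)
qed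

text \<open>Bounds uniform in k, for dominated convergence. The factor 4 arises because each of the
  two nested ramps has derivative at most 2.\<close>

lemma h_bounds:
  assumes "0 \<le> k"
  shows "0 \<le> h k s" "h k s \<le> (\<rho>\<^sup>2) powr (- p)" "\<bar>h' k s\<bar> \<le> 4 * p * (\<rho>\<^sup>2) powr (- p - 1)"
proof -
  show "0 \<le> h k s" unfolding h_def by (rule ramp_bounds[OF assms])
  have b: "base k s powr (- p) \<le> (\<rho>\<^sup>2) powr (- p)" "base k s powr (- p - 1) \<le> (\<rho>\<^sup>2) powr (- p - 1)"
    using base_ge[OF assms, of s] \<rho>r2(1) p by (auto intro!: powr_mono2')
  have "h k s \<le> max 0 (arg k s)" unfolding h_def by (rule ramp_bounds[OF assms])
  also have "\<dots> \<le> (\<rho>\<^sup>2) powr (- p)" using b(1) powr_ge_zero[of "base k (r\<^sup>2)" "- p"] unfolding arg_def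
    by (intro max.boundedI powr_ge_zero) linarith
  finally show "h k s \<le> (\<rho>\<^sup>2) powr (- p)" .
  have "\<bar>h' k s\<bar> = ramp' k (arg k s) * (p * base k s powr (- p - 1) * ramp' k (s - \<rho>\<^sup>2))"
    unfolding h'_def arg'_def using ramp_bounds(3)[OF assms] p by (simp add: abs_mult)
  also have "\<dots> \<le> 2 * (p * (\<rho>\<^sup>2) powr (- p - 1) * 2)"
    using ramp_bounds(3,4)[OF assms] p b(2) by (intro mult_mono) auto
  finally show "\<bar>h' k s\<bar> \<le> 4 * p * (\<rho>\<^sup>2) powr (- p - 1)" by simp
qed

lemma base_tendsto: "(\<lambda>k. base (real k) s) \<longlonglongrightarrow> max (\<rho>\<^sup>2) s"
proof -
  have "(\<lambda>k. base (real k) s) \<longlonglongrightarrow> \<rho>\<^sup>2 + max 0 (s - \<rho>\<^sup>2)"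
    unfolding base_def by (intro tendsto_intros ramp_tendsto)
  then show ?thesis by (simp add: max_def split: if_splits)
qed

lemma base_powr_tendsto: "(\<lambda>k. base (real k) s powr a) \<longlonglongrightarrow> max (\<rho>\<^sup>2) s powr a"
  using \<rho>r2(1) by (intro tendsto_powr base_tendsto tendsto_const) (auto simp: max_def)

lemma arg_tendsto: "(\<lambda>k. arg (real k) s) \<longlonglongrightarrow> max (\<rho>\<^sup>2) s powr (- p) - (r\<^sup>2) powr (- p)"
proof -
  have "max (\<rho>\<^sup>2) (r\<^sup>2) = r\<^sup>2" using \<rho>r2 by simp
  then show ?thesis
    unfolding arg_def using tendsto_diff[OF base_powr_tendsto[of s "- p"] base_powr_tendsto[of "r\<^sup>2" "- p"]] by simp
qed

lemma h_tendsto: "(\<lambda>k. h (real k) s) \<longlonglongrightarrow> H s"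
  unfolding h_def H_def by (rule ramp_tendsto[OF arg_tendsto])

text \<open>Up to \<open>\<rho>\<^sup>2\<close> the inner ramp has derivative 0, and from
  \<open>r\<^sup>2\<close> on the outer one, for every k. Strictly between, the arguments of both
  ramps have positive limits, so both derivatives tend to 1.\<close>

lemma h'_tendsto: "(\<lambda>k. h' (real k) s) \<longlonglongrightarrow> H' s"
proof -
  consider "s \<le> \<rho>\<^sup>2" | "r\<^sup>2 \<le> s" | "\<rho>\<^sup>2 < s" "s < r\<^sup>2" by linarith
  then show ?thesis
  proof cases
    case 1
    then have "h' k s = 0" for k by (simp add: h'_def arg'_def ramp_nonpos)
    then show ?thesis using 1 by (simp add: H'_def)
  next
    case 2
    then have "h' (real k) s = 0" for k using arg_nonpos[of "real k" s] by (simp add: h'_def ramp_nonpos)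
    then show ?thesis using 2 by (simp add: H'_def)
  next
    case 3
    have "s powr (- p) > (r\<^sup>2) powr (- p)"
      using 3 less_trans[OF \<rho>r2(1), of s] p by (intro powr_less_mono2_neg) simp_all
    then have l: "0 < max (\<rho>\<^sup>2) s powr (- p) - (r\<^sup>2) powr (- p)" using 3 by simp
    have "(\<lambda>k. ramp' (real k) (arg (real k) s) * (- p * base (real k) s powr (- p - 1) * ramp' (real k) (s - \<rho>\<^sup>2)))
        \<longlonglongrightarrow> 1 * (- p * max (\<rho>\<^sup>2) s powr (- p - 1) * 1)"
      using 3 by (intro tendsto_intros ramp_tendsto_pos(2)[OF arg_tendsto l] base_powr_tendsto
          ramp_tendsto_pos(2)[OF tendsto_const]) auto
    then show ?thesis using 3 by (simp add: h'_def arg'_def H'_def)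
  qed
qed

lemma H_measurable [measurable]: "H \<in> borel_measurable borel" "H' \<in> borel_measurable borel"
  unfolding H_def H'_def by measurable

lemma h_measurable [measurable]:
  assumes "0 \<le> k" shows "h k \<in> borel_measurable borel" "h' k \<in> borel_measurable borel"
  using radial_profile_continuous[OF h_profile[OF assms], of UNIV] by (auto intro: borel_measurable_continuous_onI)

lemma h_zero: "0 \<le> k \<Longrightarrow> r\<^sup>2 \<le> s \<Longrightarrow> h k s = 0 \<and> h' k s = 0"
  using arg_nonpos by (simp add: h_def h'_def ramp_nonpos)

lemma lborel_tendsto:
  shows "(\<lambda>k. LINT x|lborel. h (real k) (x \<bullet> (x::'a::euclidean_space))) \<longlonglongrightarrow> (LINT x|lborel. H (x \<bullet> (x::'a)))"
    and "(\<lambda>k. LINT x|lborel. h' (real k) (x \<bullet> x) * (x \<bullet> (x::'a))) \<longlonglongrightarrow> (LINT x|lborel. H' (x \<bullet> x) * (x \<bullet> (x::'a)))"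
proof -
  have out: "r\<^sup>2 \<le> x \<bullet> x" if "x \<notin> ball 0 r" for x :: 'a
    using that \<rho> by (simp add: dot_square_norm power_mono)
  have inn: "x \<bullet> x \<le> r\<^sup>2" if "x \<in> ball 0 r" for x :: 'a
    using that by (simp add: dot_square_norm power_mono)
  have ib: "integrable lborel (indicator (ball 0 r) :: 'a \<Rightarrow> real)"
    using emeasure_bounded_finite[OF bounded_ball, of "0::'a" r] by simp
  let ?A = "(\<rho>\<^sup>2) powr (- p)" and ?B = "4 * p * (\<rho>\<^sup>2) powr (- p - 1)"
  show "(\<lambda>k. LINT x|lborel. h (real k) (x \<bullet> (x::'a::euclidean_space))) \<longlonglongrightarrow> (LINT x|lborel. H (x \<bullet> (x::'a)))"
  proof (rule integral_dominated_convergence[where w="\<lambda>x. ?A * indicator (ball 0 r) x"])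
    show "AE x::'a in lborel. norm (h (real k) (x \<bullet> x)) \<le> ?A * indicator (ball 0 r) x" for k
      using h_bounds(1,2)[of "real k"] h_zero[of "real k"] out by (auto simp: indicator_def)
  qed (use ib h_tendsto in auto)
  show "(\<lambda>k. LINT x|lborel. h' (real k) (x \<bullet> x) * (x \<bullet> (x::'a))) \<longlonglongrightarrow> (LINT x|lborel. H' (x \<bullet> x) * (x \<bullet> (x::'a)))"
  proof (rule integral_dominated_convergence[where w="\<lambda>x. ?B * r\<^sup>2 * indicator (ball 0 r) x"])
    show "AE x::'a in lborel. norm (h' (real k) (x \<bullet> x) * (x \<bullet> x)) \<le> ?B * r\<^sup>2 * indicator (ball 0 r) x" for k
    proof (rule AE_I2)
      fix x :: 'a
      show "norm (h' (real k) (x \<bullet> x) * (x \<bullet> x)) \<le> ?B * r\<^sup>2 * indicator (ball 0 r) x"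
      proof (cases "x \<in> ball 0 r")
        case True
        have "norm (h' (real k) (x \<bullet> x) * (x \<bullet> x)) \<le> ?B * r\<^sup>2"
          unfolding norm_mult using h_bounds(3)[of "real k" "x \<bullet> x"] inn[OF True] p by (intro mult_mono) auto
        then show ?thesis using True by simp
      qed (use h_zero[of "real k"] out in auto)
    qed
  qed (use ib h'_tendsto in \<open>auto intro!: tendsto_intros\<close>)
qed

text \<open>The divergence theorem for the limiting profile, which has corners. It replaces polar
  coordinates in the evaluation of the integral of H.\<close>

lemma H_identity: "real DIM('a) * (LINT x|lborel. H (x \<bullet> (x::'a))) = - 2 * (LINT x|lborel. H' (x \<bullet> x) * (x \<bullet> (x::'a::euclidean_space)))"
proof (rule LIMSEQ_unique)
  show "(\<lambda>k. real DIM('a) * (LINT x|lborel. h (real k) (x \<bullet> (x::'a)))) \<longlonglongrightarrow> real DIM('a) * (LINT x|lborel. H (x \<bullet> (x::'a)))"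
    by (intro tendsto_intros lborel_tendsto)
  have "(\<lambda>k. - 2 * (LINT x|lborel. h' (real k) (x \<bullet> x) * (x \<bullet> (x::'a)))) \<longlonglongrightarrow> - 2 * (LINT x|lborel. H' (x \<bullet> x) * (x \<bullet> (x::'a)))"
    by (intro tendsto_intros lborel_tendsto)
  then show "(\<lambda>k. real DIM('a) * (LINT x|lborel. h (real k) (x \<bullet> (x::'a)))) \<longlonglongrightarrow> - 2 * (LINT x|lborel. H' (x \<bullet> x) * (x \<bullet> (x::'a)))"
    using radial_integral_identity[OF h_profile \<rho>r2(1)[THEN less_trans, OF \<rho>r2(2)], where 'a='a] by simp
qed

end

subsection \<open>The monotonicity formula\<close>

context vec_measure
begin

lemma measurable_TV_of_borel: "f \<in> borel_measurable borel \<Longrightarrow> f \<in> borel_measurable TV"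
  using measurable_restrict_space1[of f borel borel \<Omega>] measurable_cong_sets[OF sets_TV refl, of borel] by blast

end

context V_minimizer
begin

text \<open>Passage to the limit in the variation of the smooth profiles. The convergence holds at
  every point and the perimeter measures are finite, so a constant dominates; this also covers mass
  on the spheres where the limiting profile has corners.\<close>

lemma cutoff_variation:
  assumes "0 < \<rho>" "\<rho> < r" "r < R" "0 < p"
    and \<Lambda>: "\<forall>c h h'. 0 < c \<and> c < R\<^sup>2 \<and> radial_profile c h h' \<longrightarrow>
    (\<Sum>j\<le>2. \<alpha> j * (LINT x|var j. radial_tension h h' j x))
      \<le> \<Lambda> * (LINT x|lborel. h (x \<bullet> (x::'a)))"
  defines "F \<equiv> \<lambda>j x. radial_tension (cutoff.H \<rho> r p) (cutoff.H' \<rho> r p) j x"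
  shows "(\<Sum>j\<le>2. \<alpha> j * (LINT x|var j. F j x)) \<le> \<Lambda> * (LINT x|lborel. cutoff.H \<rho> r p (x \<bullet> (x::'a)))"
    and "j \<le> 2 \<Longrightarrow> integrable (var j) (F j)"
proof -
  interpret cutoff \<rho> r p by unfold_locales fact+
  let ?F = "\<lambda>k j x. radial_tension (h (real k)) (h' (real k)) j x"
  have lim: "(\<lambda>k. LINT x|var j. ?F k j x) \<longlonglongrightarrow> (LINT x|var j. F j x) \<and> integrable (var j) (F j)" if j: "j \<le> 2" for j
  proof -
    interpret vec_measure \<Omega> "DE j" by (rule vec_measure_DE[OF j])
    have id: "(\<lambda>x. x) \<in> borel_measurable TV" by (rule measurable_TV_of_borel) simp
    have [measurable]: "(\<lambda>x. x \<bullet> \<nu> x) \<in> borel_measurable TV" "(\<lambda>x. x \<bullet> x) \<in> borel_measurable TV"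
      by (intro borel_measurable_inner id measurable_rn_density)+
    let ?K = "real DIM('a) * (\<rho>\<^sup>2) powr (- p) + 2 * (4 * p * (\<rho>\<^sup>2) powr (- p - 1)) * R\<^sup>2"
    have i: "integrable TV (\<lambda>x. ?K)" by simp
    have m1: "F j \<in> borel_measurable TV" unfolding F_def by measurable
    have m2: "?F k j \<in> borel_measurable TV" for k by measurable
    have l: "AE x in TV. (\<lambda>k. ?F k j x) \<longlonglongrightarrow> F j x"
      unfolding F_def by (intro AE_I2 tendsto_intros h_tendsto h'_tendsto)
    have b: "AE x in TV. norm (?F k j x) \<le> ?K" for k
      using norm_rn_density_le AE_space
    proof eventually_elim
      case (elim x)
      have g: "0 \<le> \<nu> x \<bullet> \<nu> x" "\<nu> x \<bullet> \<nu> x \<le> 1"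
        using elim(1) by (simp_all add: dot_square_norm power_le_one)
      have "norm x < R" using elim(2) by simp
      then have xx: "x \<bullet> x \<le> R\<^sup>2" by (simp add: dot_square_norm power_mono)
      have "(x \<bullet> \<nu> x)\<^sup>2 \<le> (x \<bullet> x) * (\<nu> x \<bullet> \<nu> x)" by (rule Cauchy_Schwarz_ineq)
      also have "\<dots> \<le> x \<bullet> x" using g by (simp add: mult_left_le)
      finally have xg: "\<bar>x \<bullet> x - (x \<bullet> \<nu> x)\<^sup>2\<bar> \<le> R\<^sup>2" using xx zero_le_power2[of "x \<bullet> \<nu> x"] by linarith
      have "1 \<le> real DIM('a)" using DIM_positive[where 'a='a] by linarith
      then have "\<bar>real DIM('a) - \<nu> x \<bullet> \<nu> x\<bar> \<le> real DIM('a)" using g by linarith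
      then have "\<bar>(real DIM('a) - \<nu> x \<bullet> \<nu> x) * h (real k) (x \<bullet> x)\<bar> \<le> real DIM('a) * (\<rho>\<^sup>2) powr (- p)"
        unfolding abs_mult using h_bounds(1,2)[of "real k"] by (intro mult_mono) auto
      moreover have "\<bar>2 * h' (real k) (x \<bullet> x) * (x \<bullet> x - (x \<bullet> \<nu> x)\<^sup>2)\<bar> \<le> 2 * (4 * p * (\<rho>\<^sup>2) powr (- p - 1)) * R\<^sup>2"
        unfolding abs_mult using xg h_bounds(3)[of "real k" "x \<bullet> x"] p by (intro mult_mono) auto
      ultimately show ?case unfolding real_norm_def by linarith
    qed
    show ?thesis
      using integral_dominated_convergence[OF m1 m2 i l b] integrable_dominated_convergence[OF m1 m2 i l b] by simp
  qed
  then show "j \<le> 2 \<Longrightarrow> integrable (var j) (F j)" by simp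
  show "(\<Sum>j\<le>2. \<alpha> j * (LINT x|var j. F j x)) \<le> \<Lambda> * (LINT x|lborel. H (x \<bullet> (x::'a)))"
  proof (rule LIMSEQ_le)
    show "(\<lambda>k. \<Sum>j\<le>2. \<alpha> j * (LINT x|var j. ?F k j x)) \<longlonglongrightarrow> (\<Sum>j\<le>2. \<alpha> j * (LINT x|var j. F j x))"
      using lim by (intro tendsto_sum tendsto_mult tendsto_const) auto
    show "(\<lambda>k. \<Lambda> * (LINT x|lborel. h (real k) (x \<bullet> (x::'a)))) \<longlonglongrightarrow> \<Lambda> * (LINT x|lborel. H (x \<bullet> (x::'a)))"
      by (intro tendsto_intros lborel_tendsto)
    have "0 < r\<^sup>2" "r\<^sup>2 < R\<^sup>2" using assms(1-3) by (auto intro: power_strict_mono)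
    then have "(\<Sum>j\<le>2. \<alpha> j * (LINT x|var j. ?F k j x)) \<le> \<Lambda> * (LINT x|lborel. h (real k) (x \<bullet> (x::'a)))" for k
      by (intro \<Lambda>[rule_format, of "r\<^sup>2" "h (real k)" "h' (real k)"] conjI h_profile) auto
    then show "\<exists>N. \<forall>k\<ge>N. (\<Sum>j\<le>2. \<alpha> j * (LINT x|var j. ?F k j x)) \<le> \<Lambda> * (LINT x|lborel. h (real k) (x \<bullet> (x::'a)))"
      by blast
  qed
qed

end

section \<open>The limiting profile in dimension n\<close>

lemma powi_one_minus:
  fixes n :: nat
  assumes "0 < t" "1 \<le> n"
  shows "t powi (1 - int n) = inverse (t ^ (n - 1))"
    and "(t\<^sup>2) powr (- ((real n - 1) / 2)) = t powi (1 - int n)"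
proof -
  have D: "1 - int n = - int (n - 1)" using assms(2) by simp
  show 1: "t powi (1 - int n) = inverse (t ^ (n - 1))"
    unfolding D power_int_minus power_int_of_nat ..
  have "(t\<^sup>2) powr (- ((real n - 1) / 2)) = (t powr 2) powr (- (real (n - 1) / 2))"
    using assms by (simp add: of_nat_diff)
  also have "\<dots> = t powr (- real (n - 1))" by (simp add: powr_powr)
  also have "\<dots> = inverse (t powr real (n - 1))" by (rule powr_minus)
  also have "\<dots> = inverse (t ^ (n - 1))" using assms(1) by (simp only: powr_realpow)
  finally show "(t\<^sup>2) powr (- ((real n - 1) / 2)) = t powi (1 - int n)" using 1 by simp
qed

text \<open>Positivity of the exponent forces n \<ge> 2; dimension one is treated apart in
  \<open>monotonicity\<close>.\<close>

locale cutoff_dim = cutoff \<rho> r "(real n - 1) / 2" for \<rho> r :: real and n :: nat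
begin

abbreviation pw :: "real \<Rightarrow> real" where "pw t \<equiv> t powi (1 - int n)"

abbreviation m :: real where "m \<equiv> real n - 1"

lemma n_ge: "2 \<le> n"
  using p by simp

lemma m_pos: "1 \<le> m"
  using n_ge by simp

lemma powr_pw: "0 < t \<Longrightarrow> (t\<^sup>2) powr (- (m / 2)) = pw t"
  using powi_one_minus(2)[of t n] n_ge by simp

lemma pw_eq: "0 < t \<Longrightarrow> pw t = inverse (t ^ (n - 1))"
  using powi_one_minus(1)[of t n] n_ge by simp

lemma pw_pos: "0 < t \<Longrightarrow> 0 < pw t" by simp

lemma pw_antimono: "0 < s \<Longrightarrow> s \<le> t \<Longrightarrow> pw t \<le> pw s"
  by (auto simp: pw_eq intro!: le_imp_inverse_le power_mono)

lemma H_inside: "norm (x::'a::euclidean_space) \<le> \<rho> \<Longrightarrow> H (x \<bullet> x) = pw \<rho> - pw r \<and> H' (x \<bullet> x) = 0"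
proof -
  assume x: "norm x \<le> \<rho>"
  then have s: "x \<bullet> x \<le> \<rho>\<^sup>2" by (simp add: dot_square_norm power_mono)
  have "\<rho>\<^sup>2 powr (- (m / 2)) = pw \<rho>" "r\<^sup>2 powr (- (m / 2)) = pw r" using \<rho> by (auto intro!: powr_pw)
  moreover have "pw r \<le> pw \<rho>" using \<rho> by (intro pw_antimono) auto
  ultimately show ?thesis using s unfolding H_def H'_def by (simp add: max_absorb1)
qed

lemma H_shell:
  assumes "\<rho> < norm (x::'a::euclidean_space)" "norm x < r"
  shows "H (x \<bullet> x) = pw (norm x) - pw r" "2 * H' (x \<bullet> x) * (x \<bullet> x) = - m * pw (norm x)"
proof -
  have x: "\<rho>\<^sup>2 < (norm x)\<^sup>2" "(norm x)\<^sup>2 < r\<^sup>2" using assms \<rho>(1) by (auto intro: power_strict_mono)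
  have nx: "0 < norm x" using assms \<rho>(1) by linarith
  show "H (x \<bullet> x) = pw (norm x) - pw r"
    using x nx assms(2) \<rho> pw_antimono[of "norm x" r] by (simp add: H_def dot_square_norm max_absorb2 powr_pw)
  have "(norm x)\<^sup>2 powr (- (m / 2) - 1) * (norm x)\<^sup>2 = (norm x)\<^sup>2 powr (- (m / 2))"
    using nx by (simp add: powr_diff)
  then have "(norm x)\<^sup>2 powr (- (m / 2) - 1) * (norm x)\<^sup>2 = pw (norm x)" using powr_pw[OF nx] by simp
  moreover have "H' (x \<bullet> x) = - (m / 2) * (norm x)\<^sup>2 powr (- (m / 2) - 1)"
    unfolding H'_def dot_square_norm by (rule if_P) (use x in simp)
  moreover have "2 * (- (M / 2) * P) * s = - M * (P * s)" for M P s :: real by simp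
  ultimately show "2 * H' (x \<bullet> x) * (x \<bullet> x) = - m * pw (norm x)"
    by (simp only: dot_square_norm)
qed

lemma H_outside: "r \<le> norm (x::'a::euclidean_space) \<Longrightarrow> H (x \<bullet> x) = 0 \<and> H' (x \<bullet> x) = 0"
proof -
  assume x: "r \<le> norm x"
  then have r2: "r\<^sup>2 \<le> (norm x)\<^sup>2" using \<rho> by (simp add: power_mono)
  have "(norm x)\<^sup>2 powr (- (m / 2)) = pw (norm x)" "r\<^sup>2 powr (- (m/2)) = pw r" using x \<rho> by (auto intro!: powr_pw)
  moreover have "pw (norm x) \<le> pw r" using x \<rho> by (intro pw_antimono) auto
  ultimately show ?thesis
    using r2 \<rho>r2 by (simp add: H_def H'_def dot_square_norm max_absorb2 minus_divide_left)
qed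

text \<open>With K the integral of |x|^(1-n) over the shell and \<omega> the volume of the unit
  ball, splitting H gives \<omega> \<rho> + K - \<omega> r for its integral, because t^(1-n) times
  the volume of the ball of radius t is \<omega> t. \<open>H_identity\<close> says that n times the
  integral is (n - 1) K. The two linear relations determine both unknowns.\<close>

lemma integral_H:
  assumes n: "n = DIM('a::euclidean_space)"
  shows "(LINT x|lborel. H (x \<bullet> (x::'a))) = m * (measure lborel (ball (0::'a) 1) * (r - \<rho>))"
proof -
  define \<omega> where "\<omega> = measure lborel (ball (0::'a) 1)"
  let ?s = "\<lambda>x::'a. indicator (ball 0 r - cball 0 \<rho>) x * pw (norm x)"
  define K where "K = (LINT x|lborel. ?s x)"
  have vol: "measure lborel (ball (0::'a) t) = \<omega> * t ^ DIM('a)" "measure lborel (cball (0::'a) t) = \<omega> * t ^ DIM('a)"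
    if "0 < t" for t
    unfolding \<omega>_def using that by (simp_all add: content_ball content_cball)
  have pwD: "pw t * t ^ DIM('a) = t" if "0 < t" for t
  proof -
    have "t ^ DIM('a) = t ^ (n - 1) * t" unfolding n using DIM_positive[where 'a='a] by (metis Suc_diff_1 power_Suc2)
    then show ?thesis using that by (simp add: pw_eq)
  qed
  have ib: "integrable lborel (indicator (ball 0 r) :: 'a \<Rightarrow> real)" "integrable lborel (indicator (cball 0 \<rho>) :: 'a \<Rightarrow> real)"
    using emeasure_bounded_finite[OF bounded_ball, of "0::'a" r] emeasure_bounded_finite[OF bounded_cball, of "0::'a" \<rho>] by simp_all
  have ish: "integrable lborel ?s"
  proof (rule Bochner_Integration.integrable_bound[of _ "\<lambda>x. pw \<rho> * indicator (ball 0 r) x"])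
    show "AE x in lborel. norm (?s x) \<le> norm (pw \<rho> * indicator (ball 0 r) x)"
    proof (rule AE_I2)
      fix x :: 'a
      show "norm (?s x) \<le> norm (pw \<rho> * indicator (ball 0 r) x)"
      proof (cases "x \<in> ball 0 r - cball 0 \<rho>")
        case True
        then have "pw (norm x) \<le> pw \<rho>" using \<rho> by (intro pw_antimono) auto
        then show ?thesis using True \<rho> by (simp add: power_int_abs[symmetric])
      qed simp
    qed
    show "?s \<in> borel_measurable lborel"
    proof -
      have "continuous_on (ball 0 r - cball (0::'a) \<rho>) (\<lambda>x. inverse (norm x ^ (n - 1)))"
        using \<rho> by (intro continuous_intros) auto
      then have "(\<lambda>x::'a. indicator (ball 0 r - cball 0 \<rho>) x *\<^sub>R inverse (norm x ^ (n - 1))) \<in> borel_measurable borel"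
        by (intro borel_measurable_continuous_on_indicator) auto
      also have "(\<lambda>x::'a. indicator (ball 0 r - cball 0 \<rho>) x *\<^sub>R inverse (norm x ^ (n - 1))) = ?s"
      proof
        fix x :: 'a
        show "indicator (ball 0 r - cball 0 \<rho>) x *\<^sub>R inverse (norm x ^ (n - 1)) = ?s x"
        proof (cases "x \<in> ball 0 r - cball 0 \<rho>")
          case True
          then have "0 < norm x" using \<rho> by auto
          then show ?thesis using True pw_eq[of "norm x"] by simp
        qed simp
      qed
      finally show ?thesis by simp
    qed
  qed (use ib in auto)
  have "H (x \<bullet> x) = pw \<rho> * indicator (cball 0 \<rho>) x + ?s x - pw r * indicator (ball 0 r) x" for x :: 'a
  proof -
    consider "norm x \<le> \<rho>" | "\<rho> < norm x" "norm x < r" | "r \<le> norm x" by linarith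
    then show ?thesis
      by cases (use H_inside[of x] H_shell(1)[of x] H_outside[of x] \<rho> in \<open>auto simp: indicator_def\<close>)
  qed
  then have IH: "(LINT x|lborel. H (x \<bullet> (x::'a))) = (LINT x|lborel. pw \<rho> * indicator (cball (0::'a) \<rho>) x + ?s x - pw r * indicator (ball 0 r) x)"
    by simp
  also have "\<dots> = pw \<rho> * measure lborel (cball (0::'a) \<rho>) + K - pw r * measure lborel (ball (0::'a) r)"
    unfolding K_def using ib ish
    by (simp only: Bochner_Integration.integral_diff Bochner_Integration.integral_add Bochner_Integration.integrable_add
        integrable_mult_right integral_mult_right_zero) simp
  also have "\<dots> = \<omega> * \<rho> + K - \<omega> * r"
    using pwD[of \<rho>] pwD[of r] vol(1)[of r] vol(2)[of \<rho>] \<rho> by (simp add: mult.left_commute)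
  finally have I: "(LINT x|lborel. H (x \<bullet> (x::'a))) = \<omega> * \<rho> + K - \<omega> * r" .
  have "- 2 * (H' (x \<bullet> x) * (x \<bullet> x)) = m * ?s x" for x :: 'a
  proof -
    consider "norm x \<le> \<rho>" | "\<rho> < norm x" "norm x < r" | "r \<le> norm x" by linarith
    then show ?thesis
    proof cases
      case 2
      have "- 2 * (H' (x \<bullet> x) * (x \<bullet> x)) = - (2 * H' (x \<bullet> x) * (x \<bullet> x))" by simp
      also have "\<dots> = m * pw (norm x)" unfolding H_shell(2)[OF 2] by (simp add: algebra_simps)
      finally show ?thesis using 2 by simp
    qed (use H_inside[of x] H_outside[of x] \<rho> in auto)
  qed
  then have "- 2 * (LINT x|lborel. H' (x \<bullet> x) * (x \<bullet> (x::'a))) = m * K"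
    unfolding K_def integral_mult_right_zero[symmetric] by simp
  then have "real n * (\<omega> * \<rho> + K - \<omega> * r) = m * K" using H_identity[where 'a='a] I n by simp
  then have "K = real n * (\<omega> * (r - \<rho>))" by (simp add: algebra_simps)
  then show ?thesis unfolding I \<omega>_def[symmetric] by (simp add: algebra_simps)
qed

text \<open>On the left stands n - 1 times the integrand of the monotonicity formula. In the shell
  the term with H' removes (n - 1) |x|^(1-n) (1 - c^2) from the power in H, leaving (n - 1)
  |x|^(1-n) c^2, and c^4/8 \<le> c^2 because |c| \<le> 1.\<close>

lemma pointwise_bound:
  fixes x g :: "'a::euclidean_space"
  assumes g: "norm g \<le> 1"
  defines "c \<equiv> (x /\<^sub>R norm x) \<bullet> g"
  shows "m * (pw \<rho> * indicator (ball 0 \<rho>) x - pw r * indicator (ball 0 r) x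
      + indicator (ball 0 r - ball 0 \<rho>) x * (pw (norm x) * c ^ 4) / 8)
    \<le> (real n - g \<bullet> g) * H (x \<bullet> x) + 2 * H' (x \<bullet> x) * (x \<bullet> x - (x \<bullet> g)\<^sup>2)"
proof -
  have gg: "m \<le> real n - g \<bullet> g" using g by (simp add: dot_square_norm power_le_one)
  have c2: "c\<^sup>2 \<le> 1"
  proof -
    have "\<bar>c\<bar> \<le> norm (x /\<^sub>R norm x) * norm g" unfolding c_def by (rule Cauchy_Schwarz_ineq2)
    also have "\<dots> \<le> 1" using g by (cases "x = 0") auto
    finally show ?thesis by (simp add: abs_square_le_1)
  qed
  have "c ^ 4 = c\<^sup>2 * c\<^sup>2" by (simp add: power_even_eq[of c 2, simplified] power2_eq_square[of "c\<^sup>2"])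
  also have "\<dots> \<le> c\<^sup>2" by (rule mult_left_le) (use c2 in auto)
  finally have c4: "c ^ 4 \<le> c\<^sup>2" .
  consider "norm x < \<rho>" | "norm x = \<rho>" | "\<rho> < norm x" "norm x < r" | "r \<le> norm x" by linarith
  then show ?thesis
  proof cases
    case 1
    have "m * (pw \<rho> - pw r) \<le> (real n - g \<bullet> g) * (pw \<rho> - pw r)"
      using gg pw_antimono[of \<rho> r] \<rho> by (intro mult_right_mono) auto
    then show ?thesis using 1 \<rho> H_inside[of x] by (simp add: indicator_def)
  next
    \<comment> \<open>This sphere belongs to the region where the weight c^4/8 is integrated,
      although \<open>H'\<close> vanishes on it. It lies outside the open ball of radius \<rho>, so
      the term \<open>pw \<rho>\<close> is missing on the left and leaves room for the
      weight.\<close>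
    case 2
    have "m * (- pw r + pw \<rho> * c ^ 4 / 8) \<le> m * (pw \<rho> - pw r)"
    proof (rule mult_left_mono)
      have "pw \<rho> * c ^ 4 \<le> pw \<rho> * 1" using c4 c2 pw_pos[OF \<rho>(1)] by (intro mult_left_mono) auto
      then show "- pw r + pw \<rho> * c ^ 4 / 8 \<le> pw \<rho> - pw r" using pw_pos[OF \<rho>(1)] by linarith
    qed (use m_pos in simp)
    also have "\<dots> \<le> (real n - g \<bullet> g) * (pw \<rho> - pw r)"
      using gg pw_antimono[of \<rho> r] \<rho> by (intro mult_right_mono) auto
    finally show ?thesis using 2 \<rho> H_inside[of x] by (simp add: indicator_def)
  next
    case 3
    have nx: "0 < norm x" using 3 \<rho> by linarith
    have xg: "(x \<bullet> g)\<^sup>2 = (x \<bullet> x) * c\<^sup>2"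
      unfolding c_def using nx by (simp add: dot_square_norm power_mult_distrib field_simps)
    have q: "0 < pw (norm x)" using nx by (rule pw_pos)
    have "m * (- pw r + pw (norm x) * c ^ 4 / 8) \<le> m * (pw (norm x) - pw r) - m * pw (norm x) * (1 - c\<^sup>2)"
    proof -
      have "c ^ 4 / 8 \<le> c\<^sup>2" using c4 zero_le_power2[of c] by linarith
      then have "m * pw (norm x) * (c ^ 4 / 8) \<le> m * pw (norm x) * c\<^sup>2"
        using m_pos q by (intro mult_left_mono) auto
      moreover have "M * (- a + b * q / 8) \<le> M * (b - a) - M * b * (1 - d)"
        if "M * b * (q / 8) \<le> M * b * d" for M a b q d :: real
        using that by (simp add: algebra_simps)
      ultimately show ?thesis by blast
    qed
    also have "\<dots> \<le> (real n - g \<bullet> g) * (pw (norm x) - pw r) - m * pw (norm x) * (1 - c\<^sup>2)"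
      using gg pw_antimono[of "norm x" r] nx 3 by (intro diff_right_mono mult_right_mono) auto
    also have "\<dots> = (real n - g \<bullet> g) * H (x \<bullet> x) + (2 * H' (x \<bullet> x) * (x \<bullet> x)) * (1 - c\<^sup>2)"
      unfolding H_shell[OF 3] by (simp add: algebra_simps)
    also have "\<dots> = (real n - g \<bullet> g) * H (x \<bullet> x) + 2 * H' (x \<bullet> x) * (x \<bullet> x - (x \<bullet> g)\<^sup>2)"
      unfolding xg by (simp add: algebra_simps)
    finally show ?thesis using 3 \<rho> by (simp add: indicator_def)
  next
    case 4
    then show ?thesis using \<rho> H_outside[of x] by (simp add: indicator_def)
  qed
qed

end

context V_minimizer
begin

definition tilt :: "nat \<Rightarrow> 'a \<Rightarrow> real" where
  "tilt j x = norm x powi (1 - int DIM('a)) * ((x /\<^sub>R norm x) \<bullet> nrm j x) ^ 4"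

lemma tilt_integrable:
  assumes j: "j \<le> 2" and "0 < \<rho>" "\<rho> < r" "r < R"
  shows "set_integrable (var j) (ball 0 r - ball 0 \<rho>) (tilt j)"
proof -
  interpret vec_measure \<Omega> "DE j" by (rule vec_measure_DE[OF j])
  have sh: "ball 0 r - ball 0 \<rho> \<in> sets TV"
    unfolding sets_TV using assms by (intro sets.Diff open_in_restrict_borel subset_ball) auto
  show ?thesis
    unfolding set_integrable_def
  proof (rule TV.integrable_const_bound[of _ "\<rho> powi (1 - int DIM('a))"])
    show "AE x in TV. norm (indicator (ball 0 r - ball 0 \<rho>) x *\<^sub>R tilt j x) \<le> \<rho> powi (1 - int DIM('a))"
      using norm_rn_density_le
    proof eventually_elim
      case (elim x)
      let ?c = "(x /\<^sub>R norm x) \<bullet> \<nu> x"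
      show ?case
      proof (cases "x \<in> ball 0 r - ball 0 \<rho>")
        case True
        then have nx: "\<rho> \<le> norm x" "0 < norm x" using assms(2) by auto
        have "\<bar>?c\<bar> \<le> norm (x /\<^sub>R norm x) * norm (\<nu> x)" by (rule Cauchy_Schwarz_ineq2)
        also have "\<dots> \<le> 1" using elim nx by simp
        finally have "\<bar>?c ^ 4\<bar> \<le> 1" unfolding power_abs by (intro power_le_one abs_ge_zero)
        moreover have "norm x powi (1 - int DIM('a)) \<le> \<rho> powi (1 - int DIM('a))"
          using nx assms(2) by (simp add: powi_one_minus(1)[OF _ DIM_ge_Suc0[where 'a='a, unfolded One_nat_def[symmetric]]] le_imp_inverse_le power_mono)
        ultimately have "norm x powi (1 - int DIM('a)) * \<bar>?c ^ 4\<bar> \<le> \<rho> powi (1 - int DIM('a)) * 1"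
          using assms(2) by (intro mult_mono) auto
        then show ?thesis using True nx by (simp add: tilt_def abs_mult)
      qed (use assms(2) in simp)
    qed
    have id: "(\<lambda>x. x) \<in> borel_measurable TV" by (rule measurable_TV_of_borel) simp
    have [measurable]: "(\<lambda>x. (x /\<^sub>R norm x) \<bullet> \<nu> x) \<in> borel_measurable TV"
      by (intro borel_measurable_inner borel_measurable_scaleR borel_measurable_inverse
          measurable_TV_of_borel[OF borel_measurable_norm] id measurable_rn_density)
    \<comment> \<open>As an inverse power the factor is evidently measurable. The rewriting assumes
      a positive base, so the value at the origin is split off.\<close>
    have eq: "(\<lambda>x::'a. norm x powi (1 - int DIM('a))) =
        (\<lambda>x. if x = 0 then 0 powi (1 - int DIM('a)) else inverse (norm x ^ (DIM('a) - 1)))"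
      using powi_one_minus(1)[of "norm _" "DIM('a)"] DIM_positive[where 'a='a] by (auto simp: fun_eq_iff)
    have [measurable]: "(\<lambda>x::'a. norm x powi (1 - int DIM('a))) \<in> borel_measurable TV"
      unfolding eq by (rule measurable_TV_of_borel) measurable
    show "(\<lambda>x. indicator (ball 0 r - ball 0 \<rho>) x *\<^sub>R tilt j x) \<in> borel_measurable TV"
      unfolding tilt_def using sh by measurable
  qed
qed

lemma monotonicity:
  "\<exists>C. \<forall>\<rho> r. 0 < \<rho> \<and> \<rho> < r \<and> r < R \<longrightarrow>
    \<rho> powi (1 - int DIM('a)) * F_S \<alpha> \<Omega> E (ball 0 \<rho>) + C * \<rho>
      + (\<Sum>j\<le>2. \<alpha> j / 8 * (LINT x:(ball 0 r - ball 0 \<rho>)|var j. tilt j x))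
    \<le> r powi (1 - int DIM('a)) * F_S \<alpha> \<Omega> E (ball 0 r) + C * r"
proof -
  obtain \<Lambda> where \<Lambda>0: "0 \<le> \<Lambda>" and \<Lambda>: "\<forall>c h h'. 0 < c \<and> c < R\<^sup>2 \<and> radial_profile c h h' \<longrightarrow>
    (\<Sum>j\<le>2. \<alpha> j * (LINT x|var j. radial_tension h h' j x))
      \<le> \<Lambda> * (LINT x|lborel. h (x \<bullet> (x::'a)))"
    using radial_variation by blast
  \<comment> \<open>\<Lambda> times the integral of H, divided by n - 1, is C (r - \<rho>) by
    \<open>integral_H\<close>.\<close>
  define C where "C = \<Lambda> * measure lborel (ball (0::'a) 1)"
  have "\<rho> powi (1 - int DIM('a)) * F_S \<alpha> \<Omega> E (ball 0 \<rho>) + C * \<rho>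
      + (\<Sum>j\<le>2. \<alpha> j / 8 * (LINT x:(ball 0 r - ball 0 \<rho>)|var j. tilt j x))
    \<le> r powi (1 - int DIM('a)) * F_S \<alpha> \<Omega> E (ball 0 r) + C * r" if \<rho>r: "0 < \<rho>" "\<rho> < r" "r < R" for \<rho> r
  proof -
    let ?pw = "\<lambda>t::real. t powi (1 - int DIM('a))" and ?m = "real DIM('a) - 1"
    let ?L = "\<lambda>j. LINT x:(ball 0 r - ball 0 \<rho>)|var j. tilt j x"
    let ?f = "\<lambda>j x. ?pw \<rho> * indicator (ball 0 \<rho>) x - ?pw r * indicator (ball 0 r) x
        + indicator (ball 0 r - ball 0 \<rho>) x *\<^sub>R tilt j x / 8"
    have f: "integrable (var j) (?f j)"
      "(LINT x|var j. ?f j x) = ?pw \<rho> * measure (var j) (ball 0 \<rho>) - ?pw r * measure (var j) (ball 0 r) + ?L j / 8"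
      if j: "j \<le> 2" for j
    proof -
      interpret vec_measure \<Omega> "DE j" by (rule vec_measure_DE[OF j])
      have B: "ball 0 \<rho> \<in> S" "ball 0 r \<in> S" using \<rho>r by (auto intro!: open_in_restrict_borel subset_ball)
      have i: "integrable TV (indicator B :: 'a \<Rightarrow> real)" "(LINT x|TV. indicator B x) = measure TV B" if "B \<in> S" for B
      proof -
        show "integrable TV (indicator B :: 'a \<Rightarrow> real)"
          by (rule TV.integrable_const_bound[of _ 1]) (use that in \<open>auto simp: indicator_def\<close>)
        show "(LINT x|TV. indicator B x) = measure TV B"
          using S_subset[OF that] by (simp add: Int_absorb2)
      qed
      have t: "integrable TV (\<lambda>x. indicator (ball 0 r - ball 0 \<rho>) x *\<^sub>R tilt j x)"
        using tilt_integrable[OF j \<rho>r] unfolding set_integrable_def .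
      note int = integrable_mult_right[OF i(1)[OF B(1)], of "?pw \<rho>"] integrable_mult_right[OF i(1)[OF B(2)], of "?pw r"]
        integrable_divide[OF t, of 8]
      show "integrable TV (?f j)"
        by (intro Bochner_Integration.integrable_add Bochner_Integration.integrable_diff int)
      show "(LINT x|TV. ?f j x) = ?pw \<rho> * measure TV (ball 0 \<rho>) - ?pw r * measure TV (ball 0 r) + ?L j / 8"
        unfolding Bochner_Integration.integral_add[OF Bochner_Integration.integrable_diff[OF int(1,2)] int(3)]
          Bochner_Integration.integral_diff[OF int(1,2)] integral_mult_right_zero integral_divide_zero
          i(2)[OF B(1)] i(2)[OF B(2)] set_lebesgue_integral_def ..
    qed
    have key: "(\<Sum>j\<le>2. \<alpha> j * (LINT x|var j. ?f j x)) \<le> C * (r - \<rho>)"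
    proof (cases "DIM('a) = 1")
      \<comment> \<open>Here n - 1 = 0 and \<open>?pw\<close> is constantly 1, so the variation
        carries no information. The integrand is 0 on the inner ball and almost everywhere equal to
        -1 plus at most 1/8 on the shell, hence nonpositive.\<close>
      case True
      have "(\<Sum>j\<le>2. \<alpha> j * (LINT x|var j. ?f j x)) \<le> 0"
      proof (intro sum_nonpos mult_nonneg_nonpos)
        fix j :: nat assume "j \<in> {..2}"
        then have j: "j \<le> 2" by simp
        then show "0 \<le> \<alpha> j" using \<alpha>_pos[OF j] by simp
        interpret vec_measure \<Omega> "DE j" by (rule vec_measure_DE[OF j])
        have "AE x in TV. ?f j x \<le> 0"
          using norm_rn_density_le
        proof eventually_elim
          case (elim x)
          let ?c = "(x /\<^sub>R norm x) \<bullet> \<nu> x"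
          have "\<bar>?c\<bar> \<le> norm (x /\<^sub>R norm x) * norm (\<nu> x)" by (rule Cauchy_Schwarz_ineq2)
          also have "\<dots> \<le> 1" using elim by (cases "x = 0") auto
          finally have "\<bar>?c ^ 4\<bar> \<le> 1" unfolding power_abs by (intro power_le_one abs_ge_zero)
          then have "?c ^ 4 \<le> 1" by linarith
          then show ?case using \<rho>r True by (auto simp: tilt_def indicator_def)
        qed
        then have "(LINT x|TV. ?f j x) \<le> (LINT x|TV. 0)" using f(1)[OF j] by (intro integral_mono_AE) auto
        then show "(LINT x|TV. ?f j x) \<le> 0" by simp
      qed
      also have "0 \<le> C * (r - \<rho>)" using \<Lambda>0 \<rho>r by (simp add: C_def)
      finally show ?thesis .
    next
      case False
      then have "1 < DIM('a)" using DIM_positive[where 'a='a] by linarith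
      then have p: "0 < ?m / 2" by simp
      interpret cutoff_dim \<rho> r "DIM('a)" by unfold_locales (use \<rho>r p in auto)
      note cv = cutoff_variation[OF \<rho>r p \<Lambda>]
      \<comment> \<open>The factor n - 1 of the pointwise bound reappears in the integral of H;
        being positive here, it cancels at the end.\<close>
      have "?m * (\<Sum>j\<le>2. \<alpha> j * (LINT x|var j. ?f j x)) = (\<Sum>j\<le>2. \<alpha> j * (LINT x|var j. ?m * ?f j x))"
        by (simp only: sum_distrib_left integral_mult_right_zero mult.left_commute)
      also have "\<dots> \<le> (\<Sum>j\<le>2. \<alpha> j * (LINT x|var j. radial_tension H H' j x))"
      proof (intro sum_mono mult_left_mono)
        fix j :: nat assume "j \<in> {..2}"
        then have j: "j \<le> 2" by simp
        then show "0 \<le> \<alpha> j" using \<alpha>_pos[OF j] by simp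
        interpret vec_measure \<Omega> "DE j" by (rule vec_measure_DE[OF j])
        show "(LINT x|TV. ?m * ?f j x) \<le> (LINT x|TV. (real DIM('a) - \<nu> x \<bullet> \<nu> x) * H (x \<bullet> x)
          + 2 * H' (x \<bullet> x) * (x \<bullet> x - (x \<bullet> \<nu> x)\<^sup>2))"
        proof (rule integral_mono_AE[OF integrable_mult_right[OF f(1)[OF j]] cv(2)[OF j]])
          show "AE x in TV. ?m * ?f j x \<le> (real DIM('a) - \<nu> x \<bullet> \<nu> x) * H (x \<bullet> x)
            + 2 * H' (x \<bullet> x) * (x \<bullet> x - (x \<bullet> \<nu> x)\<^sup>2)"
            using norm_rn_density_le
          proof eventually_elim
            case (elim x)
            from pointwise_bound[OF elim, of x] show ?case by (simp add: tilt_def)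
          qed
        qed
      qed
      also have "\<dots> \<le> \<Lambda> * (LINT x|lborel. H (x \<bullet> (x::'a)))" by (rule cv(1))
      also have "\<dots> = ?m * (C * (r - \<rho>))" unfolding integral_H[OF refl] C_def by simp
      finally show ?thesis using m_pos by simp
    qed
    have "(\<Sum>j\<le>2. \<alpha> j * (LINT x|var j. ?f j x))
        = (\<Sum>j\<le>2. \<alpha> j * (?pw \<rho> * measure (var j) (ball 0 \<rho>) - ?pw r * measure (var j) (ball 0 r) + ?L j / 8))"
      using f(2) by (intro sum.cong) auto
    also have "\<dots> = ?pw \<rho> * F_S \<alpha> \<Omega> E (ball 0 \<rho>) - ?pw r * F_S \<alpha> \<Omega> E (ball 0 r) + (\<Sum>j\<le>2. \<alpha> j / 8 * ?L j)"
      unfolding F_S_def by (simp add: algebra_simps sum.distrib sum_subtractf sum_distrib_left)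
    finally show ?thesis using key by (simp add: algebra_simps)
  qed
  then show ?thesis by blast
qed

end

theorem corollary5p2:
  fixes E :: "nat \<Rightarrow> 'a::euclidean_space set"
    and v :: "nat \<Rightarrow> real"
    and \<sigma>01 \<sigma>02 \<sigma>12 R :: real
  defines "\<alpha> \<equiv> alpha \<sigma>01 \<sigma>02 \<sigma>12"
  assumes "\<forall>j\<le>2. 0 < \<alpha> j"
    and "0 < R"
    and "\<forall>j\<le>2. indicator (E j) \<in> BV (ball 0 R)"
    and "V_permissible (ball 0 R) v E"
    and "\<forall>A. A \<subset>\<subset> ball 0 R \<longrightarrow> Psi_V \<alpha> (ball 0 R) v E A = 0"
  shows "\<exists>C. \<forall>\<rho> r. 0 < \<rho> \<and> \<rho> < r \<and> r < R \<longrightarrow>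
    \<rho> powi (1 - int DIM('a)) * F_S \<alpha> (ball 0 R) E (ball 0 \<rho>) + C * \<rho>
      + (\<Sum>j\<le>2. \<alpha> j / 8 *
          (LINT x:(ball 0 r - ball 0 \<rho>)|total_variation (ball 0 R) (Dchi (ball 0 R) (E j)).
             norm x powi (1 - int DIM('a)) *
             ((x /\<^sub>R norm x) \<bullet> rn_density (ball 0 R) (Dchi (ball 0 R) (E j)) x) ^ 4))
    \<le> r powi (1 - int DIM('a)) * F_S \<alpha> (ball 0 R) E (ball 0 r) + C * r"
proof -
  interpret V_minimizer E v \<alpha> R
    by unfold_locales (use assms in auto)
  show ?thesis using monotonicity unfolding tilt_def .
qed

end
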